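(* Let $G$ be a finite group of order greater than $1$, let $q$ be the smallest prime divisor of $|G|$, and let $Q\in{\rm Syl}_q(G)$. Then ${\rm mf}_{pp}(G)\leq q$ if and only if $G$ is one of the following groups: (1) $G=Q\times R$, where $R\geq 1$ is a cyclic Hall $q'$-subgroup of $G$, and $Q$ is one of: $Q\cong Z_{q^m}$ with $m\geq 1$; or $Q\cong Z_{q^{m-1}}\times Z_q$ with $m\geq 2$; or $Q\cong Q_8$ (quaternion group of order $8$); or $Q\cong\langle a, b\mid a^{2^{m-1}}=b^2=1,\ b^{-1}ab=a^{1+2^{m-2}}\rangle$ with $m\geq 4$ (here $q=2$); or $Q\cong\langle a, b\mid a^{q^{m-1}}=b^q=1,\ b^{-1}ab=a^{1+q^{m-2}}\rangle$ with $q>2$ and $m\geq 3$. (2) $G\cong\langle a,b\mid a^{2^m}=b^3=1,\ a^{-1}ba=b^{-1}\rangle\times T$, where $m\geq 1$, $T$ is cyclic and $\gcd(|T|,6)=1$.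
   Context: All groups are finite. For a group $G$ and a positive integer $n$ dividing $|G|$, let $F_n(G)=\{g\in G\mid g^n=1\}$. By Frobenius' theorem $|F_n(G)|=f_n\cdot n$ for a positive integer $f_n$, called the Frobenius quotient of $G$ for $n$. ${\rm exp}(G)$ denotes the exponent of $G$. A prime-power divisor of ${\rm exp}(G)$ is a positive divisor $n$ of ${\rm exp}(G)$ of the form $n=p^k$ with $p$ prime and $k\geq 0$ (so $n=1$ is included). $\mathcal{F}_{pp}(G)=\{f_n\mid n \text{ is a prime-power divisor of } {\rm exp}(G)\}$ and ${\rm mf}_{pp}(G)$ is the maximum element of $\mathcal{F}_{pp}(G)$. *)

theory Defs
  imports "HOL-Algebra.Algebra"
begin

definition Fset :: "('a, 'b) monoid_scheme \<Rightarrow> nat \<Rightarrow> 'a set" where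
  "Fset G n = {g \<in> carrier G. g [^]\<^bsub>G\<^esub> n = \<one>\<^bsub>G\<^esub>}"

text \<open>Frobenius quotient f_n = |F_n(G)| / n (an integer by Frobenius' theorem when n divides |G|).\<close>
definition frob_quot :: "('a, 'b) monoid_scheme \<Rightarrow> nat \<Rightarrow> nat" where
  "frob_quot G n = card (Fset G n) div n"

definition group_exponent :: "('a, 'b) monoid_scheme \<Rightarrow> nat" where
  "group_exponent G = Lcm (group.ord G ` carrier G)"

definition pp_divisors :: "('a, 'b) monoid_scheme \<Rightarrow> nat set" where
  "pp_divisors G = {n. n dvd group_exponent G \<and> (\<exists>p k. Factorial_Ring.prime p \<and> n = p ^ k)}"

definition mf_pp :: "('a, 'b) monoid_scheme \<Rightarrow> nat" where
  "mf_pp G = Max (frob_quot G ` pp_divisors G)"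

text \<open>The group with presentation < a, b | a^N = b^M = 1, b^-1 a b = a^r >
  (for r^M = 1 mod N), realised on normal forms b^j a^i, encoded as the pair (j, i):
  b^j a^i * b^l a^k = b^(j+l) a^(i r^l + k).\<close>
definition metacyc :: "nat \<Rightarrow> nat \<Rightarrow> nat \<Rightarrow> (nat \<times> nat) monoid" where
  "metacyc M N r = \<lparr>carrier = {0..<M} \<times> {0..<N},
     monoid.mult = (\<lambda>(j, i) (l, k). ((j + l) mod M, (i * r ^ l + k) mod N)),
     monoid.one = (0, 0)\<rparr>"

text \<open>Quaternion group Q_8 = < a, b | a^4 = 1, b^2 = a^2, b^-1 a b = a^-1 >,
  normal forms b^j a^i encoded as (j, i).\<close>
definition quaternion8 :: "(nat \<times> nat) monoid" where
  "quaternion8 = \<lparr>carrier = {0..<2} \<times> {0..<4},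
     monoid.mult = (\<lambda>(j, i) (l, k). ((j + l) mod 2,
               (i * 3 ^ l + k + (if j = 1 \<and> l = 1 then 2 else 0)) mod 4)),
     monoid.one = (0, 0)\<rparr>"

end

theory Submission
  imports Defs "HOL-Number_Theory.Residues"
begin

text \<open>
  If the largest prime-power Frobenius quotient is at most \<open>q\<close>, then a Sylow \<open>p\<close>-subgroup \<open>P\<close> has an
  element of order \<open>p\<^sup>e\<close> with \<open>\<bar>P\<bar> < (q + 1) p\<^sup>e\<close>. Hence \<open>P\<close> is cyclic for \<open>p > q\<close>, and \<open>Q\<close> has a
  cyclic subgroup of index at most \<open>q\<close>. A cyclic Sylow subgroup of order \<open>p\<^sup>n\<close> with \<open>N\<close> conjugates
  forces at least \<open>p\<^sup>n + (N - 1) (p\<^sup>n - p\<^sup>n\<^sup>-\<^sup>1)\<close> solutions of \<open>x\<^bsup>p\<^sup>n\<^esup> = 1\<close>, and \<open>N\<close> is \<open>1\<close> modulo \<open>p\<close>.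
  So \<open>N = 1\<close> for \<open>p > q\<close>, which makes the Hall \<open>q'\<close>-subgroup \<open>R\<close> cyclic and normal, while for
  \<open>p = q\<close> either \<open>N = 1\<close> or \<open>N = q + 1\<close>. The latter divides the order of the group, so \<open>q = 2\<close>
  and \<open>N = 3\<close>: then \<open>Q\<close> centralises the cubes in \<open>R\<close> and inverts an element of order \<open>3\<close>, which
  is case (2). If \<open>Q\<close> is not cyclic, two distinct conjugates of \<open>Q\<close> already contain too many
  elements, so \<open>Q\<close> is normal; among the \<open>q\<close>-groups with a cyclic maximal subgroup, the
  dihedral, semidihedral and larger quaternion groups have too many solutions of
  \<open>x\<^sup>2 = 1\<close> or \<open>x\<^sup>4 = 1\<close>.
\<close>

section \<open>Solutions of power equations in finite groups\<close>

text \<open>The quotient in \<open>frob_quot\<close> is truncated, so f_n \<le> q is used throughout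
  as the strict inequality |F_n(G)| < (q + 1) n, and lower bounds on the number of solutions are
  played against it. The obstacle is that the hypothesis only counts elements, while the conclusion
  asks for normal subgroups. The bridge is that \<open>Fset G n\<close> is invariant under
  conjugation: once it is known to be a subgroup it is normal, and cyclic solution sets of coprime
  orders multiply to a cyclic one. R is found in this way, as a solution set. The exceptional family
  is an extremal case of the count: q + 1 cyclic Sylow subgroups of order q^n force q^n + q (q^n -
  q^(n-1)) = q * q^n solutions, which the hypothesis still admits. The dihedral group of order 8
  just fails, with 6 = 3 * 2 solutions of x^2 = 1. Inside G, elements are handled through normal
  forms b^j a^i. There q-th powers are governed by the geometric sum of the powers of r^j modulo
  q^n, where b^-1 a b = a^r: whether that sum is q times a unit separates the modular groups from
  the others.\<close>

locale finite_group = group G for G (structure) +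
  assumes fin [simp]: "finite (carrier G)"

text \<open>Such an i is determined by the quotient \<open>i * n div d\<close>, which is smaller
  than n. This is the bound of n solutions of x^n = 1 in a cyclic group of order d, stated for
  exponents.\<close>

lemma card_roots_mod_le:
  assumes "n > 0" "d > 0" shows "card {i \<in> {..<d}. d dvd i * n} \<le> (n::nat)"
proof -
  let ?A = "{i \<in> {..<d}. d dvd i * n}"
  have "inj_on (\<lambda>i. i * n div d) ?A"
  proof (rule inj_onI)
    fix i j assume ij: "i \<in> ?A" "j \<in> ?A" "i * n div d = j * n div d"
    then have "i * n = j * n" by (metis (no_types, lifting) dvd_div_mult_self mem_Collect_eq)
    then show "i = j" using assms by simp
  qed
  moreover have "(\<lambda>i. i * n div d) ` ?A \<subseteq> {..<n}"
    using assms by (auto simp: less_mult_imp_div_less mult.commute)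
  ultimately show ?thesis using card_inj_on_le[of "\<lambda>i. i * n div d" ?A "{..<n}"] by simp
qed

context group begin

lemma pow_mod_eq:
  assumes "x \<in> carrier G" "x [^] (N::nat) = \<one>"
  shows "x [^] (i mod N) = x [^] (i::nat)"
proof -
  have "x [^] (N * (i div N) + i mod N) = (x [^] N) [^] (i div N) \<otimes> x [^] (i mod N)"
    using assms(1) by (simp only: nat_pow_mult[symmetric] nat_pow_pow nat_pow_closed)
  then show ?thesis using assms by simp
qed

lemma pow_cong:
  assumes "x \<in> carrier G" "x [^] (N::nat) = \<one>" "i mod N = j mod N"
  shows "x [^] (i::nat) = x [^] (j::nat)"
  using pow_mod_eq[OF assms(1,2)] assms(3) by metis

lemma pow_eq_iff_mod:
  assumes "x \<in> carrier G"
  shows "x [^] (i::nat) = x [^] j \<longleftrightarrow> i mod ord x = j mod ord x"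
proof -
  have "x [^] i = x [^] j \<longleftrightarrow> int (ord x) dvd int j - int i"
    using int_pow_eq[OF assms, of "int i" "int j"] by (simp add: int_pow_int)
  also have "\<dots> \<longleftrightarrow> int j mod int (ord x) = int i mod int (ord x)"
    by (simp add: mod_eq_dvd_iff)
  also have "\<dots> \<longleftrightarrow> i mod ord x = j mod ord x"
    by (metis of_nat_eq_iff of_nat_mod)
  finally show ?thesis .
qed

lemma Fset_subgroup:
  assumes "H \<subseteq> carrier G"
  shows "Fset (G\<lparr>carrier := H\<rparr>) n = Fset G n \<inter> H"
  using assms by (auto simp: Fset_def nat_pow_consistent[symmetric])

lemma ord_subgroup: "group.ord (G\<lparr>carrier := H\<rparr>) x = ord x" if "subgroup H G"
  using that by (simp add: group.ord_def subgroup_imp_group ord_def nat_pow_consistent[symmetric])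

lemma conj_pow:
  assumes "g \<in> carrier G" "x \<in> carrier G"
  shows "(g \<otimes> x \<otimes> inv g) [^] (n::nat) = g \<otimes> x [^] n \<otimes> inv g"
proof (induction n)
  case (Suc n)
  have "(g \<otimes> x \<otimes> inv g) [^] Suc n = g \<otimes> x [^] n \<otimes> (inv g \<otimes> g) \<otimes> (x \<otimes> inv g)"
    using Suc assms by (simp only: nat_pow_Suc m_assoc nat_pow_closed inv_closed m_closed)
  then show ?case using assms by (simp add: m_assoc)
qed (use assms in simp)

lemma Fset_conj:
  assumes "g \<in> carrier G" "x \<in> Fset G n"
  shows "g \<otimes> x \<otimes> inv g \<in> Fset G n"
  using assms by (auto simp: Fset_def conj_pow)

end

context finite_group begin

lemma ord_pos [simp]: "x \<in> carrier G \<Longrightarrow> ord x > 0"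
  using ord_ge_1[OF fin, of x] by simp

lemma generate_eq_powers:
  assumes "x \<in> carrier G"
  shows "generate G {x} = (\<lambda>i::nat. x [^] i) ` {..<ord x}"
proof -
  have "{0..ord x - 1} = {..<ord x}" using ord_pos[OF assms] by auto
  then show ?thesis
    unfolding generate_pow_on_finite_carrier[OF fin assms] ord_elems[OF fin assms] by auto
qed

lemma pow_in_generate: "x \<in> carrier G \<Longrightarrow> x [^] (i::nat) \<in> generate G {x}"
  using generate_pow_on_finite_carrier[OF fin] by blast

lemma generate_eqI:
  assumes "subgroup H G" "x \<in> H" "ord x = card H"
  shows "generate G {x} = H"
proof -
  have "generate G {x} \<subseteq> H" using assms by (intro generate_subgroup_incl) auto
  moreover have "x \<in> carrier G" using assms subgroup.mem_carrier by fast
  moreover have "finite H" using assms(1) subgroup.subset finite_subset fin by metis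
  ultimately show ?thesis using generate_pow_card[of x] assms(3) by (metis card_subset_eq)
qed

lemma finite_subgroup: "subgroup H G \<Longrightarrow> finite H"
  using subgroup.subset finite_subset fin by metis

lemma card_subgroup_dvd: "subgroup H G \<Longrightarrow> card H dvd order G"
  using lagrange by (metis dvd_triv_right)

lemma card_subgroup_mono_dvd:
  assumes "subgroup H G" "subgroup K G" "H \<subseteq> K"
  shows "card H dvd card K"
proof -
  have "subgroup H (G\<lparr>carrier := K\<rparr>)" using assms subgroup_incl by blast
  then show ?thesis
    using group.lagrange[OF subgroup_imp_group[OF assms(2)]] unfolding order_def
    by (metis dvd_triv_right partial_object.simps(1) partial_object.surjective partial_object.update_convs(1))
qed

lemma ord_dvd_card_subgroup:
  assumes "subgroup H G" "x \<in> H" shows "ord x dvd card H"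
  using group.ord_dvd_group_order[OF subgroup_imp_group[OF assms(1)], of x] assms
  by (simp add: ord_subgroup order_def)

lemma finite_Fset [simp]: "finite (Fset G n)"
  by (rule finite_subset[OF _ fin]) (auto simp: Fset_def)

lemma Fset_iff_ord: "x \<in> Fset G n \<longleftrightarrow> x \<in> carrier G \<and> ord x dvd n"
  by (auto simp: Fset_def pow_eq_id)

lemma Fset_coprime:
  assumes "coprime n (order G)" shows "Fset G n = {\<one>}"
proof -
  have "x = \<one>" if "x \<in> Fset G n" for x
  proof -
    have "x \<in> carrier G" "ord x dvd n" "ord x dvd order G"
      using that by (auto simp: Fset_iff_ord ord_dvd_group_order)
    with assms have "ord x = 1" by (metis coprime_def is_unit_gcd gcd_greatest_iff nat_dvd_1_iff_1)
    then show ?thesis using \<open>x \<in> carrier G\<close> ord_eq_1 by blast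
  qed
  then show ?thesis by (auto simp: Fset_def)
qed

lemma card_Fset_cyclic_le:
  assumes "x \<in> carrier G" "carrier G = generate G {x}" "n > 0"
  shows "card (Fset G n) \<le> n"
proof -
  have "Fset G n \<subseteq> (\<lambda>i::nat. x [^] i) ` {i \<in> {..<ord x}. ord x dvd i * n}"
    using assms generate_eq_powers[OF assms(1)] by (auto simp: Fset_def nat_pow_pow pow_eq_id)
  then have "card (Fset G n) \<le> card {i \<in> {..<ord x}. ord x dvd i * n}"
    by (rule surj_card_le[rotated]) simp
  also have "\<dots> \<le> n" using card_roots_mod_le assms by simp
  finally show ?thesis .
qed

text \<open>The pairs with product h k are exactly (h z, z^-1 k) with z in the intersection, so
  every fibre of the multiplication map on \<open>H \<times> K\<close> has
  \<open>card (H \<inter> K)\<close> elements.\<close>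

lemma card_set_mult:
  assumes H: "subgroup H G" and K: "subgroup K G"
  shows "card (H <#> K) * card (H \<inter> K) = card H * card K"
proof -
  interpret H: subgroup H G by fact
  interpret K: subgroup K G by fact
  let ?f = "\<lambda>(h,k). h \<otimes> k"
  have fib: "card {z \<in> H \<times> K. ?f z = y} = card (H \<inter> K)" if "y \<in> H <#> K" for y
  proof -
    from that obtain h k where hk: "h \<in> H" "k \<in> K" "y = h \<otimes> k" by (auto simp: set_mult_def)
    have "bij_betw (\<lambda>z. (h \<otimes> z, inv z \<otimes> k)) (H \<inter> K) {z \<in> H \<times> K. ?f z = y}"
    proof (rule bij_betw_byWitness[where f' = "\<lambda>(u,v). inv h \<otimes> u"])
      show "\<forall>z\<in>H \<inter> K. (case (h \<otimes> z, inv z \<otimes> k) of (u, v) \<Rightarrow> inv h \<otimes> u) = z"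
        using hk by (auto simp: m_assoc[symmetric])
      have "inv (inv h \<otimes> u) \<otimes> k = v \<and> inv h \<otimes> u = k \<otimes> inv v"
        if "u \<in> H" "v \<in> K" "u \<otimes> v = h \<otimes> k" for u v
      proof -
        have c: "u \<in> carrier G" "v \<in> carrier G" "h \<in> carrier G" "k \<in> carrier G"
          using that hk by auto
        have "inv h \<otimes> u \<otimes> v = k" using that(3) c by (simp add: m_assoc inv_solve_left')
        then have "inv h \<otimes> u = k \<otimes> inv v" using c by (metis inv_closed inv_solve_right m_closed)
        then show ?thesis using c by (simp add: inv_mult_group m_assoc)
      qed
      then show "\<forall>z\<in>{z \<in> H \<times> K. ?f z = y}. (h \<otimes> (case z of (u, v) \<Rightarrow> inv h \<otimes> u),
            inv (case z of (u, v) \<Rightarrow> inv h \<otimes> u) \<otimes> k) = z"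
         "(\<lambda>(u,v). inv h \<otimes> u) ` {z \<in> H \<times> K. ?f z = y} \<subseteq> H \<inter> K"
        using hk by (fastforce simp: m_assoc[symmetric] image_iff)+
      have "h \<otimes> z \<otimes> (inv z \<otimes> k) = h \<otimes> k" if "z \<in> H" "z \<in> K" for z
      proof -
        have c: "z \<in> carrier G" "h \<in> carrier G" "k \<in> carrier G" using that hk by auto
        have "h \<otimes> z \<otimes> (inv z \<otimes> k) = h \<otimes> (z \<otimes> inv z) \<otimes> k"
          using c by (simp only: m_assoc m_closed inv_closed)
        then show ?thesis using c by simp
      qed
      then show "(\<lambda>z. (h \<otimes> z, inv z \<otimes> k)) ` (H \<inter> K) \<subseteq> {z \<in> H \<times> K. ?f z = y}"
        using hk by auto
    qed
    from bij_betw_same_card[OF this] show ?thesis by simp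
  qed
  have fin': "finite (H \<times> K)" using finite_subgroup[OF H] finite_subgroup[OF K] by simp
  have img: "?f ` (H \<times> K) = H <#> K" by (auto simp: set_mult_def)
  have "card H * card K = (\<Sum>z\<in>H \<times> K. 1::nat)" by (simp add: card_cartesian_product)
  also have "\<dots> = (\<Sum>y\<in>H <#> K. \<Sum>z\<in>{z \<in> H \<times> K. ?f z = y}. 1)"
    using sum.image_gen[OF fin', of "\<lambda>_. 1::nat" ?f] unfolding img .
  also have "\<dots> = card (H <#> K) * card (H \<inter> K)"
    using fib by simp
  finally show ?thesis by simp
qed

end

lemma finite_group_subgroup:
  assumes "finite_group G" "subgroup H G" shows "finite_group (G\<lparr>carrier := H\<rparr>)"
proof -
  interpret finite_group G by fact
  show ?thesis using subgroup_imp_group[OF assms(2)] finite_subgroup[OF assms(2)]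
    by (simp add: finite_group_def finite_group_axioms_def)
qed

text \<open>Powers are compared through a homomorphism, so the target has to be a group as well; for
  the pair encoding this is supplied by \<open>group_metacyc\<close>.\<close>

lemma card_Fset_iso:
  assumes "group G" "group H" "G \<cong> H"
  shows "card (Fset G n) = card (Fset H n)"
proof -
  obtain h where h: "h \<in> hom G H" "bij_betw h (carrier G) (carrier H)"
    using assms(3) by (auto simp: is_iso_def iso_def)
  interpret group_hom G H h using assms h by (simp add: group_hom_def group_hom_axioms_def)
  have iff: "h x [^]\<^bsub>H\<^esub> n = \<one>\<^bsub>H\<^esub> \<longleftrightarrow> x [^]\<^bsub>G\<^esub> n = \<one>\<^bsub>G\<^esub>" if "x \<in> carrier G" for x
  proof -
    have "h (x [^]\<^bsub>G\<^esub> n) = h \<one>\<^bsub>G\<^esub> \<longleftrightarrow> x [^]\<^bsub>G\<^esub> n = \<one>\<^bsub>G\<^esub>"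
      using h(2) that unfolding bij_betw_def by (intro inj_on_eq_iff) auto
    then show ?thesis using hom_nat_pow[OF that, of n] hom_one by simp
  qed
  have img: "h ` carrier G = carrier H" using h(2) by (simp add: bij_betw_def)
  have "h ` Fset G n = Fset H n"
    unfolding Fset_def img[symmetric] using iff by blast
  moreover have "inj_on h (Fset G n)"
    using h(2) unfolding bij_betw_def by (auto simp: Fset_def intro: inj_on_subset)
  ultimately show ?thesis using card_image by fastforce
qed

lemma Fset_DirProd:
  assumes "group G" "group H"
  shows "Fset (G \<times>\<times> H) n = Fset G n \<times> Fset H n"
proof -
  have "(x, y) [^]\<^bsub>G \<times>\<times> H\<^esub> n = (x [^]\<^bsub>G\<^esub> n, y [^]\<^bsub>H\<^esub> n)" for x y
    by (induction n) auto
  then show ?thesis by (auto simp: Fset_def)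
qed

lemma card_Fset_integer_mod_group_le:
  assumes "t > 0" "n > 0" shows "card (Fset (integer_mod_group t) n) \<le> n"
proof -
  have "Fset (integer_mod_group t) n \<subseteq> int ` {i \<in> {..<t}. t dvd i * n}"
  proof
    fix z assume z: "z \<in> Fset (integer_mod_group t) n"
    then have "z = int (nat z)" "nat z < t" "int t dvd int n * z"
      using assms by (auto simp: Fset_def carrier_integer_mod_group)
    moreover from this have "t dvd nat z * n"
      by (metis int_dvd_int_iff mult.commute of_nat_mult)
    ultimately show "z \<in> int ` {i \<in> {..<t}. t dvd i * n}" by blast
  qed
  then have "card (Fset (integer_mod_group t) n) \<le> card {i \<in> {..<t}. t dvd i * n}"
    by (rule surj_card_le[rotated]) auto
  also have "\<dots> \<le> n" using card_roots_mod_le assms by simp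
  finally show ?thesis .
qed

section \<open>Conjugates of Sylow subgroups\<close>

definition (in group) conjugate :: "'a \<Rightarrow> 'a set \<Rightarrow> 'a set" where
  "conjugate g P = (\<lambda>x. g \<otimes> x \<otimes> inv g) ` P"

definition (in group) conjugates :: "'a set \<Rightarrow> 'a set set" where
  "conjugates P = (\<lambda>g. conjugate g P) ` carrier G"

context group begin

lemma conjugate_eq_coset: "g <# H #> inv g = conjugate g H"
  by (auto simp: conjugate_def l_coset_def r_coset_def)

lemma conjugate_conjugate:
  assumes "g \<in> carrier G" "h \<in> carrier G" "P \<subseteq> carrier G"
  shows "conjugate h (conjugate g P) = conjugate (h \<otimes> g) P"
proof -
  have "h \<otimes> (g \<otimes> x \<otimes> inv g) \<otimes> inv h = h \<otimes> g \<otimes> x \<otimes> inv (h \<otimes> g)" if "x \<in> P" for x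
    using that assms by (simp add: m_assoc inv_mult_group subset_iff)
  then show ?thesis by (auto simp: conjugate_def image_image)
qed

lemma conjugate_one: "P \<subseteq> carrier G \<Longrightarrow> conjugate \<one> P = P"
  by (auto simp: conjugate_def subset_iff image_iff)

lemma conjugate_subset: "P \<subseteq> carrier G \<Longrightarrow> g \<in> carrier G \<Longrightarrow> conjugate g P \<subseteq> carrier G"
  by (auto simp: conjugate_def)

lemma inj_on_conj: "g \<in> carrier G \<Longrightarrow> P \<subseteq> carrier G \<Longrightarrow> inj_on (\<lambda>x. g \<otimes> x \<otimes> inv g) P"
  by (rule inj_onI) (simp add: subset_iff)

lemma card_conjugate: "g \<in> carrier G \<Longrightarrow> P \<subseteq> carrier G \<Longrightarrow> card (conjugate g P) = card P"
  unfolding conjugate_def by (rule card_image, rule inj_on_conj)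

lemma conjugate_subgroup:
  assumes "subgroup P G" "g \<in> carrier G" shows "subgroup (conjugate g P) G"
proof -
  have "group_hom G G (\<lambda>x. g \<otimes> x \<otimes> inv g)"
  proof -
    have "g \<otimes> (x \<otimes> y) \<otimes> inv g = g \<otimes> x \<otimes> inv g \<otimes> (g \<otimes> y \<otimes> inv g)"
      if "x \<in> carrier G" "y \<in> carrier G" for x y
    proof -
      have "g \<otimes> x \<otimes> inv g \<otimes> (g \<otimes> y \<otimes> inv g) = g \<otimes> x \<otimes> (inv g \<otimes> g) \<otimes> (y \<otimes> inv g)"
        using that assms by (simp only: m_assoc inv_closed m_closed)
      then show ?thesis using that assms by (simp add: m_assoc)
    qed
    then show ?thesis using assms
      by (auto simp: group_hom_def group_hom_axioms_def hom_def)
  qed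
  from group_hom.subgroup_img_is_subgroup[OF this assms(1)]
  show ?thesis by (simp add: conjugate_def)
qed

lemma normal_iff_conjugate_subset:
  "P \<lhd> G \<longleftrightarrow> subgroup P G \<and> (\<forall>g\<in>carrier G. conjugate g P \<subseteq> P)"
  unfolding normal_inv_iff conjugate_def by blast

lemma conjugates_singleton_imp_normal:
  assumes "subgroup P G" "card (conjugates P) = 1" shows "P \<lhd> G"
proof -
  from assms(2) obtain W where W: "conjugates P = {W}" using card_1_singletonE by blast
  have "P \<in> conjugates P"
    unfolding conjugates_def using conjugate_one[OF subgroup.subset[OF assms(1)]] image_eqI[OF _ one_closed] by metis
  moreover have "conjugate g P \<in> conjugates P" if "g \<in> carrier G" for g
    unfolding conjugates_def using that by (rule imageI)
  ultimately have "conjugate g P = P" if "g \<in> carrier G" for g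
    using W that by simp
  then show ?thesis using assms(1) normal_iff_conjugate_subset by simp
qed

lemma ord_conj:
  assumes "g \<in> carrier G" "x \<in> carrier G" shows "ord (g \<otimes> x \<otimes> inv g) = ord x"
proof -
  have "g \<otimes> x [^] n \<otimes> inv g = \<one> \<longleftrightarrow> x [^] n = \<one>" for n :: nat
    using assms by (metis inv_closed inv_solve_left' inv_solve_right l_inv m_closed nat_pow_closed r_inv r_one)
  then show ?thesis using assms
    by (subst ord_unique) (auto simp: conj_pow pow_eq_id)
qed

end

context finite_group begin

text \<open>Orders of elements of P are powers of p, hence linearly ordered by divisibility, so one
  element realises the exponent of P. This turns a bound on \<open>Fset G (p ^ e)\<close> into a
  bound on \<open>card P\<close>.\<close>

lemma exists_max_prime_power_ord:
  assumes P: "subgroup P G" "card P = p ^ n" and p: "Factorial_Ring.prime (p::nat)"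
  obtains e x where "x \<in> P" "ord x = p ^ e" "e \<le> n" "P \<subseteq> Fset G (p ^ e)"
proof -
  have sub: "P \<subseteq> carrier G" using P subgroup.subset by blast
  let ?E = "{k. \<exists>y\<in>P. ord y = p ^ k}"
  have k: "\<exists>k\<le>n. ord y = p ^ k" if "y \<in> P" for y
    using ord_dvd_card_subgroup[OF P(1) that] P(2) p divides_primepow_nat by metis
  have le: "k \<le> n" if E: "k \<in> ?E" for k
  proof -
    from E obtain y where y: "y \<in> P" "ord y = p ^ k" by blast
    with k obtain k' where "k' \<le> n" "p ^ k = p ^ k'" by metis
    then show ?thesis using power_inject_exp[OF prime_gt_1_nat[OF p]] by simp
  qed
  then have "finite ?E" by (meson finite_nat_set_iff_bounded_le)
  moreover have "?E \<noteq> {}" using k subgroup.one_closed[OF P(1)] by blast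
  ultimately have "Max ?E \<in> ?E" "\<And>k. k \<in> ?E \<Longrightarrow> k \<le> Max ?E" using Max_in by auto
  then obtain x where "x \<in> P" "ord x = p ^ Max ?E" by blast
  moreover have "P \<subseteq> Fset G (p ^ Max ?E)"
    using k sub \<open>\<And>k. k \<in> ?E \<Longrightarrow> k \<le> Max ?E\<close> by (fastforce simp: Fset_iff_ord intro: le_imp_power_dvd)
  ultimately show ?thesis using that le \<open>Max ?E \<in> ?E\<close> by blast
qed

text \<open>Since P normalises W, the product P W is a subgroup; its order is a power of p, so it
  cannot exceed the Sylow subgroup W that it contains.\<close>

lemma normalizing_subgroup_le_sylow:
  assumes p: "Factorial_Ring.prime (p::nat)"
    and P: "subgroup P G" "card P = p ^ k"
    and W: "subgroup W G" "card W = p ^ multiplicity p (order G)"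
    and norm: "\<And>g. g \<in> P \<Longrightarrow> conjugate g W = W"
  shows "P \<subseteq> W"
proof -
  interpret P: subgroup P G by fact
  interpret W: subgroup W G by fact
  let ?n = "multiplicity p (order G)"
  have sub: "subgroup (P <#> W) G"
  proof (rule subgroupI)
    show "P <#> W \<subseteq> carrier G" using P.subset W.subset set_mult_closed by simp
    show "P <#> W \<noteq> {}" using P.one_closed W.one_closed unfolding set_mult_def by blast
    have swap: "\<exists>x'\<in>W. x \<otimes> g = g \<otimes> x'" if "g \<in> P" "x \<in> W" for g x
    proof -
      have "inv g \<otimes> x \<otimes> inv (inv g) \<in> W" using norm[of "inv g"] that by (auto simp: conjugate_def)
      moreover have "x \<otimes> g = g \<otimes> (inv g \<otimes> x \<otimes> inv (inv g))"
        using that P.mem_carrier W.mem_carrier by (simp add: m_assoc[symmetric])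
      ultimately show ?thesis by blast
    qed
    show "inv a \<in> P <#> W" if "a \<in> P <#> W" for a
    proof -
      from that obtain g x where gx: "g \<in> P" "x \<in> W" "a = g \<otimes> x" by (auto simp: set_mult_def)
      then obtain x' where "x' \<in> W" "inv x \<otimes> inv g = inv g \<otimes> x'" using swap[of "inv g" "inv x"] by auto
      then show ?thesis using gx by (auto simp: set_mult_def inv_mult_group)
    qed
    show "a \<otimes> b \<in> P <#> W" if "a \<in> P <#> W" "b \<in> P <#> W" for a b
    proof -
      from that obtain g x h y where gx: "g \<in> P" "x \<in> W" "a = g \<otimes> x" "h \<in> P" "y \<in> W" "b = h \<otimes> y"
        by (auto simp: set_mult_def)
      obtain x' where x': "x' \<in> W" "x \<otimes> h = h \<otimes> x'" using swap[of h x] gx by auto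
      have c: "g \<in> carrier G" "x \<in> carrier G" "h \<in> carrier G" "y \<in> carrier G" "x' \<in> carrier G"
        using gx x' by auto
      have "a \<otimes> b = g \<otimes> (x \<otimes> h) \<otimes> y" using gx c by (simp add: m_assoc)
      also have "\<dots> = (g \<otimes> h) \<otimes> (x' \<otimes> y)" using x'(2) c by (simp add: m_assoc)
      finally show ?thesis using gx x' by (auto simp: set_mult_def)
    qed
  qed
  have "card (P <#> W) dvd p ^ (k + ?n)"
    using card_set_mult[OF P(1) W(1)] P(2) W(2) by (metis dvd_triv_left power_add)
  then obtain i where i: "card (P <#> W) = p ^ i" using p divides_primepow_nat by blast
  have "p ^ i dvd order G" using card_subgroup_dvd[OF sub] i by simp
  moreover have "order G \<noteq> 0" using order_gt_0_iff_finite by simp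
  ultimately have "i \<le> ?n" using p by (intro multiplicity_geI) (auto dest: prime_gt_1_nat)
  then have "card (P <#> W) \<le> p ^ ?n" using i p prime_gt_0_nat by (auto intro!: power_increasing simp: Suc_leI)
  moreover have "P \<subseteq> P <#> W"
  proof
    fix x assume "x \<in> P"
    then have "x = x \<otimes> \<one>" by simp
    then show "x \<in> P <#> W" using \<open>x \<in> P\<close> W.one_closed unfolding set_mult_def by blast
  qed
  moreover have "W \<subseteq> P <#> W"
  proof
    fix x assume "x \<in> W"
    then have "x = \<one> \<otimes> x" by simp
    then show "x \<in> P <#> W" using \<open>x \<in> W\<close> P.one_closed unfolding set_mult_def by blast
  qed
  ultimately show ?thesis using finite_subgroup[OF sub] W(2) by (metis card_seteq)
qed

lemma self_in_conjugates: "P \<subseteq> carrier G \<Longrightarrow> P \<in> conjugates P"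
  unfolding conjugates_def using conjugate_one[of P] image_eqI[OF _ one_closed] by metis

lemma finite_conjugates [simp]: "finite (conjugates P)"
  unfolding conjugates_def by (rule finite_imageI[OF fin])

text \<open>G acts by conjugation on all its subsets, and the conjugates of P form one orbit, which
  gives the divisibility. For the congruence the action is restricted to P: a conjugate fixed by P
  is normalised by P, hence equal to P, so every other orbit has a size divisible by p.\<close>

lemma
  assumes p: "Factorial_Ring.prime (p::nat)"
    and P: "subgroup P G" "card P = p ^ multiplicity p (order G)"
  shows card_sylow_conjugates_dvd: "card (conjugates P) dvd order G"
    and card_sylow_conjugates_mod: "card (conjugates P) mod p = 1"
proof -
  interpret P: subgroup P G by fact
  let ?n = "multiplicity p (order G)"
  define E where "E = {H. H \<subseteq> carrier G}"
  define \<phi> where "\<phi> = (\<lambda>g. \<lambda>H \<in> E. g <# H #> inv g)"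
  interpret A: group_action G E \<phi>
    using action_by_conjugation_on_power_set by (simp add: E_def \<phi>_def)
  interpret B: group_action "G\<lparr>carrier := P\<rparr>" E \<phi> using A.induced_action[OF P(1)] .
  have app: "\<phi> g W = conjugate g W" if "W \<subseteq> carrier G" for g W
    using that by (simp add: \<phi>_def E_def conjugate_eq_coset)
  have "orbit G \<phi> P = conjugates P"
    using P.subset by (auto simp: orbit_def conjugates_def app)
  moreover have "P \<in> E" using P.subset by (simp add: E_def)
  ultimately show "card (conjugates P) dvd order G"
    using A.orbit_stabilizer_theorem by (metis dvd_triv_left)
  define Ob where "Ob = (\<lambda>W. orbit (G\<lparr>carrier := P\<rparr>) \<phi> W)"
  have S: "subgroup W G" "W \<subseteq> carrier G" "W \<in> E" "card W = p ^ ?n" if "W \<in> conjugates P" for W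
    using that P conjugate_subgroup[OF P(1)] card_conjugate[OF _ P.subset] conjugate_subset[OF P.subset]
    by (auto simp: conjugates_def E_def)
  have Ob: "Ob W = (\<lambda>g. conjugate g W) ` P" if "W \<in> conjugates P" for W
    using app[OF S(2)[OF that]] by (auto simp: Ob_def orbit_def)
  have Ob_sub: "Ob W \<subseteq> conjugates P - {P}" if W: "W \<in> conjugates P - {P}" for W
  proof
    fix Y assume "Y \<in> Ob W"
    then obtain g where g: "g \<in> P" "Y = conjugate g W" using Ob W by auto
    obtain h where h: "h \<in> carrier G" "W = conjugate h P" using W by (auto simp: conjugates_def)
    have "Y \<in> conjugates P"
      using g h conjugate_conjugate[of h g P] P.subset by (auto simp: conjugates_def)
    moreover have "Y \<noteq> P"
    proof
      assume "Y = P"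
      then have "conjugate (inv g) P = conjugate (inv g) (conjugate g W)" using g by simp
      also have "\<dots> = W" using g S(2)[of W] W by (simp add: conjugate_conjugate conjugate_one)
      finally have eq: "conjugate (inv g) P = W" .
      have "conjugate (inv g) P \<subseteq> P" using g by (auto simp: conjugate_def)
      then have "W \<subseteq> P" unfolding eq .
      then show False using W S(4)[of W] P(2) finite_subgroup[OF P(1)] by (metis DiffE card_subset_eq singletonI)
    qed
    ultimately show "Y \<in> conjugates P - {P}" by simp
  qed
  have self: "W \<in> Ob W" if "W \<in> conjugates P" for W
    using S(3)[OF that] B.orbit_refl by (simp add: Ob_def)
  have un: "\<Union> (Ob ` (conjugates P - {P})) = conjugates P - {P}"
    using Ob_sub self by blast
  have "p dvd card (\<Union> (Ob ` (conjugates P - {P})))"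
  proof (rule dvd_partition)
    show "finite (\<Union> (Ob ` (conjugates P - {P})))" by (simp add: un)
    show "\<forall>c1\<in>Ob ` (conjugates P - {P}). \<forall>c2\<in>Ob ` (conjugates P - {P}). c1 \<noteq> c2 \<longrightarrow> c1 \<inter> c2 = {}"
    proof (intro ballI impI)
      fix c1 c2 assume c: "c1 \<in> Ob ` (conjugates P - {P})" "c2 \<in> Ob ` (conjugates P - {P})" "c1 \<noteq> c2"
      have "Ob W \<in> orbits (G\<lparr>carrier := P\<rparr>) E \<phi>" if "W \<in> conjugates P" for W
        unfolding orbits_def Ob_def using S(3)[OF that] by blast
      then have "c1 \<in> orbits (G\<lparr>carrier := P\<rparr>) E \<phi>" "c2 \<in> orbits (G\<lparr>carrier := P\<rparr>) E \<phi>"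
        using c by auto
      then show "c1 \<inter> c2 = {}" using B.disjoint_union c(3) by blast
    qed
    show "\<forall>c\<in>Ob ` (conjugates P - {P}). p dvd card c"
    proof (rule ballI)
      fix c assume "c \<in> Ob ` (conjugates P - {P})"
      then obtain W where W: "W \<in> conjugates P" "W \<noteq> P" and c: "c = Ob W" by auto
      have "card (Ob W) dvd p ^ ?n"
        using B.orbit_stabilizer_theorem[OF S(3)[OF W(1)]] P(2) by (simp add: Ob_def order_def) (metis dvd_triv_left)
      then obtain i where i: "card (Ob W) = p ^ i" using p divides_primepow_nat by blast
      have "i \<noteq> 0"
      proof
        assume "i = 0"
        then obtain Y where "Ob W = {Y}" using i card_1_singletonE by (metis power_0)
        then have "conjugate g W = W" if "g \<in> P" for g using self[OF W(1)] Ob[OF W(1)] that by auto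
        then have "P \<subseteq> W" using normalizing_subgroup_le_sylow[OF p P S(1,4)[OF W(1)]] by blast
        then show False using S(4)[OF W(1)] P(2) W(2) finite_subgroup[OF S(1)[OF W(1)]] card_subset_eq by metis
      qed
      then show "p dvd card c" using i c by simp
    qed
  qed
  then have "p dvd card (conjugates P - {P})" by (simp only: un)
  moreover have "card (conjugates P) = Suc (card (conjugates P - {P}))"
    by (rule card.remove[OF finite_conjugates self_in_conjugates[OF P.subset]])
  ultimately show "card (conjugates P) mod p = 1"
    using prime_gt_1_nat[OF p] by (auto simp: mod_Suc)
qed

text \<open>Every conjugate is cyclic of order p^n and has at least p^n - p^(n-1) generators, and a
  generator determines its subgroup, so generators of different conjugates never coincide. One
  conjugate is counted with all its elements, the others with their generators only.\<close>

lemma card_Fset_cyclic_conjugates: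
  assumes x: "x \<in> carrier G" "ord x = p ^ n" "n > 0" and p: "Factorial_Ring.prime (p::nat)"
  shows "p ^ n + (card (conjugates (generate G {x})) - 1) * (p ^ n - p ^ (n - 1)) \<le> card (Fset G (p ^ n))"
proof -
  define P where "P = generate G {x}"
  have P: "subgroup P G" unfolding P_def using x generate_is_subgroup by simp
  interpret P: subgroup P G by fact
  have cP: "card P = p ^ n" using generate_pow_card x by (simp add: P_def)
  define gens where "gens W = {y \<in> W. ord y = p ^ n}" for W
  \<comment> \<open>A non-generator has order dividing p^(n-1), and a cyclic group has at most
    p^(n-1) such elements.\<close>
  have gP: "p ^ n - p ^ (n - 1) \<le> card (gens P)"
  proof -
    interpret F: finite_group "G\<lparr>carrier := P\<rparr>" using finite_group_subgroup[OF finite_group_axioms P] .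
    have "x \<in> P" using x by (simp add: P_def generate.incl)
    have "generate (G\<lparr>carrier := P\<rparr>) {x} = P"
      using F.generate_eqI[OF F.subgroup_self, of x] \<open>x \<in> P\<close> ord_subgroup[OF P] x cP by simp
    then have "card (Fset (G\<lparr>carrier := P\<rparr>) (p ^ (n - 1))) \<le> p ^ (n - 1)"
      using F.card_Fset_cyclic_le[of x "p ^ (n-1)"] \<open>x \<in> P\<close> p prime_gt_0_nat by simp
    moreover have "P - gens P \<subseteq> Fset (G\<lparr>carrier := P\<rparr>) (p ^ (n - 1))"
    proof
      fix y assume y: "y \<in> P - gens P"
      then have "ord y dvd p ^ n" "ord y \<noteq> p ^ n" using ord_dvd_card_subgroup[OF P] cP by (auto simp: gens_def)
      then obtain i where "i < n" "ord y = p ^ i"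
        using p divides_primepow_nat by (metis le_neq_implies_less)
      then have "ord y dvd p ^ (n - 1)" by (simp add: le_imp_power_dvd)
      then show "y \<in> Fset (G\<lparr>carrier := P\<rparr>) (p ^ (n - 1))"
        using y by (auto simp: Fset_subgroup[OF P.subset] Fset_iff_ord)
    qed
    ultimately have "card (P - gens P) \<le> p ^ (n - 1)"
      using card_mono[OF F.finite_Fset] by (meson le_trans)
    moreover have "card (P - gens P) = card P - card (gens P)"
      using finite_subgroup[OF P] by (intro card_Diff_subset) (auto simp: gens_def)
    ultimately show ?thesis using cP by simp
  qed
  have cj: "subgroup W G \<and> card W = p ^ n \<and> p ^ n - p ^ (n - 1) \<le> card (gens W)"
    if W: "W \<in> conjugates P" for W
  proof -
    obtain g where g: "g \<in> carrier G" "W = conjugate g P" using W by (auto simp: conjugates_def)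
    have "gens W = (\<lambda>x. g \<otimes> x \<otimes> inv g) ` gens P"
      using g P.subset ord_conj by (auto simp: gens_def conjugate_def)
    moreover have "inj_on (\<lambda>x. g \<otimes> x \<otimes> inv g) (gens P)"
      using g P.subset by (intro inj_on_conj) (auto simp: gens_def)
    ultimately show ?thesis
      using g gP cP conjugate_subgroup[OF P] card_conjugate[OF _ P.subset] by (simp add: card_image)
  qed
  have gen: "generate G {y} = W" if "W \<in> conjugates P" "y \<in> gens W" for W y
    using cj[OF that(1)] that(2) by (intro generate_eqI) (auto simp: gens_def)
  let ?S = "conjugates P - {P}"
  have PS: "P \<in> conjugates P" using self_in_conjugates P.subset by blast
  have fg: "finite (gens W)" if "W \<in> conjugates P" for W
    using cj[OF that] finite_subgroup by (auto simp: gens_def)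
  have "card (\<Union>W\<in>?S. gens W) = (\<Sum>W\<in>?S. card (gens W))"
  proof (rule card_UN_disjoint)
    show "\<forall>i\<in>?S. \<forall>j\<in>?S. i \<noteq> j \<longrightarrow> gens i \<inter> gens j = {}"
    proof (intro ballI impI)
      fix i j assume "i \<in> ?S" "j \<in> ?S" "i \<noteq> j"
      then show "gens i \<inter> gens j = {}" using gen[of i] gen[of j] by blast
    qed
  qed (use fg in auto)
  moreover have "\<dots> \<ge> (\<Sum>W\<in>?S. p ^ n - p ^ (n - 1))" using cj by (intro sum_mono) auto
  ultimately have "card ?S * (p ^ n - p ^ (n - 1)) \<le> card (\<Union>W\<in>?S. gens W)" by simp
  moreover have "P \<inter> (\<Union>W\<in>?S. gens W) = {}"
  proof -
    have False if "y \<in> P" "W \<in> ?S" "y \<in> gens W" for y W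
    proof -
      have "y \<in> gens P" using that by (simp add: gens_def)
      then show False using gen[OF PS] gen[of W y] that by auto
    qed
    then show ?thesis by blast
  qed
  moreover have "finite (\<Union>W\<in>?S. gens W)" using fg by simp
  ultimately have "card P + card ?S * (p ^ n - p ^ (n - 1)) \<le> card (P \<union> (\<Union>W\<in>?S. gens W))"
    using finite_subgroup[OF P] by (simp add: card_Un_disjoint)
  also have "\<dots> \<le> card (Fset G (p ^ n))"
  proof (rule card_mono)
    show "P \<union> (\<Union>W\<in>?S. gens W) \<subseteq> Fset G (p ^ n)"
    proof (intro Un_least UN_least subsetI)
      show "y \<in> Fset G (p ^ n)" if "y \<in> P" for y
        using that ord_dvd_card_subgroup[OF P that] cP by (simp add: Fset_iff_ord)
      show "y \<in> Fset G (p ^ n)" if "W \<in> ?S" "y \<in> gens W" for W y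
      proof -
        have "W \<subseteq> carrier G" using cj[of W] that(1) subgroup.subset[of W G] by simp
        then show ?thesis using that(2) by (auto simp: Fset_iff_ord gens_def)
      qed
    qed
  qed simp
  finally show ?thesis using cP PS by (simp add: P_def)
qed

text \<open>With 1 + j p conjugates the count of solutions is at least (1 + j (p - 1)) p^n, because
  p (p^n - p^(n-1)) = (p - 1) p^n. Hence j (p - 1) < q \<le> p. The value j = 0 means normality, j =
  1 leaves only p = q, and j \<ge> 2 is impossible.\<close>

lemma cyclic_sylow_conjugates:
  assumes x: "x \<in> carrier G" "ord x = p ^ n" "n > 0" "n = multiplicity p (order G)"
    and p: "Factorial_Ring.prime (p::nat)" and q: "q \<le> p"
    and small: "card (Fset G (p ^ n)) < (q + 1) * p ^ n"
  shows "generate G {x} \<lhd> G \<or> p = q \<and> card (conjugates (generate G {x})) = q + 1"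
proof -
  let ?P = "generate G {x}" let ?N = "card (conjugates ?P)"
  have P: "subgroup ?P G" "card ?P = p ^ multiplicity p (order G)"
    using x generate_is_subgroup generate_pow_card by auto
  have p1: "p > 1" using p prime_gt_1_nat by blast
  have m: "?N mod p = 1" using card_sylow_conjugates_mod[OF p P] .
  define j where "j = ?N div p"
  have N: "?N = 1 + j * p" using m by (metis j_def add.commute div_mult_mod_eq)
  have pn: "p ^ n = p * p ^ (n - 1)" using x(3) by (simp add: power_eq_if)
  have "p ^ n + (j * p) * (p ^ n - p ^ (n - 1)) < (q + 1) * p ^ n"
    using card_Fset_cyclic_conjugates[OF x(1-3) p] small N by simp
  moreover have "(j * p) * (p ^ n - p ^ (n - 1)) = j * (p - 1) * p ^ n"
    unfolding pn by (simp add: algebra_simps diff_mult_distrib2)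
  ultimately have "(1 + j * (p - 1)) * p ^ n < (q + 1) * p ^ n" by (simp add: algebra_simps)
  then have lt: "j * (p - 1) < q" by simp
  then consider "j = 0" | "j = 1" | "j \<ge> 2" by linarith
  then show ?thesis
  proof cases
    case 1 then show ?thesis using N conjugates_singleton_imp_normal[OF P(1)] by simp
  next
    case 2 then show ?thesis using N lt q by auto
  next
    case 3
    then have "2 * (p - 1) \<le> j * (p - 1)" by (intro mult_right_mono) auto
    then show ?thesis using lt q p1 by linarith
  qed
qed

end

section \<open>Isomorphisms onto the model groups\<close>

text \<open>The map goes from the model H to G because a pair is easily evaluated as a product in G;
  its inverse is the isomorphism. In the model only closure and multiplicativity have to be
  checked.\<close>

lemma (in group) iso_from_bij:
  assumes bij: "bij_betw h (carrier H) (carrier G)"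
    and mult: "\<And>x y. x \<in> carrier H \<Longrightarrow> y \<in> carrier H \<Longrightarrow>
      x \<otimes>\<^bsub>H\<^esub> y \<in> carrier H \<and> h (x \<otimes>\<^bsub>H\<^esub> y) = h x \<otimes> h y"
  shows "G \<cong> H"
proof -
  let ?g = "inv_into (carrier H) h"
  have g: "bij_betw ?g (carrier G) (carrier H)" using bij by (rule bij_betw_inv_into)
  have hg: "h (?g x) = x" if "x \<in> carrier G" for x
    using that bij by (simp add: bij_betw_inv_into_right)
  have gc: "?g x \<in> carrier H" if "x \<in> carrier G" for x
    using that g bij_betwE by blast
  have "?g (x \<otimes> y) = ?g x \<otimes>\<^bsub>H\<^esub> ?g y" if "x \<in> carrier G" "y \<in> carrier G" for x y
  proof -
    have "h (?g x \<otimes>\<^bsub>H\<^esub> ?g y) = x \<otimes> y" using mult[OF gc gc] hg that by simp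
    then show ?thesis using mult[OF gc[OF that(1)] gc[OF that(2)]] bij
      by (metis bij_betw_inv_into_left)
  qed
  then have "?g \<in> iso G H" using g gc by (auto simp: iso_def hom_def)
  then show ?thesis by (rule is_isoI)
qed

lemma (in finite_group) iso_from_surj:
  assumes "carrier G \<subseteq> h ` carrier H" "finite (carrier H)" "card (carrier H) = order G"
    and mult: "\<And>x y. x \<in> carrier H \<Longrightarrow> y \<in> carrier H \<Longrightarrow>
      x \<otimes>\<^bsub>H\<^esub> y \<in> carrier H \<and> h (x \<otimes>\<^bsub>H\<^esub> y) = h x \<otimes> h y"
    and cl: "\<And>x. x \<in> carrier H \<Longrightarrow> h x \<in> carrier G"
  shows "G \<cong> H"
proof (rule iso_from_bij[OF _ mult])
  have "h ` carrier H = carrier G" using assms(1) cl by blast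
  moreover from this have "inj_on h (carrier H)"
    using assms(2,3) by (intro eq_card_imp_inj_on) (auto simp: order_def)
  ultimately show "bij_betw h (carrier H) (carrier G)" by (simp add: bij_betw_def)
qed

text \<open>Internal counterpart of an isomorphism with \<open>metacyc M N r\<close>, so that
  computations use elements of G instead of pairs. The order equation turns the covering by normal
  forms into a bijection.\<close>

definition (in group) metacyclic_gens :: "nat \<Rightarrow> nat \<Rightarrow> nat \<Rightarrow> 'a \<Rightarrow> 'a \<Rightarrow> bool" where
  "metacyclic_gens M N r a b \<longleftrightarrow> a \<in> carrier G \<and> b \<in> carrier G \<and> a [^] N = \<one> \<and> b [^] M = \<one> \<and>
     a \<otimes> b = b \<otimes> a [^] r \<and> order G = M * N \<and>
     carrier G \<subseteq> (\<lambda>(j, i). b [^] j \<otimes> a [^] i) ` ({0..<M} \<times> {0..<N})"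

context group begin

lemma pow_conj_commute:
  assumes ab: "a \<in> carrier G" "b \<in> carrier G" "a \<otimes> b = b \<otimes> a [^] (r::nat)"
  shows "a [^] (i::nat) \<otimes> b [^] (l::nat) = b [^] l \<otimes> a [^] (i * r ^ l)"
proof -
  have one: "a [^] (i::nat) \<otimes> b = b \<otimes> a [^] (i * r)" for i
  proof (induction i)
    case (Suc i)
    have "a [^] Suc i \<otimes> b = a [^] i \<otimes> b \<otimes> a [^] r" using ab by (simp add: m_assoc)
    also have "\<dots> = b \<otimes> a [^] (Suc i * r)"
      using ab Suc by (simp add: m_assoc nat_pow_mult add.commute)
    finally show ?case .
  qed (use ab in simp)
  show ?thesis
  proof (induction l)
    case (Suc l)
    have "a [^] i \<otimes> b [^] Suc l = b [^] l \<otimes> (a [^] (i * r ^ l) \<otimes> b)"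
      using ab Suc by (simp add: m_assoc[symmetric])
    also have "\<dots> = b [^] Suc l \<otimes> a [^] (i * r ^ Suc l)"
      unfolding one using ab by (simp add: m_assoc ac_simps)
    finally show ?case .
  qed (use ab in simp)
qed

lemma normal_form_mult:
  assumes ab: "a \<in> carrier G" "b \<in> carrier G" "a \<otimes> b = b \<otimes> a [^] (r::nat)"
  shows "(b [^] (j::nat) \<otimes> a [^] (i::nat)) \<otimes> (b [^] (l::nat) \<otimes> a [^] (k::nat)) =
    b [^] (j + l) \<otimes> a [^] (i * r ^ l + k)"
proof -
  have "(b [^] j \<otimes> a [^] i) \<otimes> (b [^] l \<otimes> a [^] k) = b [^] j \<otimes> (a [^] i \<otimes> b [^] l) \<otimes> a [^] k"
    using ab by (simp add: m_assoc)
  also have "\<dots> = b [^] j \<otimes> b [^] l \<otimes> (a [^] (i * r ^ l) \<otimes> a [^] k)"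
    unfolding pow_conj_commute[OF ab] using ab by (simp add: m_assoc)
  finally show ?thesis using ab by (simp add: nat_pow_mult)
qed

text \<open>Collecting all powers of b on the left moves them past the factors a^i, and passing b^j
  once multiplies the exponent of a by r^j. The geometric sum that results decides all later
  questions about orders.\<close>

lemma normal_form_pow:
  assumes ab: "a \<in> carrier G" "b \<in> carrier G" "a \<otimes> b = b \<otimes> a [^] (r::nat)"
  shows "(b [^] (j::nat) \<otimes> a [^] (i::nat)) [^] (n::nat) = b [^] (j * n) \<otimes> a [^] (i * (\<Sum>l<n. (r ^ j) ^ l))"
proof (induction n)
  case (Suc n)
  have "(b [^] j \<otimes> a [^] i) [^] Suc n = (b [^] j \<otimes> a [^] i) \<otimes> (b [^] j \<otimes> a [^] i) [^] n"
    using ab by (simp only: nat_pow_Suc2 m_closed nat_pow_closed)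
  also have "\<dots> = b [^] (j + j * n) \<otimes> a [^] (i * r ^ (j * n) + i * (\<Sum>l<n. (r ^ j) ^ l))"
    unfolding Suc normal_form_mult[OF ab] ..
  also have "i * r ^ (j * n) + i * (\<Sum>l<n. (r ^ j) ^ l) = i * (\<Sum>l<Suc n. (r ^ j) ^ l)"
    by (simp add: power_mult algebra_simps)
  finally show ?case by (simp add: add.commute)
qed (use ab in simp)

end

context finite_group begin

lemma iso_metacyc:
  assumes g: "metacyclic_gens M N r a b" and M: "M > 0" "N > 0"
  shows "G \<cong> metacyc M N r"
proof (rule iso_from_surj[where h = "\<lambda>(j, i). b [^] j \<otimes> a [^] i"])
  have ab: "a \<in> carrier G" "b \<in> carrier G" "a [^] N = \<one>" "b [^] M = \<one>" "a \<otimes> b = b \<otimes> a [^] r"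
    using g by (auto simp: metacyclic_gens_def)
  show "carrier G \<subseteq> (\<lambda>(j, i). b [^] j \<otimes> a [^] i) ` carrier (metacyc M N r)"
    "card (carrier (metacyc M N r)) = order G" "finite (carrier (metacyc M N r))"
    using g by (auto simp: metacyclic_gens_def metacyc_def)
  show "x \<in> carrier (metacyc M N r) \<Longrightarrow> (\<lambda>(j, i). b [^] j \<otimes> a [^] i) x \<in> carrier G" for x
    using ab(1,2) by (cases x) simp
  show "x \<otimes>\<^bsub>metacyc M N r\<^esub> y \<in> carrier (metacyc M N r) \<and>
    (\<lambda>(j, i). b [^] j \<otimes> a [^] i) (x \<otimes>\<^bsub>metacyc M N r\<^esub> y) =
    (\<lambda>(j, i). b [^] j \<otimes> a [^] i) x \<otimes> (\<lambda>(j, i). b [^] j \<otimes> a [^] i) y" for x y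
    using M ab by (cases x; cases y)
      (simp add: metacyc_def normal_form_mult[OF ab(1,2,5)] pow_mod_eq[OF ab(1,3)] pow_mod_eq[OF ab(2,4)])
qed

text \<open>The generators are the preimages of (0, 1) and (1, 0); \<open>M > 1\<close> and
  \<open>N > 1\<close> ensure that these pairs lie in the carrier.\<close>

lemma iso_metacyc_imp_gens:
  assumes iso: "G \<cong> metacyc M N r" and M: "M > 1" "N > 1"
  obtains a b where "metacyclic_gens M N r a b"
proof -
  let ?H = "metacyc M N r"
  obtain f where f: "f \<in> hom G ?H" "bij_betw f (carrier G) (carrier ?H)"
    using iso by (auto simp: is_iso_def iso_def)
  have car: "carrier ?H = {0..<M} \<times> {0..<N}" by (simp add: metacyc_def)
  have mul: "(j, i) \<otimes>\<^bsub>?H\<^esub> (l, k) = ((j + l) mod M, (i * r ^ l + k) mod N)" for j i l k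
    by (simp add: metacyc_def)
  have hm: "f (x \<otimes> y) = f x \<otimes>\<^bsub>?H\<^esub> f y" if "x \<in> carrier G" "y \<in> carrier G" for x y
    using f(1) that by (simp add: hom_def)
  have inj: "f x = f y \<Longrightarrow> x = y" if "x \<in> carrier G" "y \<in> carrier G" for x y
    using f(2) that unfolding bij_betw_def by (meson inj_onD)
  have img: "f ` carrier G = {0..<M} \<times> {0..<N}" using f(2) car by (simp add: bij_betw_def)
  obtain a where a: "a \<in> carrier G" "f a = (0, 1)"
  proof -
    have "(0, 1) \<in> f ` carrier G" unfolding img using M by simp
    then show ?thesis using that by (metis imageE)
  qed
  obtain b where b: "b \<in> carrier G" "f b = (1, 0)"
  proof -
    have "(1, 0) \<in> f ` carrier G" unfolding img using M by simp
    then show ?thesis using that by (metis imageE)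
  qed
  \<comment> \<open>The image of the unit is an idempotent pair (j, i). Comparing first components
    gives j = 0, after which the second component gives i = 0.\<close>
  have f1: "f \<one> = (0, 0)"
  proof -
    obtain j i where ji: "f \<one> = (j, i)" by fastforce
    moreover have "f \<one> \<in> {0..<M} \<times> {0..<N}" unfolding img[symmetric] by blast
    moreover have "f \<one> = f \<one> \<otimes>\<^bsub>?H\<^esub> f \<one>" using hm[of \<one> \<one>] by simp
    ultimately have "j < M" "i < N" and ij: "j = (j + j) mod M" "i = (i * r ^ j + i) mod N"
      by (auto simp: mul)
    have "j = 0" using ij(1) \<open>j < M\<close> by (cases "j + j < M") (auto simp: mod_if split: if_splits)
    moreover from this have "i = 0" using ij(2) \<open>i < N\<close>
      by (cases "i + i < N") (auto simp: mod_if split: if_splits)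
    ultimately show ?thesis using ji by simp
  qed
  have fa: "f (a [^] i) = (0, i mod N)" for i :: nat
    using M by (induction i) (auto simp: f1 hm a mul mod_Suc_eq)
  have fb: "f (b [^] j) = (j mod M, 0)" for j :: nat
    using M by (induction j) (auto simp: f1 hm b mul mod_Suc_eq)
  have fab: "f (b [^] j \<otimes> a [^] i) = (j mod M, i mod N)" for i j :: nat
    using M by (simp add: hm a b fa fb mul)
  have "a \<otimes> b = b \<otimes> a [^] r"
  proof (rule inj)
    show "f (a \<otimes> b) = f (b \<otimes> a [^] r)"
      unfolding hm[OF a(1) b(1)] hm[OF b(1) nat_pow_closed[OF a(1)]] fa a b mul using M by simp
  qed (use a b in auto)
  moreover have "a [^] N = \<one>" by (rule inj) (use a fa f1 in auto)
  moreover have "b [^] M = \<one>" by (rule inj) (use b fb f1 in auto)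
  moreover have "order G = M * N"
    using bij_betw_same_card[OF f(2)] by (simp add: order_def car)
  moreover have "carrier G \<subseteq> (\<lambda>(j, i). b [^] j \<otimes> a [^] i) ` ({0..<M} \<times> {0..<N})"
  proof
    fix x assume x: "x \<in> carrier G"
    obtain j i where ji: "f x = (j, i)" by fastforce
    then have "j < M" "i < N" using x img by (metis SigmaD1 SigmaD2 atLeastLessThan_iff imageI)+
    then have "f x = f (b [^] j \<otimes> a [^] i)" using fab ji by simp
    then have "x = b [^] j \<otimes> a [^] i" by (rule inj[rotated 2]) (use a b x in auto)
    then show "x \<in> (\<lambda>(j, i). b [^] j \<otimes> a [^] i) ` ({0..<M} \<times> {0..<N})"
      using \<open>j < M\<close> \<open>i < N\<close> by force
  qed
  ultimately have "metacyclic_gens M N r a b" using a b by (simp add: metacyclic_gens_def)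
  then show thesis by (rule that)
qed

text \<open>The product of normal forms is the metacyclic one except for a carry: when j = l = 1 the
  factor b^2 is rewritten as a^2, which is the summand 2 in \<open>quaternion8\<close>.\<close>

lemma iso_quaternion8:
  assumes ab: "a \<in> carrier G" "b \<in> carrier G" "a [^] (4::nat) = \<one>" "b [^] (2::nat) = a [^] (2::nat)"
    "a \<otimes> b = b \<otimes> a [^] (3::nat)" and o: "order G = 8"
    and sub: "carrier G \<subseteq> (\<lambda>(j, i). b [^] j \<otimes> a [^] i) ` ({0..<2::nat} \<times> {0..<4::nat})"
  shows "G \<cong> quaternion8"
proof (rule iso_from_surj[where h = "\<lambda>(j, i). b [^] j \<otimes> a [^] i"])
  show "carrier G \<subseteq> (\<lambda>(j, i). b [^] j \<otimes> a [^] i) ` carrier quaternion8"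
    "card (carrier quaternion8) = order G" "finite (carrier quaternion8)"
    using sub o by (auto simp: quaternion8_def)
  show "x \<in> carrier quaternion8 \<Longrightarrow> (\<lambda>(j, i). b [^] j \<otimes> a [^] i) x \<in> carrier G" for x
    using ab(1,2) by (cases x) simp
  have *: "b [^] ((j + l) mod 2) \<otimes> a [^] ((i * 3 ^ l + k + (if j = 1 \<and> l = 1 then 2 else 0)) mod 4)
    = (b [^] j \<otimes> a [^] i) \<otimes> (b [^] l \<otimes> a [^] k)" if "j < 2" "l < 2" for j l i k :: nat
  proof (cases "j = 1 \<and> l = 1")
    case True
    then have "(b [^] j \<otimes> a [^] i) \<otimes> (b [^] l \<otimes> a [^] k) = b [^] (2::nat) \<otimes> a [^] (i * 3 ^ l + k)"
      unfolding normal_form_mult[OF ab(1,2,5)] by (simp add: numeral_2_eq_2)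
    also have "\<dots> = a [^] (2 + (i * 3 ^ l + k))" using ab by (simp add: nat_pow_mult)
    finally show ?thesis using True ab by (simp add: pow_mod_eq add.commute)
  next
    case False
    with that have "(j + l) mod 2 = j + l" by (auto simp: less_2_cases_iff)
    then show ?thesis using False
      unfolding normal_form_mult[OF ab(1,2,5)] using pow_mod_eq[OF ab(1,3)] by auto
  qed
  show "x \<otimes>\<^bsub>quaternion8\<^esub> y \<in> carrier quaternion8 \<and>
    (\<lambda>(j, i). b [^] j \<otimes> a [^] i) (x \<otimes>\<^bsub>quaternion8\<^esub> y) =
    (\<lambda>(j, i). b [^] j \<otimes> a [^] i) x \<otimes> (\<lambda>(j, i). b [^] j \<otimes> a [^] i) y"
    if "x \<in> carrier quaternion8" "y \<in> carrier quaternion8" for x y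
    using that * by (cases x; cases y) (simp add: quaternion8_def)
qed

text \<open>A pair (1, i) squares to (0, 2), since 3 i + i vanishes modulo 4. So a solution has
  first component 0, and then its second component is even.\<close>

lemma card_Fset_2_quaternion8:
  assumes "G \<cong> quaternion8" shows "card (Fset G 2) \<le> 2"
proof -
  obtain f where f: "f \<in> hom G quaternion8" "bij_betw f (carrier G) (carrier quaternion8)"
    using assms by (auto simp: is_iso_def iso_def)
  have hm: "f (x \<otimes> y) = f x \<otimes>\<^bsub>quaternion8\<^esub> f y" if "x \<in> carrier G" "y \<in> carrier G" for x y
    using f(1) that by (simp add: hom_def)
  have fc: "f x \<in> {0..<2} \<times> {0..<4}" if "x \<in> carrier G" for x
    using f(2) that bij_betwE by (fastforce simp: quaternion8_def)
  have four: "i < 4 \<Longrightarrow> i = 0 \<or> i = 1 \<or> i = 2 \<or> i = (3::nat)" for i by auto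
  have f1: "f \<one> = (0, 0)"
  proof -
    obtain j i where ji: "f \<one> = (j, i)" by fastforce
    then have lt: "j < 2" "i < 4" using fc[of \<one>] by auto
    have "(j, i) = (j, i) \<otimes>\<^bsub>quaternion8\<^esub> (j, i)" using hm[of \<one> \<one>] ji by simp
    then have "(j, i) = (0, 0)" using lt four[OF lt(2)]
      by (auto simp: quaternion8_def less_2_cases_iff)
    then show ?thesis using ji by simp
  qed
  have "f ` Fset G 2 \<subseteq> {(0, 0), (0, 2)}"
  proof
    fix z assume "z \<in> f ` Fset G 2"
    then obtain x where x: "x \<in> carrier G" "x \<otimes> x = \<one>" "z = f x"
      by (auto simp: Fset_def numeral_2_eq_2)
    obtain j i where ji: "f x = (j, i)" by fastforce
    then have lt: "j < 2" "i < 4" using fc[OF x(1)] by auto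
    have "(0, 0) = (j, i) \<otimes>\<^bsub>quaternion8\<^esub> (j, i)" using hm[of x x] ji x f1 by simp
    then have "(j, i) \<in> {(0, 0), (0, 2)}" using lt four[OF lt(2)]
      by (auto simp: quaternion8_def less_2_cases_iff dest: dvd_imp_le)
    then show "z \<in> {(0, 0), (0, 2)}" using ji x by simp
  qed
  moreover have "inj_on f (Fset G 2)"
    using f(2) unfolding bij_betw_def by (auto simp: Fset_def intro: inj_on_subset)
  ultimately have "card (Fset G 2) \<le> card {(0::nat, 0::nat), (0, 2)}"
    by (intro card_inj_on_le) auto
  then show ?thesis by simp
qed

lemma iso_integer_mod_group:
  assumes x: "x \<in> carrier G" "ord x = order G" shows "G \<cong> integer_mod_group (order G)"
proof (rule iso_from_surj[where h = "\<lambda>z. x [^] nat z"])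
  have n: "order G > 0" using order_gt_0_iff_finite by simp
  have car: "carrier (integer_mod_group (order G)) = int ` {..<order G}"
    using n by (simp add: carrier_integer_mod_group image_int_atLeastLessThan lessThan_atLeast0)
  have "carrier G = (\<lambda>i. x [^] i) ` {..<order G}"
    using generate_eqI[OF subgroup_self x(1)] x generate_eq_powers[OF x(1)] by (simp add: order_def)
  then show "carrier G \<subseteq> (\<lambda>z. x [^] nat z) ` carrier (integer_mod_group (order G))"
    unfolding car by (simp add: image_image)
  show "finite (carrier (integer_mod_group (order G)))"
    "card (carrier (integer_mod_group (order G))) = order G"
    using n by (simp_all add: carrier_integer_mod_group)
  have xo: "x [^] order G = \<one>" using x by (metis pow_ord_eq_1)
  show "u \<otimes>\<^bsub>integer_mod_group (order G)\<^esub> v \<in> carrier (integer_mod_group (order G)) \<and>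
    x [^] nat (u \<otimes>\<^bsub>integer_mod_group (order G)\<^esub> v) = x [^] nat u \<otimes> x [^] nat v"
    if "u \<in> carrier (integer_mod_group (order G))" "v \<in> carrier (integer_mod_group (order G))" for u v
    using that n x pow_mod_eq[OF x(1) xo]
    by (simp add: carrier_integer_mod_group nat_mod_distrib nat_add_distrib nat_pow_mult del: pow_nat)
qed (use x in auto)

lemma iso_integer_mod_groups:
  assumes g: "metacyclic_gens M N 1 a b" and M: "M > 0" "N > 0"
  shows "G \<cong> integer_mod_group N \<times>\<times> integer_mod_group M"
proof (rule iso_from_surj[where h = "\<lambda>(u, v). b [^] nat v \<otimes> a [^] nat u"])
  let ?H = "integer_mod_group N \<times>\<times> integer_mod_group M"
  have ab: "a \<in> carrier G" "b \<in> carrier G" "a [^] N = \<one>" "b [^] M = \<one>" "a \<otimes> b = b \<otimes> a [^] (1::nat)"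
    using g by (auto simp: metacyclic_gens_def)
  show "carrier G \<subseteq> (\<lambda>(u, v). b [^] nat v \<otimes> a [^] nat u) ` carrier ?H"
  proof
    fix x assume "x \<in> carrier G"
    then have "x \<in> (\<lambda>(j, i). b [^] j \<otimes> a [^] i) ` ({0..<M} \<times> {0..<N})"
      using g unfolding metacyclic_gens_def by blast
    then obtain j i where "j < M" "i < N" "x = b [^] j \<otimes> a [^] i" by auto
    then show "x \<in> (\<lambda>(u, v). b [^] nat v \<otimes> a [^] nat u) ` carrier ?H"
      using M by (intro image_eqI[of _ _ "(int i, int j)"]) (auto simp: carrier_integer_mod_group)
  qed
  show "finite (carrier ?H)" "card (carrier ?H) = order G"
    using M g by (simp_all add: carrier_integer_mod_group metacyclic_gens_def)
  show "(\<lambda>(u, v). b [^] nat v \<otimes> a [^] nat u) x \<in> carrier G" for x using ab by (cases x) simp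
  have *: "b [^] (j + l) \<otimes> a [^] (i + k) = b [^] j \<otimes> a [^] i \<otimes> (b [^] l \<otimes> a [^] k)" for i j k l :: nat
    using normal_form_mult[OF ab(1,2,5), of j i l k] by simp
  show "x \<otimes>\<^bsub>?H\<^esub> y \<in> carrier ?H \<and> (\<lambda>(u, v). b [^] nat v \<otimes> a [^] nat u) (x \<otimes>\<^bsub>?H\<^esub> y) =
    (\<lambda>(u, v). b [^] nat v \<otimes> a [^] nat u) x \<otimes> (\<lambda>(u, v). b [^] nat v \<otimes> a [^] nat u) y"
    if "x \<in> carrier ?H" "y \<in> carrier ?H" for x y
    using that M *
    by (cases x; cases y) (simp add: carrier_integer_mod_group nat_mod_distrib nat_add_distrib
      pow_mod_eq[OF ab(1,3)] pow_mod_eq[OF ab(2,4)])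
qed

lemma iso_metacyc_DirProd_integer_mod_group:
  assumes ab: "a \<in> carrier G" "b \<in> carrier G" "a [^] N = \<one>" "b [^] M = \<one>" "a \<otimes> b = b \<otimes> a [^] r"
    and c: "c \<in> carrier G" "c [^] t = \<one>" "a \<otimes> c = c \<otimes> a" "b \<otimes> c = c \<otimes> b"
    and pos: "M > 0" "N > 0" "t > 0" and o: "order G = M * N * t"
    and sub: "carrier G \<subseteq> (\<lambda>((j, i), k). b [^] j \<otimes> a [^] i \<otimes> c [^] k) ` (({0..<M} \<times> {0..<N}) \<times> {0..<t})"
  shows "G \<cong> metacyc M N r \<times>\<times> integer_mod_group t"
proof (rule iso_from_surj[where h = "\<lambda>((j, i), z). b [^] j \<otimes> a [^] i \<otimes> c [^] nat z"])
  let ?H = "metacyc M N r \<times>\<times> integer_mod_group t"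
  let ?h = "\<lambda>((j::nat, i::nat), z). b [^] j \<otimes> a [^] i \<otimes> c [^] nat z"
  have car: "carrier ?H = ({0..<M} \<times> {0..<N}) \<times> {0..<int t}"
    using pos by (simp add: metacyc_def carrier_integer_mod_group)
  show "carrier G \<subseteq> ?h ` carrier ?H"
  proof
    fix x assume "x \<in> carrier G"
    then have "x \<in> (\<lambda>((j, i), k). b [^] j \<otimes> a [^] i \<otimes> c [^] k) ` (({0..<M} \<times> {0..<N}) \<times> {0..<t})"
      using sub by blast
    then obtain j i k where "j < M" "i < N" "k < t" "x = b [^] j \<otimes> a [^] i \<otimes> c [^] k" by auto
    then show "x \<in> ?h ` carrier ?H"
      unfolding car by (intro image_eqI[of _ _ "((j, i), int k)"]) auto
  qed
  show "finite (carrier ?H)" "card (carrier ?H) = order G" unfolding car using o by simp_all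
  show "?h x \<in> carrier G" for x using ab(1,2) c(1) by (simp split: prod.split)
  have comm: "b [^] (j::nat) \<otimes> a [^] (i::nat) \<otimes> c [^] (k::nat) = c [^] k \<otimes> (b [^] j \<otimes> a [^] i)" for j i k
  proof -
    have "a [^] i \<otimes> c [^] k = c [^] k \<otimes> a [^] i" "b [^] j \<otimes> c [^] k = c [^] k \<otimes> b [^] j"
      using ab c by (metis group_commutes_pow nat_pow_closed)+
    then show ?thesis using ab c by (metis m_assoc nat_pow_closed)
  qed
  have *: "b [^] (j + l) \<otimes> a [^] (i * r ^ l + k) \<otimes> c [^] (u + v) =
    b [^] j \<otimes> a [^] i \<otimes> c [^] u \<otimes> (b [^] l \<otimes> a [^] k \<otimes> c [^] v)" for i j k l u v :: nat
  proof -
    have "b [^] j \<otimes> a [^] i \<otimes> c [^] u \<otimes> (b [^] l \<otimes> a [^] k \<otimes> c [^] v)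
      = b [^] j \<otimes> a [^] i \<otimes> (c [^] u \<otimes> (b [^] l \<otimes> a [^] k)) \<otimes> c [^] v"
      using ab c by (simp add: m_assoc)
    also have "\<dots> = (b [^] j \<otimes> a [^] i) \<otimes> (b [^] l \<otimes> a [^] k) \<otimes> (c [^] u \<otimes> c [^] v)"
      unfolding comm[symmetric] using ab c by (simp add: m_assoc)
    finally show ?thesis
      unfolding normal_form_mult[OF ab(1,2,5)] using c by (simp add: nat_pow_mult)
  qed
  show "x \<otimes>\<^bsub>?H\<^esub> y \<in> carrier ?H \<and> ?h (x \<otimes>\<^bsub>?H\<^esub> y) = ?h x \<otimes> ?h y"
    if xy: "x \<in> carrier ?H" "y \<in> carrier ?H" for x y
  proof -
    obtain j i z l k w where e: "x = ((j, i), z)" "y = ((l, k), w)" by (metis surj_pair)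
    have m: "x \<otimes>\<^bsub>?H\<^esub> y = (((j + l) mod M, (i * r ^ l + k) mod N), (z + w) mod int t)"
      by (simp add: e metacyc_def)
    have zw: "0 \<le> z" "0 \<le> w" using xy unfolding car e by auto
    then have n: "nat ((z + w) mod int t) = (nat z + nat w) mod t"
      by (simp add: nat_mod_distrib nat_add_distrib)
    show ?thesis unfolding m car using pos
      by (simp add: e n pow_mod_eq[OF ab(1,3)] pow_mod_eq[OF ab(2,4)] pow_mod_eq[OF c(1,2)] *)
  qed
qed

end

section \<open>Groups of prime power order with a cyclic maximal subgroup\<close>

text \<open>All terms of the binomial expansion after the linear one contain the factor m^2.\<close>

lemma one_plus_power_cong:
  fixes m D :: nat assumes "D dvd m * m"
  shows "[(1 + m) ^ l = 1 + l * m] (mod D)"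
proof (induction l)
  case (Suc l)
  have "[(1 + m) * (1 + m) ^ l = (1 + m) * (1 + l * m)] (mod D)"
    using Suc by (rule cong_scalar_left)
  moreover have "(1 + m) * (1 + l * m) = (1 + Suc l * m) + l * (m * m)" by (simp add: algebra_simps)
  moreover have "[(1 + Suc l * m) + l * (m * m) = (1 + Suc l * m) + 0] (mod D)"
    using assms by (intro cong_add cong_refl) (auto simp: cong_0_iff)
  ultimately show ?case by (metis add.right_neutral cong_trans power_Suc)
qed simp

text \<open>Linearising each power leaves the arithmetic series q + j m q (q - 1) / 2. Evenness of m
  (q - 1) allows the halving to be done there, so that the whole factor q can be taken out.\<close>

lemma sum_one_plus_power_cong:
  fixes m D :: nat assumes "D dvd m * m" "even (m * (q - 1))"
  shows "[(\<Sum>l<q. ((1 + m) ^ j) ^ l) = q * (1 + j * (m * (q - 1) div 2))] (mod D)"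
proof -
  have tri: "2 * (\<Sum>l<k. l) = k * (k - 1)" for k :: nat
  proof (induction k)
    case (Suc k)
    then have "2 * (\<Sum>l<Suc k. l) = k * (k - 1) + 2 * k" by simp
    also have "\<dots> = Suc k * k" by (cases k) (auto simp: algebra_simps)
    finally show ?case by simp
  qed simp
  have "[(\<Sum>l<q. ((1 + m) ^ j) ^ l) = (\<Sum>l<q. 1 + (j * l) * m)] (mod D)"
    using one_plus_power_cong[OF assms(1)] by (intro cong_sum) (simp add: power_mult[symmetric])
  moreover have "(\<Sum>l<q. 1 + (j * l) * m) = q * (1 + j * (m * (q - 1) div 2))"
  proof -
    obtain e where e: "m * (q - 1) = 2 * e" using assms(2) by blast
    have "(\<Sum>l<q. 1 + (j * l) * m) = q + j * m * (\<Sum>l<q. l)"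
      by (simp only: sum.distrib sum_constant card_lessThan sum_distrib_left) (simp add: ac_simps)
    moreover have "2 * (j * m * (\<Sum>l<q. l)) = 2 * (q * (j * e))"
    proof -
      have "2 * (j * m * (\<Sum>l<q. l)) = j * m * (2 * (\<Sum>l<q. l))" by simp
      also have "\<dots> = j * q * (m * (q - 1))" unfolding tri by (simp add: ac_simps)
      finally show ?thesis unfolding e by (simp add: ac_simps)
    qed
    ultimately show ?thesis unfolding e by (simp add: distrib_left)
  qed
  ultimately show ?thesis by simp
qed

section \<open>Normal forms over a cyclic subgroup of prime index\<close>

context finite_group begin

text \<open>If A had a different conjugate B, then |A B| = |A| |B| / |A \<inter> B| would be at
  least |G|, so G = A B. But a group is never the product of a proper subgroup and one of its
  conjugates.\<close>

lemma prime_index_normal: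
  assumes q: "Factorial_Ring.prime (q::nat)" and A: "subgroup A G" "card A = q ^ n" and o: "order G = q ^ Suc n"
  shows "A \<lhd> G"
proof -
  interpret A: subgroup A G by fact
  have "conjugate g A \<subseteq> A" if g: "g \<in> carrier G" for g
  proof (rule ccontr)
    assume not: "\<not> conjugate g A \<subseteq> A"
    let ?B = "conjugate g A"
    have B: "subgroup ?B G" "card ?B = q ^ n"
      using conjugate_subgroup[OF A(1) g] card_conjugate[OF g A.subset] A(2) by auto
    have sI: "subgroup (A \<inter> ?B) G" using subgroups_Inter_pair[OF A(1) B(1)] .
    have "card (A \<inter> ?B) dvd q ^ n" using card_subgroup_mono_dvd[OF sI A(1)] A(2) by auto
    then obtain i where i: "i \<le> n" "card (A \<inter> ?B) = q ^ i" using q divides_primepow_nat by blast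
    have "i \<noteq> n"
    proof
      assume "i = n"
      then have "A \<inter> ?B = ?B" using i B finite_subgroup[OF B(1)] by (intro card_subset_eq) auto
      then show False using not by blast
    qed
    then have "i < n" using i by simp
    have "card (A <#> ?B) * q ^ i = q ^ n * q ^ n" using card_set_mult[OF A(1) B(1)] A B i by simp
    also have "q ^ n * q ^ n = q ^ (n + (n - i)) * q ^ i"
      using \<open>i < n\<close> by (simp add: power_add[symmetric])
    finally have "card (A <#> ?B) = q ^ (n + (n - i))" using prime_gt_0_nat[OF q] by simp
    moreover have "q ^ Suc n \<le> q ^ (n + (n - i))"
      using \<open>i < n\<close> prime_gt_0_nat[OF q] by (intro power_increasing) auto
    ultimately have "card (A <#> ?B) \<ge> card (carrier G)" using o by (simp add: order_def)
    moreover have "A <#> ?B \<subseteq> carrier G"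
      using A.subset subgroup.subset[OF B(1)] set_mult_closed by simp
    ultimately have "A <#> ?B = carrier G" using card_seteq[OF fin] by simp
    \<comment> \<open>Writing \<open>g\<inverse> = h (g k g\<inverse>)\<close> and cancelling \<open>g\<inverse>\<close> on the right puts \<open>g\<close> into \<open>A\<close>.\<close>
    then have "inv g \<in> A <#> ?B" using g by simp
    then obtain h k where hk: "h \<in> A" "k \<in> A" "inv g = h \<otimes> (g \<otimes> k \<otimes> inv g)"
      by (auto simp: set_mult_def conjugate_def)
    then have c: "h \<in> carrier G" "k \<in> carrier G" by auto
    have "inv g = h \<otimes> g \<otimes> k \<otimes> inv g" using hk c g by (simp add: m_assoc)
    then have "h \<otimes> g \<otimes> k = \<one>" using c g by (metis inv_closed m_closed r_cancel_one')
    then have "g = inv h \<otimes> inv k"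
      using c g by (metis inv_closed inv_equality inv_solve_left m_assoc m_closed)
    then have "g \<in> A" using hk by simp
    then have "?B \<subseteq> A" by (auto simp: conjugate_def)
    then show False using not by simp
  qed
  then show ?thesis using A normal_iff_conjugate_subset by blast
qed

end

locale cyclic_maximal_subgroup = finite_group +
  fixes q n a
  assumes q: "Factorial_Ring.prime (q::nat)" and o: "order G = q * q ^ n"
    and a: "a \<in> carrier G" "ord a = q ^ n"
begin

abbreviation "A \<equiv> generate G {a}"

lemma A_subgroup: "subgroup A G" using a generate_is_subgroup by simp

lemma A_powers: "A = (\<lambda>i::nat. a [^] i) ` {..<q ^ n}"
  using generate_eq_powers[OF a(1)] a by simp

lemma a_pow_in_A: "a [^] (i::nat) \<in> A" using pow_in_generate a by blast

lemma A_normal: "A \<lhd> G"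
  using prime_index_normal[OF q A_subgroup] o a generate_pow_card by simp

lemma a_pow_q: "a [^] (q ^ n) = \<one>" using a pow_ord_eq_1 by metis

lemma a_pow_eq_one_iff: "a [^] (i::nat) = \<one> \<longleftrightarrow> q ^ n dvd i" using pow_eq_id[OF a(1)] a(2) by simp

text \<open>The order of b is a power of q and d is coprime to q, so b^d generates the same cyclic
  subgroup as b.\<close>

lemma pow_notin_A:
  assumes b: "b \<in> carrier G" "b \<notin> A" and d: "0 < d" "d < q"
  shows "b [^] (d::nat) \<notin> A"
proof
  assume dA: "b [^] d \<in> A"
  have "ord b dvd q ^ Suc n" using ord_dvd_group_order[OF b(1)] o by simp
  then obtain k where k: "ord b = q ^ k" using q divides_primepow_nat by blast
  have "coprime d q" using q d prime_imp_coprime_nat[of q d] coprime_commute nat_dvd_not_less by blast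
  then have "ord (b [^] d) = ord b" using pow_ord_eq_ord_iff[OF fin b(1)] k by simp
  moreover have "subgroup (generate G {b}) G" using generate_is_subgroup b by simp
  ultimately have "generate G {b [^] d} = generate G {b}"
    using generate_eqI[of "generate G {b}" "b [^] d"] pow_in_generate[OF b(1)] generate_pow_card[OF b(1)] by simp
  moreover have "generate G {b [^] d} \<subseteq> A"
    using dA by (intro generate_subgroup_incl[OF _ A_subgroup]) simp
  ultimately have "b \<in> A" using generate.incl[of b "{b}" G] by blast
  then show False using b by simp
qed

text \<open>Two equal normal forms with different exponents of b would put a power b^d with 0 < d <
  q into \<open>A\<close>. So the q * q^n products are distinct and exhaust G.\<close>

lemma normal_form:
  assumes b: "b \<in> carrier G" "b \<notin> A"
  shows "carrier G \<subseteq> (\<lambda>(j, i). b [^] j \<otimes> a [^] i) ` ({0..<q} \<times> {0..<q ^ n})"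
proof -
  let ?f = "\<lambda>(j, i). b [^] j \<otimes> a [^] i" let ?D = "{0..<q} \<times> {0..<q ^ n}"
  interpret A: subgroup A G by (rule A_subgroup)
  have aux: False if "b [^] j \<otimes> a [^] i = b [^] j' \<otimes> a [^] i'" "j < j'" "j' < q" for j j' i i' :: nat
  proof -
    have "b [^] j' = b [^] j \<otimes> b [^] (j' - j)" using that b by (simp add: nat_pow_mult)
    then have "b [^] j \<otimes> a [^] i = b [^] j \<otimes> (b [^] (j' - j) \<otimes> a [^] i')" using that b a by (simp add: m_assoc)
    then have "a [^] i = b [^] (j' - j) \<otimes> a [^] i'" using a b by simp
    then have "b [^] (j' - j) = a [^] i \<otimes> inv (a [^] i')" using a b by (simp add: inv_solve_right)
    then have "b [^] (j' - j) \<in> A" using a_pow_in_A by simp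
    then show False using pow_notin_A[OF b] that by simp
  qed
  have "inj_on ?f ?D"
  proof (rule inj_onI, clarsimp)
    fix j i j' i' :: nat assume *: "j < q" "j' < q" "i < q ^ n" "i' < q ^ n" "b [^] j \<otimes> a [^] i = b [^] j' \<otimes> a [^] i'"
    then have jj: "j = j'" using aux[of j i j' i'] aux[of j' i' j i] by (metis linorder_neqE_nat)
    then have "a [^] i = a [^] i'" using * a b by simp
    then have "i = i'" using pow_eq_iff_mod[OF a(1)] a(2) * by simp
    then show "j = j' \<and> i = i'" using jj by simp
  qed
  then have "card (?f ` ?D) = card (carrier G)" using o by (simp add: card_image order_def)
  moreover have "?f ` ?D \<subseteq> carrier G" using a b by auto
  ultimately show ?thesis using card_subset_eq[OF fin] by blast
qed

lemma pow_q_in_A: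
  assumes b: "b \<in> carrier G" "b \<notin> A" obtains s where "b [^] q = a [^] (s::nat)"
proof -
  interpret A: subgroup A G by (rule A_subgroup)
  have "b [^] q \<in> (\<lambda>(j, i). b [^] j \<otimes> a [^] i) ` ({0..<q} \<times> {0..<q ^ n})"
    using normal_form[OF b] b by blast
  then obtain j i where ji: "j < q" "b [^] q = b [^] j \<otimes> a [^] (i::nat)" by auto
  have "j = 0"
  proof (rule ccontr)
    assume "j \<noteq> 0"
    have "b [^] j \<otimes> b [^] (q - j) = b [^] j \<otimes> a [^] i" using ji b by (simp add: nat_pow_mult)
    then have "b [^] (q - j) = a [^] i" using a b by simp
    then show False using pow_notin_A[OF b, of "q - j"] a_pow_in_A ji \<open>j \<noteq> 0\<close> by simp
  qed
  then show thesis using that ji a by simp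
qed

lemma conj_exponent:
  assumes b: "b \<in> carrier G" obtains r where "r < q ^ n" "a \<otimes> b = b \<otimes> a [^] r"
proof -
  have "inv b \<otimes> a \<otimes> inv (inv b) \<in> A"
    using A_normal inv_closed[OF b] generate.incl[of a "{a}" G] unfolding normal_inv_iff by blast
  then obtain r where r: "r < q ^ n" "inv b \<otimes> a \<otimes> b = a [^] r" using A_powers b by auto
  have "b \<otimes> a [^] r = a \<otimes> b" unfolding r(2)[symmetric] using a b by (simp add: m_assoc[symmetric])
  then show thesis using that r by simp
qed

text \<open>The first congruence says that b^q, being a power of a, commutes with a. The second says
  that b commutes with its own power b^q = a^s.\<close>

lemma conj_exponent_cong:
  assumes b: "b \<in> carrier G" "a \<otimes> b = b \<otimes> a [^] r" "b [^] q = a [^] (s::nat)"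
  shows "[r ^ q = 1] (mod q ^ n)" "[s * r = s] (mod q ^ n)"
proof -
  have "a [^] (1::nat) \<otimes> b [^] q = b [^] q \<otimes> a [^] (1 * r ^ q)" by (rule pow_conj_commute[OF a(1) b(1,2)])
  then have "a \<otimes> a [^] s = a [^] s \<otimes> a [^] (r ^ q)" using a b by simp
  moreover have "a \<otimes> a [^] s = a [^] s \<otimes> a [^] (1::nat)" using a by (metis nat_pow_Suc2 nat_pow_Suc nat_pow_eone)
  ultimately have "a [^] (r ^ q) = a [^] (1::nat)" using a by simp
  then show "[r ^ q = 1] (mod q ^ n)" unfolding pow_eq_iff_mod[OF a(1)] a(2) cong_def .
  have "a [^] s \<otimes> b [^] (1::nat) = b [^] (1::nat) \<otimes> a [^] (s * r ^ 1)" by (rule pow_conj_commute[OF a(1) b(1,2)])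
  moreover have "b [^] q \<otimes> b = b \<otimes> b [^] q" using b by (metis nat_pow_Suc2 nat_pow_Suc)
  ultimately have "b \<otimes> a [^] (s * r) = b \<otimes> a [^] s" using a b by simp
  then have "a [^] (s * r) = a [^] s" using a b by simp
  then show "[s * r = s] (mod q ^ n)" unfolding pow_eq_iff_mod[OF a(1)] a(2) cong_def .
qed

lemma metacyclic_gens_if_complement:
  assumes "b \<in> carrier G" "b \<notin> A" "a \<otimes> b = b \<otimes> a [^] r" "b [^] q = \<one>"
  shows "metacyclic_gens q (q ^ n) r a b"
  unfolding metacyclic_gens_def using assms a o a_pow_q normal_form by simp

text \<open>The element b is corrected by a power of a, which does not change its action on a. The
  condition on the exponent of G makes s divisible by q, and the geometric sum contributes exactly
  one factor q together with a unit u, so the q-th power can be cancelled.\<close>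

lemma exists_complement:
  assumes n: "n > 0" and ex: "carrier G \<subseteq> Fset G (q ^ n)"
    and b: "b \<in> carrier G" "b \<notin> A" "a \<otimes> b = b \<otimes> a [^] r"
    and sm: "[(\<Sum>l<q. r ^ l) = q * u] (mod q ^ n)" and u: "coprime u q"
  obtains b' where "metacyclic_gens q (q ^ n) r a b'"
proof -
  let ?N = "q ^ n"
  interpret A: subgroup A G by (rule A_subgroup)
  obtain s where s: "b [^] q = a [^] (s::nat)" using pow_q_in_A[OF b(1,2)] .
  have qn: "q ^ n = q * q ^ (n - 1)" using n by (simp add: power_eq_if)
  have "b [^] (q ^ n) = \<one>" using ex b by (auto simp: Fset_def)
  then have "a [^] (s * q ^ (n - 1)) = \<one>"
    unfolding qn using a b s by (simp add: nat_pow_pow[symmetric])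
  then have "q * q ^ (n - 1) dvd s * q ^ (n - 1)" using a_pow_eq_one_iff qn by simp
  then have "q dvd s" using prime_gt_0_nat[OF q] by simp
  then obtain s' where s': "s = q * s'" by blast
  have "coprime u ?N" using u by simp
  then obtain v where v: "[u * v = 1] (mod ?N)" using cong_solve_coprime_nat[of u ?N] by auto
  \<comment> \<open>\<open>(b a\<^sup>c)\<^sup>q = a\<^bsup>s + c q u\<^esup>\<close>, so \<open>c = - s' u\<inverse>\<close> modulo \<open>q\<^sup>n\<close> is the right exponent.\<close>
  define c where "c = (?N - 1) * s' * v"
  have ac: "a [^] c \<in> carrier G" using a by simp
  have "(b \<otimes> a [^] c) [^] q = b [^] (1 * q) \<otimes> a [^] (c * (\<Sum>l<q. (r ^ 1) ^ l))"
    using normal_form_pow[OF a(1) b(1,3), of 1 c q] b by simp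
  also have "\<dots> = a [^] (s + c * (\<Sum>l<q. r ^ l))" using a s by (simp add: nat_pow_mult)
  also have "\<dots> = \<one>"
  proof -
    have "[s + c * (\<Sum>l<q. r ^ l) = s + c * (q * u)] (mod ?N)"
      using sm by (intro cong_add cong_refl cong_mult)
    moreover have "s + c * (q * u) = q * s' + (?N - 1) * (q * s') * (u * v)"
      by (simp add: c_def s' ac_simps)
    moreover have "[q * s' + (?N - 1) * (q * s') * (u * v) = q * s' + (?N - 1) * (q * s') * 1] (mod ?N)"
      using v by (intro cong_add cong_refl cong_mult)
    moreover have "q * s' + (?N - 1) * (q * s') * 1 = ?N * (q * s')"
      using prime_gt_0_nat[OF q] by (simp add: diff_mult_distrib)
    ultimately have "[s + c * (\<Sum>l<q. r ^ l) = ?N * (q * s')] (mod ?N)" by (metis cong_trans)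
    from cong_dvd_iff[OF this] have "?N dvd s + c * (\<Sum>l<q. r ^ l)" by simp
    then show ?thesis using a_pow_eq_one_iff by simp
  qed
  finally have one: "(b \<otimes> a [^] c) [^] q = \<one>" .
  have "a \<otimes> (b \<otimes> a [^] c) = b \<otimes> (a [^] r \<otimes> a [^] c)"
    using a b by (metis m_assoc nat_pow_closed)
  also have "\<dots> = (b \<otimes> a [^] c) \<otimes> a [^] r" using a b by (simp add: nat_pow_mult m_assoc add.commute)
  finally have "a \<otimes> (b \<otimes> a [^] c) = (b \<otimes> a [^] c) \<otimes> a [^] r" .
  moreover have "b \<otimes> a [^] c \<notin> A"
  proof
    assume "b \<otimes> a [^] c \<in> A"
    then have "b \<otimes> a [^] c \<otimes> inv (a [^] c) \<in> A" using a_pow_in_A by simp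
    then show False using b a by (simp add: m_assoc)
  qed
  ultimately have "metacyclic_gens q ?N r a (b \<otimes> a [^] c)"
    using one a b by (intro metacyclic_gens_if_complement) auto
  then show thesis by (rule that)
qed


end

section \<open>Roots of unity and geometric sums modulo prime powers\<close>

lemma one_plus_power_eq: "(1 + x) ^ k = 1 + x * (\<Sum>l<k. (1 + x) ^ l)" for x :: nat
  by (induction k) (auto simp: algebra_simps)

text \<open>By Fermat r = 1 + x with q dividing x. Then r^q - 1 is x times the geometric sum, and
  for odd q this sum contains q exactly once, so x has to absorb the remaining q^(n-1).\<close>

lemma odd_prime_power_root_of_unity:
  fixes q r :: nat
  assumes q: "Factorial_Ring.prime q" "odd q" and n: "n > 0"
    and c: "[r ^ q = 1] (mod q ^ n)" and r: "r < q ^ n" "r \<noteq> 1"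
  obtains w where "r = 1 + q ^ (n - 1) * w" "0 < w" "w < q" "n \<ge> 2"
proof -
  have q1: "q > 1" using prime_gt_1_nat[OF q(1)] .
  have qn: "q ^ n = q * q ^ (n - 1)" using n by (simp add: power_eq_if)
  have cq: "[r ^ q = 1] (mod q)" using c qn by (metis cong_dvd_modulus_nat dvd_triv_left)
  have nd: "\<not> q dvd r"
  proof
    assume "q dvd r"
    then have "q dvd r ^ q" using q1 by (simp add: dvd_power_same dvd_trans[OF _ dvd_power[of q r]])
    then have "q dvd 1" using cong_dvd_iff[OF cq] by simp
    then show False using q1 by simp
  qed
  have "[r ^ (q - 1) = 1] (mod q)" using fermat_theorem[OF q(1) nd] .
  then have "[r * r ^ (q - 1) = r * 1] (mod q)" by (intro cong_mult cong_refl)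
  moreover have "r * r ^ (q - 1) = r ^ q" using q1 by (simp add: power_eq_if)
  ultimately have "[r = 1] (mod q)" using cq by (metis cong_sym cong_trans mult.right_neutral)
  moreover have "r \<noteq> 0" using nd by (metis dvd_0_right)
  ultimately have qx: "q dvd r - 1" by (simp add: cong_altdef_nat)
  define x where "x = r - 1"
  have rx: "r = 1 + x" "x \<noteq> 0" using \<open>r \<noteq> 0\<close> r by (auto simp: x_def)
  have qx: "q dvd x" using qx x_def by simp
  let ?S = "\<Sum>l<q. (1 + x) ^ l"
  define e where "e = x * (q - 1) div 2"
  have qe: "q dvd e"
  proof -
    have "e = x * ((q - 1) div 2)" unfolding e_def using q(2) by (intro div_mult_swap[symmetric]) simp
    then show ?thesis using qx by simp
  qed
  \<comment> \<open>Working modulo q^2 suffices to see that q divides the sum only once. Oddness of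
    q enters through e, which is then still divisible by q.\<close>
  have S: "[?S = q * (1 + e)] (mod q * q)"
    using sum_one_plus_power_cong[of "q * q" x q 1] qx q(2) by (simp add: mult_dvd_mono e_def)
  have "[?S = q * (1 + e)] (mod q)" using S by (metis cong_dvd_modulus_nat dvd_triv_left)
  then have "q dvd ?S" using cong_dvd_iff by (metis dvd_triv_left)
  then obtain u where u: "?S = q * u" by blast
  have "\<not> q dvd u"
  proof
    assume "q dvd u"
    then have "q * q dvd ?S" using u by simp
    then have "q * q dvd q * (1 + e)" using cong_dvd_iff[OF S] by simp
    then have "q dvd 1 + e" unfolding nat_mult_dvd_cancel_disj using q1 by linarith
    then have "q dvd 1" using qe by (metis dvd_add_left_iff)
    then show False using q1 by simp
  qed
  then have cop: "coprime (q ^ (n - 1)) u" using q(1) by (simp add: prime_imp_coprime)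
  have "q ^ n dvd r ^ q - 1" using c \<open>r \<noteq> 0\<close> by (simp add: cong_altdef_nat)
  moreover have "r ^ q - 1 = q * (x * u)" unfolding rx(1) one_plus_power_eq[of x q] u by simp
  ultimately have "q ^ (n - 1) dvd x * u" using qn q1 by simp
  then have "q ^ (n - 1) dvd x" using cop by (simp add: coprime_dvd_mult_left_iff)
  then obtain w where w: "x = q ^ (n - 1) * w" by blast
  have "q ^ (n - 1) * w < q ^ (n - 1) * q" using r w rx qn by (metis Suc_lessD mult.commute plus_1_eq_Suc)
  then have "w < q" by (metis mult_less_cancel1)
  moreover have "w > 0" using w rx by (cases w) auto
  \<comment> \<open>For n = 1 the number x would equal w, positive and smaller than q, yet q divides
    x.\<close>
  moreover have "n \<ge> 2"
  proof (rule ccontr)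
    assume "\<not> n \<ge> 2"
    then have "n = 1" using n by simp
    then have "x = w" using w by simp
    then show False using qx \<open>w < q\<close> \<open>w > 0\<close> by (simp add: nat_dvd_not_less)
  qed
  ultimately show thesis using that w rx by blast
qed

text \<open>Writing r = 1 + 2 k gives r^2 - 1 = 4 k (k + 1), and only one of k and k + 1 is even, so
  the other can be cancelled. Even k yields the modular exponent. Odd k yields r = -1 or r = -1 +
  2^(n-1) modulo 2^n, the exponents of the dihedral, quaternion and semidihedral groups.\<close>

lemma two_power_root_of_unity:
  fixes r :: nat
  assumes n: "n > 0" and c: "[r ^ 2 = 1] (mod 2 ^ n)" and r: "r < 2 ^ n" "r \<noteq> 1"
  obtains "r = 1 + 2 ^ (n - 1)" "n \<ge> 3"
    | k where "r = 1 + 2 * k" "odd k" "2 ^ n dvd 2 * (r + 1)" "n \<ge> 2"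
proof -
  have tn: "2 ^ n = 2 * (2::nat) ^ (n - 1)" using n by (simp add: power_eq_if)
  have "[r ^ 2 = 1] (mod 2)" using c tn by (metis cong_dvd_modulus_nat dvd_triv_left)
  then have "odd r" using cong_dvd_iff by fastforce
  then obtain k where k: "r = 1 + 2 * k" by (metis oddE add.commute)
  have "2 ^ n dvd r ^ 2 - 1" using c k by (simp add: cong_altdef_nat)
  moreover have "r ^ 2 - 1 = 2 * k * (2 * (k + 1))" unfolding k by (simp add: power2_eq_square algebra_simps)
  ultimately have d: "2 ^ n dvd 2 * k * (2 * (k + 1))" by simp
  show thesis
  proof (cases "even k")
    case True
    have "2 * 2 ^ (n - 1) dvd 2 * (2 * k * (k + 1))" using d tn by (simp add: ac_simps)
    then have "2 ^ (n - 1) dvd 2 * k * (k + 1)" by (simp only: nat_mult_dvd_cancel_disj) simp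
    moreover have "coprime (2 ^ (n - 1)) (k + 1)" using True by simp
    ultimately have "2 ^ (n - 1) dvd 2 * k" by (simp only: coprime_dvd_mult_left_iff)
    then obtain w where w: "2 * k = 2 ^ (n - 1) * w" by blast
    have "2 ^ (n - 1) * w < 2 ^ (n - 1) * 2" using r k w tn by linarith
    then have "w < 2" by (metis mult_less_cancel1)
    moreover have "w \<noteq> 0" using w k r by auto
    ultimately have "w = 1" by simp
    then have r': "r = 1 + 2 ^ (n - 1)" using k w by simp
    moreover have "n \<ge> 3"
    proof (rule ccontr)
      assume "\<not> n \<ge> 3"
      then have "n = 1 \<or> n = 2" using n by auto
      then show False using r' k True r by auto
    qed
    ultimately show thesis using that by blast
  next
    case False
    have "2 * k * (2 * (k + 1)) = 4 * (k + 1) * k" by (simp add: algebra_simps)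
    with d have "2 ^ n dvd 4 * (k + 1) * k" by metis
    moreover have "coprime (2 ^ n) k" using False by simp
    ultimately have "2 ^ n dvd 4 * (k + 1)" by (simp only: coprime_dvd_mult_left_iff)
    moreover have "4 * (k + 1) = 2 * (r + 1)" using k by simp
    ultimately have "2 ^ n dvd 2 * (r + 1)" by metis
    moreover have "n \<ge> 2"
    proof (rule ccontr)
      assume "\<not> n \<ge> 2"
      then have "n = 1" using n by auto
      then show False using k r False by (cases k) auto
    qed
    ultimately show thesis using that k False by blast
  qed
qed

text \<open>With m = q^(n-1) the unit is u = 1 + j m (q - 1) / 2, and u is 1 modulo q. For odd q
  this follows from q dividing m; for q = 2 it needs 4 to divide m, hence n \<ge> 3. At q = n = 2
  the exponent 1 + m would be 3, which is inversion modulo 4.\<close>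

lemma modular_sum_cong:
  fixes q n :: nat
  assumes q: "Factorial_Ring.prime q" and n: "n \<ge> 2" "odd q \<or> n \<ge> 3"
  obtains u where "coprime u q" "[(\<Sum>l<q. ((1 + q ^ (n - 1)) ^ j) ^ l) = q * u] (mod q ^ n)"
proof -
  define m where "m = q ^ (n - 1)"
  have qm: "q ^ n = q * m" unfolding m_def using n by (simp add: power_eq_if)
  have q_m: "q dvd m" unfolding m_def using n by simp
  then have mm: "q ^ n dvd m * m" unfolding qm by (simp add: mult_dvd_mono)
  have "even (m * (q - 1)) \<and> q dvd m * (q - 1) div 2"
  proof (cases "odd q")
    case True
    then have "m * (q - 1) div 2 = m * ((q - 1) div 2)" by (intro div_mult_swap[symmetric]) simp
    then show ?thesis using True q_m by simp
  next
    case False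
    then have q2: "q = 2" using q primes_dvd_imp_eq two_is_prime_nat by blast
    have "n - 1 = Suc (Suc (n - 3))" using False n by simp
    then have "m = 2 * (2 * 2 ^ (n - 3))" unfolding m_def q2 by simp
    then show ?thesis unfolding q2 by simp
  qed
  then have ev: "even (m * (q - 1))" and dv: "q dvd m * (q - 1) div 2" by auto
  have "coprime (1 + j * (m * (q - 1) div 2)) q"
  proof (rule coprimeI)
    fix d assume "d dvd 1 + j * (m * (q - 1) div 2)" "d dvd q"
    then show "is_unit d" using dv by (metis dvd_add_left_iff dvd_mult dvd_trans)
  qed
  then show thesis using that sum_one_plus_power_cong[OF mm ev, of j] unfolding m_def by blast
qed

section \<open>Classification of q-groups with a cyclic maximal subgroup and few solutions\<close>

context cyclic_maximal_subgroup begin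

lemma exists_notin_A: obtains b where "b \<in> carrier G" "b \<notin> A"
proof -
  have "card A < card (carrier G)"
    unfolding generate_pow_card[OF a(1), symmetric] a(2) order_def[symmetric] o
    using prime_gt_1_nat[OF q] by simp
  then have "\<not> carrier G \<subseteq> A"
    using card_mono[OF finite_subgroup[OF A_subgroup]] by (metis not_le)
  then show thesis using that by blast
qed

text \<open>Replacing b by b^i with w i = 1 modulo q normalises the exponent: (1 + m w)^i is 1 + m w
  i, that is 1 + m, modulo q^n, where m = q^(n-1).\<close>

lemma modular_case:
  assumes n: "n \<ge> 2" "odd q \<or> n \<ge> 3" and ex: "carrier G \<subseteq> Fset G (q ^ n)"
    and b: "b \<in> carrier G" "b \<notin> A" "a \<otimes> b = b \<otimes> a [^] (1 + q ^ (n - 1) * w)" and w: "0 < w" "w < q"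
  shows "G \<cong> metacyc q (q ^ n) (1 + q ^ (n - 1))"
proof -
  define m where "m = q ^ (n - 1)"
  have q1: "q > 1" using prime_gt_1_nat[OF q] .
  have qm: "q ^ n = q * m" unfolding m_def using n by (simp add: power_eq_if)
  have q_m: "q dvd m" unfolding m_def using n by simp
  then have mm: "q ^ n dvd m * m" unfolding qm by (simp add: mult_dvd_mono)
  have "coprime q w" using w by (intro prime_imp_coprime[OF q]) (simp add: nat_dvd_not_less)
  then have "coprime w q" by (simp add: coprime_commute)
  then obtain i0 where i0: "[w * i0 = 1] (mod q)" using cong_solve_coprime_nat[of w q] by auto
  \<comment> \<open>The reduction modulo q places i strictly between 0 and q, so that b^i stays
    outside \<open>A\<close>.\<close>
  define i where "i = i0 mod q"
  have i: "[w * i = 1] (mod q)" using i0 unfolding i_def cong_def by (simp add: mod_mult_right_eq)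
  have "i \<noteq> 0"
  proof
    assume "i = 0"
    then show False using i q1 by (simp add: cong_def)
  qed
  have "i < q" unfolding i_def using q1 by simp
  let ?b = "b [^] i"
  have "[(1 + m * w) ^ i = 1 + i * (m * w)] (mod q ^ n)"
    using mm by (intro one_plus_power_cong) (metis dvd_mult2 mult.assoc mult.left_commute)
  moreover have "[1 + m * (w * i) = 1 + m * 1] (mod q ^ n)"
    unfolding qm using i by (intro cong_add cong_refl) (simp add: cong_def mult.commute mult_mod_right)
  ultimately have "[(1 + m * w) ^ i = 1 + m] (mod q ^ n)"
    by (metis cong_trans mult.assoc mult.commute mult.right_neutral)
  then have "a [^] ((1 + m * w) ^ i) = a [^] (1 + m)"
    unfolding pow_eq_iff_mod[OF a(1)] a(2) cong_def .
  moreover have "a [^] (1::nat) \<otimes> b [^] i = b [^] i \<otimes> a [^] (1 * (1 + m * w) ^ i)"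
    using pow_conj_commute[OF a(1) b(1) b(3)] unfolding m_def .
  ultimately have "a \<otimes> ?b = ?b \<otimes> a [^] (1 + m)" using a by simp
  moreover have "?b \<in> carrier G" "?b \<notin> A" using pow_notin_A[OF b(1,2)] \<open>i \<noteq> 0\<close> \<open>i < q\<close> b by auto
  moreover have "n > 0" using n by simp
  moreover obtain u where "coprime u q" "[(\<Sum>l<q. (1 + m) ^ l) = q * u] (mod q ^ n)"
    using modular_sum_cong[OF q n, of 1] unfolding m_def by auto
  ultimately obtain b' where "metacyclic_gens q (q ^ n) (1 + m) a b'"
    using exists_complement[OF _ ex] by metis
  then show ?thesis using iso_metacyc q1 by (simp add: m_def)
qed

lemma abelian_case:
  assumes n: "n > 0" and ex: "carrier G \<subseteq> Fset G (q ^ n)"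
    and b: "b \<in> carrier G" "b \<notin> A" "a \<otimes> b = b \<otimes> a"
  shows "G \<cong> integer_mod_group (q ^ n) \<times>\<times> integer_mod_group q"
proof -
  have "a \<otimes> b = b \<otimes> a [^] (1::nat)" using b a by simp
  then obtain b' where "metacyclic_gens q (q ^ n) 1 a b'"
    using exists_complement[OF n ex b(1,2), of 1 1] by auto
  then show ?thesis using iso_integer_mod_groups prime_gt_0_nat[OF q] by simp
qed

text \<open>The coset b A contributes q^n solutions, and the subgroup of order q^k inside
  \<open>A\<close> contributes q^k more. This is the count that rules out the groups with too many
  elements of small order.\<close>

lemma card_Fset_ge_coset:
  assumes b: "b \<in> carrier G" "b \<notin> A" and F: "\<And>c::nat. b \<otimes> a [^] c \<in> Fset G (q ^ k)" and k: "k \<le> n"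
  shows "q ^ n + q ^ k \<le> card (Fset G (q ^ k))"
proof -
  let ?B = "(\<lambda>x. b \<otimes> x) ` A" let ?C = "generate G {a [^] (q ^ (n - k))}"
  have dv: "q ^ (n - k) dvd ord a" using a(2) by (simp add: le_imp_power_dvd)
  have q0: "q > 0" using prime_gt_0_nat[OF q] .
  have "ord (a [^] (q ^ (n - k))) = q ^ n div q ^ (n - k)"
    using ord_pow[OF a(1) dv] a(2) q0 by simp
  then have oc: "ord (a [^] (q ^ (n - k))) = q ^ k" using k q0 by (simp add: power_diff[symmetric])
  have sC: "subgroup ?C G" using generate_is_subgroup a by simp
  have cC: "card ?C = q ^ k" using generate_pow_card[of "a [^] (q ^ (n - k))"] a oc by simp
  have CA: "?C \<subseteq> A" using a_pow_in_A by (intro generate_subgroup_incl[OF _ A_subgroup]) simp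
  have Asub: "A \<subseteq> carrier G" using subgroup.subset[OF A_subgroup] .
  have cB: "card ?B = q ^ n"
    using card_image[of "\<lambda>x. b \<otimes> x" A] inj_on_subset[OF inj_on_cmult[OF b(1)] Asub]
      generate_pow_card[OF a(1)] a(2) by simp
  have "?B \<inter> ?C = {}"
  proof -
    have False if "x \<in> A" "b \<otimes> x \<in> A" for x
    proof -
      have "b \<otimes> x \<otimes> inv x \<in> A" using that A_subgroup by (simp add: subgroup.m_closed subgroup.m_inv_closed)
      then show False using that b Asub by (simp add: m_assoc subset_iff)
    qed
    then show ?thesis using CA by blast
  qed
  moreover have "finite ?B" "finite ?C" using finite_subgroup A_subgroup sC by auto
  ultimately have "card (?B \<union> ?C) = q ^ n + q ^ k" using cB cC by (simp add: card_Un_disjoint)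
  moreover have "?B \<union> ?C \<subseteq> Fset G (q ^ k)"
  proof -
    have "?B \<subseteq> Fset G (q ^ k)" using F A_powers by auto
    moreover have "?C \<subseteq> Fset G (q ^ k)"
      using ord_dvd_card_subgroup[OF sC] cC subgroup.subset[OF sC] by (auto simp: Fset_iff_ord)
    ultimately show ?thesis by blast
  qed
  ultimately show ?thesis using card_mono[OF finite_Fset] by metis
qed

lemma classification:
  assumes n: "n > 0" and ex: "carrier G \<subseteq> Fset G (q ^ n)"
    and small: "\<And>k. k \<le> n \<Longrightarrow> card (Fset G (q ^ k)) < (q + 1) * q ^ k"
  shows "G \<cong> integer_mod_group (q ^ n) \<times>\<times> integer_mod_group q \<or> G \<cong> quaternion8 \<or>
    (n \<ge> 2 \<and> (odd q \<or> n \<ge> 3) \<and> G \<cong> metacyc q (q ^ n) (1 + q ^ (n - 1)))"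
proof -
  obtain b where b: "b \<in> carrier G" "b \<notin> A" using exists_notin_A .
  obtain r where r: "r < q ^ n" "a \<otimes> b = b \<otimes> a [^] r" using conj_exponent[OF b(1)] .
  obtain s where s: "b [^] q = a [^] (s::nat)" using pow_q_in_A[OF b] .
  note c = conj_exponent_cong[OF b(1) r(2) s]
  consider "r = 1" | "r \<noteq> 1" "odd q" | "r \<noteq> 1" "q = 2"
    using q primes_dvd_imp_eq two_is_prime_nat by blast
  then show ?thesis
  proof cases
    case 1 then show ?thesis using abelian_case[OF n ex b] r a by simp
  next
    case 2
    obtain w where "r = 1 + q ^ (n - 1) * w" "0 < w" "w < q" "n \<ge> 2"
      using odd_prime_power_root_of_unity[OF q 2(2) n c(1) r(1) 2(1)] .
    then show ?thesis using modular_case[OF _ _ ex b, of w] 2 r by simp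
  next
    case 3
    have c1: "[r ^ 2 = 1] (mod 2 ^ n)" and r1: "r < 2 ^ n" using c(1) r(1) 3(2) by auto
    show ?thesis
    proof (cases rule: two_power_root_of_unity[OF n c1 r1 3(1)])
      case 1 then show ?thesis using modular_case[OF _ _ ex b, of 1] 3 r by simp
    next
      case (2 k)
      \<comment> \<open>Here s (r - 1) = 2 s k with k odd, so b^2 = a^s has order at most 2.\<close>
      have "2 ^ n dvd s * r - s" using c(2) 3 2 by (simp add: cong_altdef_nat)
      moreover have "s * r - s = 2 * s * k" unfolding 2(1) by (simp add: algebra_simps)
      moreover have "coprime (2 ^ n) k" using 2 by simp
      ultimately have s2: "2 ^ n dvd 2 * s" by (simp only: coprime_dvd_mult_left_iff)
      have pw: "(b \<otimes> a [^] (i::nat)) [^] (t::nat) = b [^] t \<otimes> a [^] (i * (\<Sum>l<t. r ^ l))" for i t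
        using normal_form_pow[OF a(1) b(1) r(2), of 1 i t] b by simp
      have b2: "b [^] (2::nat) = a [^] s" using s 3 by simp
      show ?thesis
      proof (cases "n \<ge> 3")
        case True
        \<comment> \<open>The sum 1 + r + r^2 + r^3 factors as (r + 1)(1 + r^2) with an even second
          factor, so it is a multiple of 2 (r + 1) and of 2^n. All of b A therefore solves x^4 = 1,
          giving at least 2^n + 4 \<ge> 12 = 3 * 4 solutions.\<close>
        have "b \<otimes> a [^] (i::nat) \<in> Fset G (q ^ 2)" for i
        proof -
          have "(\<Sum>l<4. r ^ l) = (r + 1) * (1 + r ^ 2)"
            by (simp add: eval_nat_numeral algebra_simps)
          moreover have "even (1 + r ^ 2)" using 2 by simp
          then obtain e where e: "1 + r ^ 2 = 2 * e" by blast
          ultimately have "(\<Sum>l<4. r ^ l) = 2 * (r + 1) * e" unfolding e by (simp only: ac_simps)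
          then have "2 ^ n dvd i * (\<Sum>l<4. r ^ l)" using 2(3) by (metis dvd_mult dvd_mult2)
          then have "a [^] (i * (\<Sum>l<4. r ^ l)) = \<one>" using a_pow_eq_one_iff 3(2) by simp
          moreover have "b [^] (4::nat) = \<one>"
          proof -
            have "b [^] (4::nat) = (b [^] (2::nat)) [^] (2::nat)" using b by (simp add: nat_pow_pow)
            also have "\<dots> = a [^] (2 * s)" unfolding b2 using a by (simp add: nat_pow_pow mult.commute)
            finally show ?thesis using s2 a_pow_eq_one_iff 3(2) by simp
          qed
          ultimately have "(b \<otimes> a [^] i) [^] (4::nat) = \<one>" unfolding pw by simp
          then show ?thesis using a b 3(2) by (simp add: Fset_def)
        qed
        then have "q ^ n + q ^ 2 \<le> card (Fset G (q ^ 2))" using card_Fset_ge_coset[OF b] 2(4) by blast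
        moreover have "card (Fset G (q ^ 2)) < (q + 1) * q ^ 2" using small 2(4) by blast
        moreover have "(2::nat) ^ 3 \<le> 2 ^ n" using True by (intro power_increasing) auto
        ultimately show ?thesis using 3(2) by simp
      next
        case False
        then have n2: "n = 2" using 2(4) by simp
        then have "r = 3" using 2(1,2) r1 by (cases k) auto
        have "2 dvd s" using s2 n2 by simp
        \<comment> \<open>If b^2 = 1, then G is dihedral of order 8 and has at least 4 + 2 = 6
          solutions of x^2 = 1, while fewer than 3 * 2 are allowed. What remains is b^2 =
          a^2.\<close>
        have bq: "\<not> 4 dvd s"
        proof
          assume "4 dvd s"
          then have b1: "b [^] (2::nat) = \<one>" using b2 a_pow_eq_one_iff 3(2) n2 by simp
          have "b \<otimes> a [^] (i::nat) \<in> Fset G (q ^ 1)" for i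
          proof -
            have "(\<Sum>l<2. r ^ l) = 4" using \<open>r = 3\<close> by (simp add: numeral_2_eq_2)
            then have "a [^] (i * (\<Sum>l<2. r ^ l)) = \<one>" using a_pow_eq_one_iff 3(2) n2 by simp
            then have "(b \<otimes> a [^] i) [^] (2::nat) = \<one>" unfolding pw b1 by simp
            then show ?thesis using a b 3(2) by (simp add: Fset_def)
          qed
          then have "q ^ n + q ^ 1 \<le> card (Fset G (q ^ 1))" using card_Fset_ge_coset[OF b] n by (metis Suc_leI One_nat_def)
          moreover have "card (Fset G (q ^ 1)) < (q + 1) * q ^ 1" using small[of 1] n by simp
          ultimately show False using 3(2) n2 by simp
        qed
        have "s mod 4 = 2" using \<open>2 dvd s\<close> bq by presburger
        then have "b [^] (2::nat) = a [^] (2::nat)" unfolding b2 pow_eq_iff_mod[OF a(1)] using a(2) 3(2) n2 by simp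
        then have "G \<cong> quaternion8"
          using iso_quaternion8[OF a(1) b(1)] a_pow_q r(2) o normal_form[OF b] \<open>r = 3\<close> 3(2) n2 by simp
        then show ?thesis by simp
      qed
    qed
  qed
qed

end

section \<open>Cyclic normal Hall subgroups\<close>

context finite_group begin

lemma group_exponent_pos: "group_exponent G > 0"
proof -
  have "group_exponent G dvd order G"
    unfolding group_exponent_def using ord_dvd_group_order by (intro Lcm_least) auto
  moreover have "order G > 0" using order_gt_0_iff_finite by simp
  ultimately show ?thesis by (metis dvd_0_left gr0I)
qed

text \<open>A truncated quotient is at most q exactly when the numerator is below (q + 1) times the
  denominator. The divisor 1 makes the set under the maximum nonempty.\<close>

lemma mf_pp_le_iff:
  "mf_pp G \<le> q \<longleftrightarrow> (\<forall>p k. Factorial_Ring.prime p \<longrightarrow> p ^ k dvd group_exponent G \<longrightarrow>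
     card (Fset G (p ^ k)) < (q + 1) * p ^ k)"
proof -
  have "pp_divisors G \<subseteq> {d. d dvd group_exponent G}" by (auto simp: pp_divisors_def)
  then have f: "finite (frob_quot G ` pp_divisors G)"
    using finite_divisors_nat[OF group_exponent_pos] by (metis finite_imageI finite_subset)
  have "2 ^ 0 dvd group_exponent G" "Factorial_Ring.prime (2::nat)" by auto
  then have "2 ^ 0 \<in> pp_divisors G" unfolding pp_divisors_def by blast
  then have ne: "frob_quot G ` pp_divisors G \<noteq> {}" by blast
  have iff: "frob_quot G (p ^ k) \<le> q \<longleftrightarrow> card (Fset G (p ^ k)) < (q + 1) * p ^ k" if "Factorial_Ring.prime p" for p k
  proof -
    have "0 < p ^ k" using prime_gt_0_nat[OF that] by simp
    then have "card (Fset G (p ^ k)) div p ^ k < q + 1 \<longleftrightarrow> card (Fset G (p ^ k)) < (q + 1) * p ^ k"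
      by (rule div_less_iff_less_mult)
    then show ?thesis unfolding frob_quot_def by linarith
  qed
  have "mf_pp G \<le> q \<longleftrightarrow> (\<forall>n\<in>pp_divisors G. frob_quot G n \<le> q)"
    unfolding mf_pp_def Max_le_iff[OF f ne] by simp
  also have "\<dots> \<longleftrightarrow> (\<forall>p k. Factorial_Ring.prime p \<longrightarrow> p ^ k dvd group_exponent G \<longrightarrow> frob_quot G (p ^ k) \<le> q)"
    unfolding pp_divisors_def by auto
  finally show ?thesis using iff by simp
qed

lemma ord_dvd_group_exponent: "x \<in> carrier G \<Longrightarrow> ord x dvd group_exponent G"
  unfolding group_exponent_def by (intro dvd_Lcm) simp

text \<open>The commutator y x y^-1 x^-1 lies in K when read as (y x y^-1) x^-1 and in N when read
  as y (x y^-1 x^-1).\<close>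

lemma commute_normal_disjoint:
  assumes N: "N \<lhd> G" and K: "K \<lhd> G" and NK: "N \<inter> K = {\<one>}" and y: "y \<in> N" and x: "x \<in> K"
  shows "y \<otimes> x = x \<otimes> y"
proof -
  interpret N: subgroup N G using N normal_inv_iff by blast
  interpret K: subgroup K G using K normal_inv_iff by blast
  have c: "x \<in> carrier G" "y \<in> carrier G" using x y by auto
  have "y \<otimes> x \<otimes> inv y \<in> K" using K x c unfolding normal_inv_iff by blast
  then have "y \<otimes> x \<otimes> inv y \<otimes> inv x \<in> K" using x by simp
  moreover have "x \<otimes> inv y \<otimes> inv x \<in> N" using N N.m_inv_closed[OF y] c unfolding normal_inv_iff by blast
  then have "y \<otimes> (x \<otimes> inv y \<otimes> inv x) \<in> N" using y by simp
  then have "y \<otimes> x \<otimes> inv y \<otimes> inv x \<in> N" using c by (simp add: m_assoc)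
  ultimately have "y \<otimes> x \<otimes> inv y \<otimes> inv x = \<one>" using NK by blast
  then have "y \<otimes> x \<otimes> inv y = x" using c by (metis inv_closed inv_solve_right l_one m_closed one_closed)
  then show ?thesis using c by (metis inv_closed inv_solve_right m_closed)
qed

lemma Fset_normal: "subgroup (Fset G d) G \<Longrightarrow> Fset G d \<lhd> G"
  unfolding normal_inv_iff using Fset_conj by blast

lemma Fset_Int_coprime: "coprime d e \<Longrightarrow> Fset G d \<inter> Fset G e = {\<one>}"
proof -
  assume "coprime d e"
  then have "x = \<one>" if "x \<in> carrier G" "ord x dvd d" "ord x dvd e" for x
    using that ord_eq_1 coprime_common_divisor_nat by blast
  then show ?thesis by (auto simp: Fset_iff_ord)
qed

text \<open>Both solution sets are normal and meet trivially, so y and x commute and the order of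
  the product is d e. Conversely every solution of z^(d e) = 1 splits into one from each set, so
  there are at most d e solutions and they form the cyclic group generated by y x.\<close>

lemma cyclic_Fset_mult:
  assumes y: "y \<in> carrier G" "ord y = d" "Fset G d = generate G {y}"
    and x: "x \<in> carrier G" "ord x = e" "Fset G e = generate G {x}"
    and de: "coprime d e"
  shows "ord (y \<otimes> x) = d * e" "Fset G (d * e) = generate G {y \<otimes> x}"
proof -
  have sd: "subgroup (Fset G d) G" "card (Fset G d) = d"
    using y generate_is_subgroup generate_pow_card by auto
  have se: "subgroup (Fset G e) G" "card (Fset G e) = e"
    using x generate_is_subgroup generate_pow_card by auto
  have int: "Fset G d \<inter> Fset G e = {\<one>}" using Fset_Int_coprime[OF de] .
  have yd: "y \<in> Fset G d" "x \<in> Fset G e" using x y by (auto simp: Fset_iff_ord)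
  have comm: "y \<otimes> x = x \<otimes> y"
    using commute_normal_disjoint[OF Fset_normal[OF sd(1)] Fset_normal[OF se(1)] int yd] .
  have iff: "(y \<otimes> x) [^] k = \<one> \<longleftrightarrow> d * e dvd k" for k :: nat
  proof -
    have pm: "(y \<otimes> x) [^] k = y [^] k \<otimes> x [^] k" using pow_mult_distrib[OF comm] x y by simp
    have "y [^] k = \<one> \<and> x [^] k = \<one>" if "y [^] k \<otimes> x [^] k = \<one>"
    proof -
      have "y [^] k = inv (x [^] k)" using that x y by (metis inv_equality nat_pow_closed)
      moreover have "inv (x [^] k) \<in> Fset G e" "y [^] k \<in> Fset G d"
        using pow_in_generate x y subgroup.m_inv_closed[OF se(1)] by auto
      ultimately have "y [^] k = \<one>" using int by auto
      then show ?thesis using that x by simp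
    qed
    then have "(y \<otimes> x) [^] k = \<one> \<longleftrightarrow> y [^] k = \<one> \<and> x [^] k = \<one>"
      unfolding pm by auto
    also have "\<dots> \<longleftrightarrow> d dvd k \<and> e dvd k"
      using pow_eq_id[OF x(1)] pow_eq_id[OF y(1)] x(2) y(2) by simp
    also have "\<dots> \<longleftrightarrow> d * e dvd k" using de divides_mult by (metis dvd_mult_left dvd_mult_right)
    finally show ?thesis .
  qed
  then show o: "ord (y \<otimes> x) = d * e" using ord_unique[of "y \<otimes> x" "d * e"] x y by simp
  have d0: "d > 0" "e > 0" using ord_pos x y by auto
  have "Fset G (d * e) \<subseteq> (\<lambda>(u, v). u \<otimes> v) ` (Fset G d \<times> Fset G e)"
  proof
    fix z assume z: "z \<in> Fset G (d * e)"
    then have zc: "z \<in> carrier G" "z [^] (d * e) = \<one>" by (auto simp: Fset_def)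
    \<comment> \<open>By the Chinese remainder theorem e u + d v is 1 modulo d e. So z is the
      product of its powers with exponents e u and d v, the parts of order dividing d and e.\<close>
    obtain u where u: "[e * u = 1] (mod d)" using cong_solve_coprime_nat[of e d] de by (auto simp: coprime_commute)
    obtain v where v: "[d * v = 1] (mod e)" using cong_solve_coprime_nat[of d e] de by auto
    have "[e * u + d * v = 1 + 0] (mod d)" using u by (intro cong_add) (auto simp: cong_0_iff)
    moreover have "[e * u + d * v = 0 + 1] (mod e)" using v by (intro cong_add) (auto simp: cong_0_iff)
    ultimately have "[e * u + d * v = 1] (mod d * e)" using de by (intro coprime_cong_mult_nat) auto
    then have "z [^] (e * u + d * v) = z [^] (1::nat)" using zc unfolding cong_def by (intro pow_cong) auto
    then have "z = z [^] (e * u) \<otimes> z [^] (d * v)" using zc by (simp add: nat_pow_mult)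
    moreover have "z [^] (e * u) \<in> Fset G d" "z [^] (d * v) \<in> Fset G e"
    proof -
      have "(z [^] (e * u)) [^] d = (z [^] (d * e)) [^] u" "(z [^] (d * v)) [^] e = (z [^] (d * e)) [^] v"
        using zc(1) by (simp_all only: nat_pow_pow ac_simps)
      then show "z [^] (e * u) \<in> Fset G d" "z [^] (d * v) \<in> Fset G e" using zc by (simp_all add: Fset_def)
    qed
    ultimately show "z \<in> (\<lambda>(u, v). u \<otimes> v) ` (Fset G d \<times> Fset G e)"
      by (intro image_eqI[of _ _ "(z [^] (e * u), z [^] (d * v))"]) auto
  qed
  then have "card (Fset G (d * e)) \<le> card (Fset G d \<times> Fset G e)"
    by (intro surj_card_le) auto
  then have "card (Fset G (d * e)) \<le> card (generate G {y \<otimes> x})"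
    using sd se o generate_pow_card[of "y \<otimes> x"] x y by (simp add: card_cartesian_product)
  moreover have "generate G {y \<otimes> x} \<subseteq> Fset G (d * e)"
  proof
    have s: "subgroup (generate G {y \<otimes> x}) G" using generate_is_subgroup x y by simp
    fix z assume "z \<in> generate G {y \<otimes> x}"
    then show "z \<in> Fset G (d * e)"
      using ord_dvd_card_subgroup[OF s, of z] generate_pow_card[of "y \<otimes> x"] o x y subgroup.mem_carrier[OF s]
      by (simp add: Fset_iff_ord)
  qed
  ultimately show "Fset G (d * e) = generate G {y \<otimes> x}"
    using card_seteq[OF finite_Fset] by blast
qed

text \<open>An element whose order is a power of p generates a p-subgroup normalising P, which
  therefore lies in P.\<close>

lemma normal_sylow_eq_Fset:
  assumes p: "Factorial_Ring.prime (p::nat)" and P: "P \<lhd> G" "card P = p ^ multiplicity p (order G)"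
  shows "Fset G (p ^ multiplicity p (order G)) = P"
proof
  have sP: "subgroup P G" using P normal_inv_iff by blast
  show "P \<subseteq> Fset G (p ^ multiplicity p (order G))"
    using ord_dvd_card_subgroup[OF sP] P subgroup.mem_carrier[OF sP] by (auto simp: Fset_iff_ord)
  show "Fset G (p ^ multiplicity p (order G)) \<subseteq> P"
  proof
    fix y assume "y \<in> Fset G (p ^ multiplicity p (order G))"
    then have y: "y \<in> carrier G" "ord y dvd p ^ multiplicity p (order G)" by (auto simp: Fset_iff_ord)
    then obtain k where k: "ord y = p ^ k" using p divides_primepow_nat by blast
    have sY: "subgroup (generate G {y}) G" using generate_is_subgroup y by simp
    have cj: "conjugate g P = P" if "g \<in> generate G {y}" for g
    proof -
      have g: "g \<in> carrier G" using subgroup.mem_carrier[OF sY that] .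
      then have "conjugate g P \<subseteq> P" using P normal_iff_conjugate_subset by blast
      then show ?thesis
        using card_conjugate[OF g subgroup.subset[OF sP]] finite_subgroup[OF sP] card_subset_eq by metis
    qed
    have "generate G {y} \<subseteq> P"
      by (rule normalizing_subgroup_le_sylow[OF p sY _ sP P(2) cj, of k])
        (use generate_pow_card[OF y(1)] k in simp)
    then show "y \<in> P" using generate.incl[of y "{y}" G] by blast
  qed
qed

lemma set_mult_eq_carrier:
  assumes "subgroup H G" "subgroup K G" "H \<inter> K = {\<one>}" "card H * card K = order G"
  shows "H <#> K = carrier G"
proof -
  have "card (H <#> K) = card (carrier G)" using card_set_mult[OF assms(1,2)] assms(3,4) by (simp add: order_def)
  moreover have "H <#> K \<subseteq> carrier G" using assms(1,2) set_mult_closed subgroup.subset by metis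
  ultimately show ?thesis using card_subset_eq[OF fin] by blast
qed

end

section \<open>Sylow subgroups under a bound on the Frobenius quotients\<close>

locale small_frobenius_quotients = finite_group +
  fixes q :: nat
  assumes q: "Factorial_Ring.prime q" and q_dvd: "q dvd order G"
    and q_min: "\<And>p. Factorial_Ring.prime p \<Longrightarrow> p dvd order G \<Longrightarrow> q \<le> p"
    and small: "\<And>p k x. Factorial_Ring.prime p \<Longrightarrow> x \<in> carrier G \<Longrightarrow> ord x = p ^ k \<Longrightarrow>
      card (Fset G (p ^ k)) < (q + 1) * p ^ k"
begin

lemma order_pos: "order G > 0" using order_gt_0_iff_finite by simp

text \<open>Because q + 1 \<le> p, the bound reads p^n < p^(e+1), which leaves e = n. The result is
  phrased with \<open>Fset\<close> because solution sets for different primes can be multiplied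
  without choosing Sylow subgroups again.\<close>

lemma exists_normal_cyclic_sylow:
  assumes p: "Factorial_Ring.prime p" "p dvd order G" "p \<noteq> q"
  obtains x where "x \<in> carrier G" "ord x = p ^ multiplicity p (order G)"
    "Fset G (p ^ multiplicity p (order G)) = generate G {x}"
proof -
  let ?n = "multiplicity p (order G)"
  have qp: "q < p" using q_min[OF p(1,2)] p(3) by simp
  obtain m where "order G = p ^ ?n * m" using multiplicity_dvd by blast
  then obtain P where P: "subgroup P G" "card P = p ^ ?n" using sylow_thm[OF p(1) is_group _ fin] by blast
  obtain e x where x: "x \<in> P" "ord x = p ^ e" "e \<le> ?n" "P \<subseteq> Fset G (p ^ e)"
    using exists_max_prime_power_ord[OF P p(1)] .
  have xc: "x \<in> carrier G" using subgroup.mem_carrier[OF P(1) x(1)] .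
  have "p ^ ?n \<le> card (Fset G (p ^ e))" using card_mono[OF finite_Fset x(4)] P by simp
  also have "\<dots> < (q + 1) * p ^ e" using small[OF p(1) xc x(2)] .
  also have "\<dots> \<le> p * p ^ e" using qp by (intro mult_right_mono) auto
  finally have "p ^ ?n < p ^ Suc e" by simp
  then have "?n < Suc e" using prime_gt_1_nat[OF p(1)] by (metis power_less_imp_less_exp)
  then have e: "e = ?n" using x by simp
  have n: "?n > 0" using p order_pos by (simp add: prime_multiplicity_gt_zero_iff)
  have gP: "generate G {x} = P" using generate_eqI[OF P(1) x(1)] x(2) P(2) e by simp
  have "generate G {x} \<lhd> G"
    using cyclic_sylow_conjugates[OF xc _ n refl p(1), of q] x(2) e qp small[OF p(1) xc x(2)] by auto
  then have "Fset G (p ^ ?n) = generate G {x}"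
    using normal_sylow_eq_Fset[OF p(1)] P(2) gP by simp
  then show thesis using that xc x(2) e by blast
qed

text \<open>Induction over the prime divisors other than q, multiplying the generator found so far
  by the generator of the next cyclic solution set. The empty product gives d = 1 and the trivial
  subgroup, as for a q-group.\<close>

lemma exists_cyclic_hall:
  obtains y d where "y \<in> carrier G" "ord y = d" "Fset G d = generate G {y}" "coprime d q"
    "order G = d * q ^ multiplicity q (order G)"
proof -
  let ?f = "\<lambda>p. p ^ multiplicity p (order G)"
  let ?S = "prime_factors (order G) - {q}"
  have "\<exists>y\<in>carrier G. ord y = prod ?f S \<and> Fset G (prod ?f S) = generate G {y}" if "S \<subseteq> ?S" for S
    using finite_subset[OF that finite_Diff[OF finite_set_mset]] that
  proof (induction S rule: finite_induct)
    case empty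
    have "Fset G 1 = {\<one>}" by (auto simp: Fset_def)
    moreover have "generate G {\<one>} = {\<one>}" using generate_eq_powers[of \<one>] by auto
    ultimately show ?case by (intro bexI[of _ \<one>]) auto
  next
    case (insert p S)
    then obtain y where y: "y \<in> carrier G" "ord y = prod ?f S" "Fset G (prod ?f S) = generate G {y}" by blast
    have p: "Factorial_Ring.prime p" "p dvd order G" "p \<noteq> q" using insert by (auto simp: in_prime_factors_iff)
    obtain x where x: "x \<in> carrier G" "ord x = ?f p" "Fset G (?f p) = generate G {x}"
      using exists_normal_cyclic_sylow[OF p] .
    have "coprime (prod ?f S) (?f p)"
    proof (rule prod_coprime_left)
      fix p' assume "p' \<in> S"
      then have "Factorial_Ring.prime p'" "p' \<noteq> p" using insert by (auto simp: in_prime_factors_iff)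
      then show "coprime (?f p') (?f p)" using p(1) by (simp add: primes_coprime)
    qed
    from cyclic_Fset_mult[OF y x this] show ?case
      using x y insert by (intro bexI[of _ "y \<otimes> x"]) (simp_all add: mult.commute)
  qed
  from this[OF subset_refl] obtain y where
    y: "y \<in> carrier G" "ord y = prod ?f ?S" "Fset G (prod ?f ?S) = generate G {y}" by blast
  have qp: "q \<in> prime_factors (order G)" using q q_dvd order_pos by (simp add: in_prime_factors_iff)
  have "order G = prod ?f (prime_factors (order G))" using order_pos by (simp add: prime_factorization_nat)
  also have "\<dots> = ?f q * prod ?f ?S" using qp by (simp add: prod.remove)
  finally have "order G = prod ?f ?S * ?f q" by (simp add: mult.commute)
  moreover have "coprime (prod ?f ?S) q"
    using q by (intro prod_coprime_left) (auto simp: in_prime_factors_iff primes_coprime)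
  ultimately show thesis using that y by blast
qed

text \<open>All elements of Q and of its conjugates solve x^(q^n) = 1, although |Q| = q^(n+1). Two
  different conjugates share at most q^n elements, so there would be at least 2 q^(n+1) - q^n
  solutions; compared with (q + 1) q^n this gives 2 q < q + 2.\<close>

lemma noncyclic_sylow_normal:
  assumes Q: "subgroup Q G" "card Q = q * q ^ n" and x: "x \<in> Q" "ord x = q ^ n" "Q \<subseteq> Fset G (q ^ n)"
  shows "Q \<lhd> G"
proof -
  have Qs: "Q \<subseteq> carrier G" using Q subgroup.subset by blast
  have q1: "q > 1" using prime_gt_1_nat[OF q] .
  have "conjugate g Q \<subseteq> Q" if g: "g \<in> carrier G" for g
  proof (rule ccontr)
    assume not: "\<not> conjugate g Q \<subseteq> Q"
    let ?B = "conjugate g Q"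
    have B: "subgroup ?B G" "card ?B = q * q ^ n"
      using conjugate_subgroup[OF Q(1) g] card_conjugate[OF g Qs] Q by auto
    have sI: "subgroup (Q \<inter> ?B) G" using subgroups_Inter_pair[OF Q(1) B(1)] .
    have "card (Q \<inter> ?B) dvd q ^ Suc n" using card_subgroup_mono_dvd[OF sI Q(1)] Q(2) by auto
    then obtain i where i: "i \<le> Suc n" "card (Q \<inter> ?B) = q ^ i" using q divides_primepow_nat by blast
    have "i \<noteq> Suc n"
    proof
      assume "i = Suc n"
      then have "Q \<inter> ?B = ?B" using i B finite_subgroup[OF B(1)] by (intro card_subset_eq) auto
      then show False using not by blast
    qed
    then have "q ^ i \<le> q ^ n" using i q1 by (intro power_increasing) auto
    moreover have "card (Q \<union> ?B) + card (Q \<inter> ?B) = card Q + card ?B"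
      using card_Un_Int[OF finite_subgroup[OF Q(1)] finite_subgroup[OF B(1)]] by simp
    moreover have "?B \<subseteq> Fset G (q ^ n)" using x(3) Fset_conj[OF g] by (auto simp: conjugate_def)
    then have "card (Q \<union> ?B) \<le> card (Fset G (q ^ n))" using x(3) by (intro card_mono) auto
    moreover have "card (Fset G (q ^ n)) < (q + 1) * q ^ n" using small[OF q _ x(2)] x(1) Qs by blast
    ultimately have "2 * (q * q ^ n) < (q + 1) * q ^ n + q ^ n" using i B(2) Q(2) by linarith
    then have "(2 * q) * q ^ n < (q + 2) * q ^ n" by (simp add: algebra_simps)
    then have "2 * q < q + 2" by (metis mult_less_cancel2)
    then show False using q1 by simp
  qed
  then show ?thesis using Q normal_iff_conjugate_subset by blast
qed

lemma noncyclic_sylow_classification: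
  assumes Q: "subgroup Q G" "card Q = q * q ^ n" and x: "x \<in> Q" "ord x = q ^ n" "Q \<subseteq> Fset G (q ^ n)"
  shows "n > 0 \<and> (G\<lparr>carrier := Q\<rparr> \<cong> integer_mod_group (q ^ n) \<times>\<times> integer_mod_group q \<or>
    G\<lparr>carrier := Q\<rparr> \<cong> quaternion8 \<or>
    (n \<ge> 2 \<and> (odd q \<or> n \<ge> 3) \<and> G\<lparr>carrier := Q\<rparr> \<cong> metacyc q (q ^ n) (1 + q ^ (n - 1))))"
proof -
  have Qs: "Q \<subseteq> carrier G" using Q subgroup.subset by blast
  have q1: "q > 1" using prime_gt_1_nat[OF q] .
  let ?K = "G\<lparr>carrier := Q\<rparr>"
  interpret K: finite_group ?K using finite_group_subgroup[OF finite_group_axioms Q(1)] .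
  interpret C: cyclic_maximal_subgroup ?K q n x
    by unfold_locales (use q Q x ord_subgroup[OF Q(1)] in \<open>auto simp: order_def\<close>)
  have "n > 0"
  proof (rule ccontr)
    assume "\<not> n > 0"
    then have "Q \<subseteq> {\<one>}" using x(3) by (auto simp: Fset_def)
    then have "card Q \<le> 1" by (metis card_mono finite.emptyI finite_insert is_singletonI is_singleton_altdef)
    then show False using Q(2) \<open>\<not> n > 0\<close> q1 by simp
  qed
  \<comment> \<open>Suitable powers of x have order q^k for every k up to n, so the bound is
    available for all these k and passes from G to Q.\<close>
  moreover have "card (Fset ?K (q ^ k)) < (q + 1) * q ^ k" if "k \<le> n" for k
  proof -
    have xc: "x \<in> carrier G" using x Qs by blast
    have "q ^ (n - k) dvd ord x" using x(2) by (simp add: le_imp_power_dvd)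
    then have "ord (x [^] (q ^ (n - k))) = q ^ n div q ^ (n - k)"
      using ord_pow[OF xc, of "q ^ (n - k)"] x(2) q1 by simp
    also have "\<dots> = q ^ k" using that q1 by (simp add: power_diff[symmetric])
    finally have "card (Fset G (q ^ k)) < (q + 1) * q ^ k" using small[OF q _, of "x [^] (q ^ (n - k))"] xc by simp
    moreover have "card (Fset ?K (q ^ k)) \<le> card (Fset G (q ^ k))"
      unfolding Fset_subgroup[OF Qs] by (intro card_mono) auto
    ultimately show ?thesis by simp
  qed
  moreover have "carrier ?K \<subseteq> Fset ?K (q ^ n)" using x(3) by (simp add: Fset_subgroup[OF Qs])
  ultimately show ?thesis using C.classification by blast
qed

end

section \<open>Three conjugate Sylow subgroups\<close>

context finite_group begin

lemma commutes_pow: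
  assumes "g \<in> carrier G" "x \<in> carrier G" "g \<otimes> x = x \<otimes> g"
  shows "g [^] (k::nat) \<otimes> x = x \<otimes> g [^] k"
  using group_commutes_pow[OF assms(3,1,2)] .

lemma commutes_mult:
  assumes "g \<in> carrier G" "h \<in> carrier G" "x \<in> carrier G" "g \<otimes> x = x \<otimes> g" "h \<otimes> x = x \<otimes> h"
  shows "(g \<otimes> h) \<otimes> x = x \<otimes> (g \<otimes> h)"
  using assms by (metis m_assoc)

text \<open>An element of R that normalises Q centralises it, because the commutator with x lies in
  Q and in R. So the three conjugates control how far the powers of y are from commuting with x.
  This leads to 3 dividing d only once, and R splits into a part of order 3, inverted by x, and a
  part generated by y^3, centralised by x.\<close>

lemma three_conjugates_iso:
  assumes x: "x \<in> carrier G" "ord x = 2 ^ n"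
    and y: "y \<in> carrier G" "ord y = d" "Fset G d = generate G {y}" "odd d"
    and o: "order G = d * 2 ^ n" and three: "card (conjugates (generate G {x})) = 3"
  obtains t where "t > 0" "coprime t 6" "G \<cong> metacyc (2 ^ n) 3 2 \<times>\<times> integer_mod_group t"
proof -
  let ?Q = "generate G {x}" let ?R = "generate G {y}"
  have sQ: "subgroup ?Q G" "card ?Q = 2 ^ n" using generate_is_subgroup generate_pow_card x by auto
  have sR: "subgroup ?R G" "card ?R = d" using generate_is_subgroup generate_pow_card y by auto
  interpret Q: subgroup ?Q G by (rule sQ)
  interpret R: subgroup ?R G by (rule sR)
  have d0: "d > 0" using ord_pos y by auto
  have nR: "?R \<lhd> G" using Fset_normal[of d] sR y by simp
  have QR: "?Q \<inter> ?R = {\<one>}"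
  proof -
    have "?Q \<subseteq> Fset G (2 ^ n)"
      using ord_dvd_card_subgroup[OF sQ(1)] sQ(2) by (auto simp: Fset_iff_ord)
    moreover have "coprime (2 ^ n) d" using y(4) by simp
    ultimately show ?thesis using Fset_Int_coprime[of "2 ^ n" d] y(3) by auto
  qed
  have conjR: "g \<otimes> h \<otimes> inv g \<in> ?R" if "g \<in> carrier G" "h \<in> ?R" for g h
    using nR that unfolding normal_inv_iff by blast
  have Rpow: "\<exists>k::nat. h = y [^] k" if "h \<in> ?R" for h using that generate_eq_powers[OF y(1)] by auto
  have xQ: "x \<in> ?Q" by (simp add: generate.incl)
  have yR: "y [^] (k::nat) \<in> ?R" for k using pow_in_generate y by blast
  have car: "\<exists>j i. g = x [^] (j::nat) \<otimes> y [^] (i::nat)" if gc: "g \<in> carrier G" for g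
  proof -
    have "?Q <#> ?R = carrier G" using set_mult_eq_carrier[OF sQ(1) sR(1) QR] o sQ sR by simp
    then obtain u v where "u \<in> ?Q" "v \<in> ?R" "g = u \<otimes> v" using gc unfolding set_mult_def by blast
    then show ?thesis using Rpow generate_eq_powers[OF x(1)] by auto
  qed
  have comm_if: "g \<otimes> x = x \<otimes> g" if g: "g \<in> ?R" "conjugate g ?Q = ?Q" for g
  proof -
    have gc: "g \<in> carrier G" using g by simp
    have "g \<otimes> x \<otimes> inv g \<in> ?Q" using g(2) xQ unfolding conjugate_def by blast
    then have "g \<otimes> x \<otimes> inv g \<otimes> inv x \<in> ?Q" using xQ by simp
    moreover have "x \<otimes> inv g \<otimes> inv x \<in> ?R" using conjR[OF x(1)] g by simp
    then have "g \<otimes> (x \<otimes> inv g \<otimes> inv x) \<in> ?R" using g by simp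
    then have "g \<otimes> x \<otimes> inv g \<otimes> inv x \<in> ?R" using gc x by (simp add: m_assoc)
    ultimately have "g \<otimes> x \<otimes> inv g \<otimes> inv x = \<one>" using QR by blast
    then have "g \<otimes> x \<otimes> inv g = x" using gc x by (metis inv_closed inv_solve_right l_one m_closed one_closed)
    then show ?thesis using gc x by (metis inv_closed inv_solve_right m_closed)
  qed
  \<comment> \<open>Otherwise x would commute with all products x^j y^i, so Q would be central and
    have only one conjugate.\<close>
  have not_comm: "y \<otimes> x \<noteq> x \<otimes> y"
  proof
    assume c: "y \<otimes> x = x \<otimes> y"
    have "conjugate g ?Q \<subseteq> ?Q" if gc: "g \<in> carrier G" for g
    proof -
      obtain j i where g: "g = x [^] (j::nat) \<otimes> y [^] (i::nat)" using car[OF gc] by blast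
      have "g \<otimes> x = x \<otimes> g" unfolding g
        using commutes_mult[of "x [^] j" "y [^] i" x] commutes_pow[OF x(1) x(1) refl] commutes_pow[OF y(1) x(1) c] x y by simp
      then have "g \<otimes> x [^] (k::nat) = x [^] k \<otimes> g" for k
        using commutes_pow[OF x(1) gc, of k] by simp
      then have "g \<otimes> x [^] (k::nat) \<otimes> inv g = x [^] k" for k using gc x by (simp add: m_assoc)
      then show ?thesis using generate_eq_powers[OF x(1)] by (auto simp: conjugate_def)
    qed
    then have "conjugate g ?Q = ?Q" if "g \<in> carrier G" for g
      using card_conjugate[OF that Q.subset] finite_subgroup[OF sQ(1)] that by (metis card_subset_eq)
    then have "conjugates ?Q \<subseteq> {?Q}" unfolding conjugates_def by blast
    then have "card (conjugates ?Q) \<le> card {?Q}" by (intro card_mono) auto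
    then show False using three by simp
  qed
  have gen_comm: False if kx: "y [^] (k::nat) \<otimes> x = x \<otimes> y [^] k" and kd: "coprime k d" for k
  proof -
    obtain u where "[k * u = 1] (mod d)" using cong_solve_coprime_nat[of k d] kd by auto
    then have "y [^] (k * u) = y [^] (1::nat)"
      unfolding pow_eq_iff_mod[OF y(1)] y(2) cong_def .
    then have "(y [^] k) [^] u = y" using y by (simp add: nat_pow_pow)
    then show False using commutes_pow[OF _ x(1) kx, of u] y not_comm by simp
  qed
  \<comment> \<open>Conjugation of Q by 1, y, y^2, y^3 gives at most three subgroups, so some y^k
    with 1 \<le> k \<le> 3 normalises Q and commutes with x. Since d is odd, y and y^2 both generate
    R, and only k = 3 remains.\<close>
  have c3: "y [^] (3::nat) \<otimes> x = x \<otimes> y [^] (3::nat)"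
  proof -
    let ?f = "\<lambda>i::nat. conjugate (y [^] i) ?Q"
    have "\<not> inj_on ?f {..3}"
    proof
      assume "inj_on ?f {..3}"
      moreover have "?f ` {..3} \<subseteq> conjugates ?Q" using y unfolding conjugates_def by auto
      ultimately have "card {..3::nat} \<le> card (conjugates ?Q)" by (intro card_inj_on_le) auto
      then show False using three by simp
    qed
    then obtain i j where ij: "i < j" "j \<le> 3" "?f i = ?f j"
      unfolding inj_on_def by (metis atMost_iff linorder_neqE_nat)
    have "conjugate (inv (y [^] i)) (?f i) = ?Q"
      using y Q.subset by (simp add: conjugate_conjugate conjugate_one)
    moreover have "conjugate (inv (y [^] i)) (?f j) = conjugate (inv (y [^] i) \<otimes> y [^] j) ?Q"
      using y Q.subset by (simp add: conjugate_conjugate)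
    moreover have "inv (y [^] i) \<otimes> y [^] j = y [^] (j - i)"
    proof -
      have "y [^] j = y [^] i \<otimes> y [^] (j - i)" using ij y by (simp add: nat_pow_mult)
      then show ?thesis using y by (simp add: m_assoc[symmetric])
    qed
    ultimately have "conjugate (y [^] (j - i)) ?Q = ?Q" using ij(3) by simp
    then have *: "y [^] (j - i) \<otimes> x = x \<otimes> y [^] (j - i)" using comm_if[OF yR] by blast
    have "j - i \<in> {1, 2, 3}" using ij by auto
    moreover have "j - i \<noteq> 1" using * gen_comm[of 1] by auto
    moreover have "j - i \<noteq> 2" using * gen_comm[of 2] y(4) by auto
    ultimately show ?thesis using * by auto
  qed
  have "\<not> coprime 3 d" using gen_comm[OF c3] by blast
  moreover have p3: "Factorial_Ring.prime (3::nat)" by simp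
  ultimately have "3 dvd d" using prime_imp_coprime by blast
  then obtain t where t: "d = 3 * t" by blast
  have t0: "t > 0" using t d0 by simp
  have cube: "\<exists>k. h = y [^] (t * k)" if hR: "h \<in> ?R" and h3: "h [^] (3::nat) = \<one>" for h
  proof -
    obtain k where k: "h = y [^] (k::nat)" using Rpow[OF hR] by blast
    then have "y [^] (k * 3) = \<one>" using h3 y by (simp add: nat_pow_pow)
    then have "3 * t dvd k * 3" using pow_eq_id[OF y(1)] y(2) t by simp
    then have "t dvd k" by simp
    then show ?thesis using k by blast
  qed
  \<comment> \<open>If 9 divided d, the commutator w of x and y would be a cube in R: w^3 = 1
    because x centralises y^3, so w is a power of y^t, hence of y^3. Thus w commutes with x, and
    moving y past x^(2^n) = 1 yields w^(2^n) = 1. Together with w^3 = 1 this gives w = 1.\<close>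
  have nt: "\<not> 3 dvd t"
  proof
    assume "3 dvd t"
    then obtain t' where t': "t = 3 * t'" by blast
    define w where "w = (x \<otimes> y \<otimes> inv x) \<otimes> inv y"
    have cR: "x \<otimes> y \<otimes> inv x \<in> ?R" using conjR[OF x(1)] yR[of 1] y by simp
    have invy: "inv y \<in> ?R" using yR[of 1] y by simp
    have wR: "w \<in> ?R" unfolding w_def using cR invy by simp
    then have wc: "w \<in> carrier G" by simp
    obtain l where l: "x \<otimes> y \<otimes> inv x = y [^] (l::nat)" using Rpow[OF cR] by blast
    have cm: "(x \<otimes> y \<otimes> inv x) \<otimes> inv y = inv y \<otimes> (x \<otimes> y \<otimes> inv x)"
      unfolding l using commutes_pow[OF y(1) inv_closed[OF y(1)], of l] y by simp
    have "w [^] (3::nat) = (x \<otimes> y \<otimes> inv x) [^] (3::nat) \<otimes> inv y [^] (3::nat)"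
      unfolding w_def using pow_mult_distrib[OF cm] x y by simp
    also have "(x \<otimes> y \<otimes> inv x) [^] (3::nat) = y [^] (3::nat)"
      unfolding conj_pow[OF x(1) y(1)] c3[symmetric] using x y by (simp add: m_assoc)
    also have "y [^] (3::nat) \<otimes> inv y [^] (3::nat) = \<one>" using y by (simp add: nat_pow_inv)
    finally have w3: "w [^] (3::nat) = \<one>" .
    then obtain k where "w = y [^] (t * k)" using cube[OF wR] by blast
    then have "w = (y [^] (3::nat)) [^] (t' * k)" using t' y by (simp add: nat_pow_pow ac_simps)
    then have wx: "w \<otimes> x = x \<otimes> w" using commutes_pow[OF _ x(1) c3] y by simp
    have base: "x \<otimes> y = w \<otimes> y \<otimes> x" unfolding w_def using x y by (simp add: m_assoc)
    have "x [^] (j::nat) \<otimes> y = w [^] j \<otimes> y \<otimes> x [^] j" for j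
    proof (induction j)
      case (Suc j)
      have "x [^] Suc j \<otimes> y = x \<otimes> (x [^] j \<otimes> y)" using x y by (simp only: nat_pow_Suc2 m_assoc nat_pow_closed)
      also have "\<dots> = (x \<otimes> w [^] j) \<otimes> y \<otimes> x [^] j" unfolding Suc using x y wc by (simp add: m_assoc)
      also have "\<dots> = w [^] j \<otimes> (x \<otimes> y) \<otimes> x [^] j"
        using commutes_pow[OF wc x(1) wx, of j, symmetric] x y wc by (simp add: m_assoc)
      also have "\<dots> = (w [^] j \<otimes> w) \<otimes> y \<otimes> (x \<otimes> x [^] j)" unfolding base using x y wc by (simp add: m_assoc)
      also have "x \<otimes> x [^] j = x [^] Suc j" using x by (simp only: nat_pow_Suc2)
      finally show ?case by simp
    qed (use y in simp)
    from this[of "2 ^ n"] have "y = w [^] ((2::nat) ^ n) \<otimes> y" using x y wc pow_ord_eq_1[OF x(1)] by simp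
    then have "w [^] ((2::nat) ^ n) = \<one>" using y wc by (metis nat_pow_closed r_cancel_one')
    then have "w \<in> Fset G (2 ^ n) \<inter> Fset G 3" using w3 wc by (simp add: Fset_def)
    moreover have "coprime (2 ^ n) (3::nat)" by simp
    ultimately have "w = \<one>" using Fset_Int_coprime by blast
    then show False using base not_comm x y by simp
  qed
  define u where "u = y [^] t"
  have uc: "u \<in> carrier G" using y by (simp add: u_def)
  have u3: "u [^] (3::nat) = \<one>" unfolding u_def using y t pow_ord_eq_1[OF y(1)] by (simp add: nat_pow_pow mult.commute)
  have cop: "coprime t 3" using nt prime_imp_coprime[OF p3, of t] by (simp add: coprime_commute)
  obtain \<alpha> where \<alpha>: "[t * \<alpha> = 1] (mod 3)" using cong_solve_coprime_nat[OF cop] by auto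
  obtain \<beta> where \<beta>: "[3 * \<beta> = 1] (mod t)" using cong_solve_coprime_nat[of 3 t] cop by (auto simp: coprime_commute)
  \<comment> \<open>As t is coprime to 3, a combination t \<alpha> + 3 \<beta> equal to 1 modulo d =
    3 t writes y through the two factors u = y^t and y^3.\<close>
  have y_eq: "y = u [^] \<alpha> \<otimes> (y [^] (3::nat)) [^] \<beta>"
  proof -
    have "[t * \<alpha> + 3 * \<beta> = 1 + 0] (mod 3)" using \<alpha> by (intro cong_add) (auto simp: cong_0_iff)
    moreover have "[t * \<alpha> + 3 * \<beta> = 0 + 1] (mod t)" using \<beta> by (intro cong_add) (auto simp: cong_0_iff)
    ultimately have "[t * \<alpha> + 3 * \<beta> = 1] (mod 3 * t)" using cop by (intro coprime_cong_mult_nat) (auto simp: coprime_commute)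
    then have "y [^] (t * \<alpha> + 3 * \<beta>) = y [^] (1::nat)" unfolding pow_eq_iff_mod[OF y(1)] y(2) t cong_def .
    then show ?thesis unfolding u_def using y by (simp add: nat_pow_pow nat_pow_mult)
  qed
  have y3c: "y [^] (3::nat) \<in> carrier G" using y by simp
  \<comment> \<open>The conjugate v of u is again a cube root of 1 in R, so it is 1, u or u^2. The
    value 1 would give u = 1. The value u would make x commute with u and y^3, hence with y.\<close>
  have ux: "u \<otimes> x = x \<otimes> u [^] (2::nat)"
  proof -
    define v where "v = inv x \<otimes> u \<otimes> x"
    have vR: "v \<in> ?R" unfolding v_def using conjR[of "inv x" u] yR[of t] x by (simp add: u_def)
    have v3: "v [^] (3::nat) = \<one>" unfolding v_def using conj_pow[of "inv x" u 3] x uc u3 by simp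
    obtain k where "v = y [^] (t * k)" using cube[OF vR v3] by blast
    then have "v = u [^] k" unfolding u_def using y by (simp add: nat_pow_pow)
    then have vk: "v = u [^] (k mod 3)" using pow_mod_eq[OF uc u3] by simp
    have uv: "u \<otimes> x = x \<otimes> v" unfolding v_def using uc x by (simp add: m_assoc[symmetric])
    have "k mod 3 \<noteq> 1"
    proof
      assume "k mod 3 = 1"
      then have "u \<otimes> x = x \<otimes> u" using uv vk uc by simp
      then have "y \<otimes> x = x \<otimes> y"
        using commutes_mult[of "u [^] \<alpha>" "(y [^] (3::nat)) [^] \<beta>" x] commutes_pow[OF uc x(1)]
          commutes_pow[OF y3c x(1) c3] uc y3c x y_eq by simp
      then show False using not_comm by simp
    qed
    moreover have "k mod 3 \<noteq> 0"
    proof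
      assume "k mod 3 = 0"
      then have "u \<otimes> x = x" using uv vk x by simp
      then have "u = \<one>" using uc x by simp
      then have "d dvd t" unfolding u_def using pow_eq_id[OF y(1)] y(2) by simp
      then show False using t t0 by (simp add: nat_dvd_not_less)
    qed
    moreover have "k mod 3 < 3" by simp
    ultimately have "k mod 3 = 2" by linarith
    then show ?thesis using uv vk by simp
  qed
  have "G \<cong> metacyc (2 ^ n) 3 2 \<times>\<times> integer_mod_group t"
  proof (rule iso_metacyc_DirProd_integer_mod_group[OF uc x(1) u3 _ ux y3c])
    have xn: "x [^] ((2::nat) ^ n) = \<one>" using pow_ord_eq_1[OF x(1)] x(2) by simp
    have ct: "(y [^] (3::nat)) [^] t = \<one>" using y t pow_ord_eq_1[OF y(1)] by (simp add: nat_pow_pow)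
    show "x [^] ((2::nat) ^ n) = \<one>" "(y [^] (3::nat)) [^] t = \<one>" by (rule xn, rule ct)
    show "u \<otimes> y [^] (3::nat) = y [^] (3::nat) \<otimes> u" unfolding u_def using y by (simp add: nat_pow_mult add.commute)
    show "x \<otimes> y [^] (3::nat) = y [^] (3::nat) \<otimes> x" using c3 by simp
    show "order G = 2 ^ n * 3 * t" using o t by simp
    show "carrier G \<subseteq> (\<lambda>((j::nat, i), k). x [^] j \<otimes> u [^] i \<otimes> (y [^] (3::nat)) [^] k) ` (({0..<2 ^ n} \<times> {0..<3::nat}) \<times> {0..<t})"
    proof
      fix g assume "g \<in> carrier G"
      then obtain j i where g: "g = x [^] (j::nat) \<otimes> y [^] (i::nat)" using car by blast
      have "y [^] i = (u [^] \<alpha> \<otimes> (y [^] (3::nat)) [^] \<beta>) [^] i" using y_eq by simp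
      also have "\<dots> = u [^] (\<alpha> * i) \<otimes> (y [^] (3::nat)) [^] (\<beta> * i)"
      proof -
        have "u [^] \<alpha> \<otimes> (y [^] (3::nat)) [^] \<beta> = (y [^] (3::nat)) [^] \<beta> \<otimes> u [^] \<alpha>"
          unfolding u_def using y by (simp add: nat_pow_pow nat_pow_mult add.commute)
        from pow_mult_distrib[OF this] show ?thesis using uc y3c by (simp add: nat_pow_pow)
      qed
      finally have "g = x [^] (j mod 2 ^ n) \<otimes> u [^] (\<alpha> * i mod 3) \<otimes> (y [^] (3::nat)) [^] (\<beta> * i mod t)"
        unfolding g pow_mod_eq[OF x(1) xn] pow_mod_eq[OF uc u3] pow_mod_eq[OF y3c ct] using x uc y3c by (simp add: m_assoc)
      then show "g \<in> (\<lambda>((j::nat, i), k). x [^] j \<otimes> u [^] i \<otimes> (y [^] (3::nat)) [^] k) ` (({0..<2 ^ n} \<times> {0..<3::nat}) \<times> {0..<t})"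
        using t0 by (intro image_eqI[of _ _ "((j mod 2 ^ n, \<alpha> * i mod 3), \<beta> * i mod t)"]) auto
    qed
  qed (use t0 in auto)
  moreover have "coprime t 6"
  proof -
    have "coprime t 2" using t y(4) by simp
    then have "coprime t (2 * 3)" using cop by (simp only: coprime_mult_right_iff)
    then show ?thesis by simp
  qed
  ultimately show thesis using that t0 by blast
qed

end

section \<open>Frobenius quotients of the model groups\<close>

context finite_group begin

lemma metacyclic_gens_inj:
  assumes g: "metacyclic_gens M N r a b"
  shows "inj_on (\<lambda>(j, i). b [^] j \<otimes> a [^] i) ({0..<M} \<times> {0..<N})"
proof -
  let ?f = "\<lambda>(j::nat, i::nat). b [^] j \<otimes> a [^] i" let ?D = "{0..<M} \<times> {0..<N}"
  have ab: "a \<in> carrier G" "b \<in> carrier G" using g by (auto simp: metacyclic_gens_def)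
  then have "?f ` ?D \<subseteq> carrier G" by auto
  then have "?f ` ?D = carrier G" using g unfolding metacyclic_gens_def by blast
  moreover have "order G = M * N" using g by (simp add: metacyclic_gens_def)
  ultimately have "card (?f ` ?D) = card ?D" by (simp add: order_def)
  then show ?thesis by (intro eq_card_imp_inj_on) auto
qed

lemma metacyclic_gens_eq_one:
  assumes g: "metacyclic_gens M N r a b" and pos: "M > 0" "N > 0" and e: "b [^] (j::nat) \<otimes> a [^] (i::nat) = \<one>"
  shows "M dvd j \<and> N dvd i"
proof -
  have ab: "a \<in> carrier G" "b \<in> carrier G" "a [^] N = \<one>" "b [^] M = \<one>" using g by (auto simp: metacyclic_gens_def)
  have "(\<lambda>(j, i). b [^] j \<otimes> a [^] i) (j mod M, i mod N) = (\<lambda>(j, i). b [^] j \<otimes> a [^] i) (0::nat, 0::nat)"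
    using e ab by (simp add: pow_mod_eq)
  then have "(j mod M, i mod N) = (0, 0)"
    by (rule inj_onD[OF metacyclic_gens_inj[OF g]]) (use pos in auto)
  then show ?thesis by auto
qed

lemma metacyclic_gensE:
  assumes "metacyclic_gens M N r a b" "x \<in> carrier G"
  obtains j i where "j < M" "i < N" "x = b [^] j \<otimes> a [^] i"
proof -
  have "x \<in> (\<lambda>(j, i). b [^] j \<otimes> a [^] i) ` ({0..<M} \<times> {0..<N})"
    using assms unfolding metacyclic_gens_def by blast
  then show thesis using that by auto
qed

lemma Fset_one: "Fset G 1 = {\<one>}" by (auto simp: Fset_def)

text \<open>For k > 0 the q-th power of b^j a^i is a^(i q u) with a unit u, so the condition on i is
  q^n | i q^k whatever j is. That leaves q choices for j and at most q^k for i.\<close>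

lemma card_Fset_modular_le:
  assumes q: "Factorial_Ring.prime (q::nat)" and n: "n \<ge> 2" "odd q \<or> n \<ge> 3"
    and g: "metacyclic_gens q (q ^ n) (1 + q ^ (n - 1)) a b"
  shows "card (Fset G (q ^ k)) \<le> q * q ^ k"
proof (cases k)
  case 0
  then show ?thesis using Fset_one prime_gt_0_nat[OF q] by simp
next
  case (Suc k')
  let ?N = "q ^ n"
  have pos: "q > 0" "?N > 0" using prime_gt_0_nat[OF q] by auto
  have ab: "a \<in> carrier G" "b \<in> carrier G" "b [^] q = \<one>" "a [^] ?N = \<one>"
    "a \<otimes> b = b \<otimes> a [^] (1 + q ^ (n - 1))" using g by (auto simp: metacyclic_gens_def)
  have "Fset G (q ^ k) \<subseteq> (\<lambda>(j, i). b [^] j \<otimes> a [^] i) ` ({0..<q} \<times> {i \<in> {..<?N}. ?N dvd i * q ^ k})"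
  proof
    fix x assume "x \<in> Fset G (q ^ k)"
    then have x: "x \<in> carrier G" "x [^] (q ^ k) = \<one>" by (auto simp: Fset_def)
    obtain j i where ji: "j < q" "i < ?N" "x = b [^] j \<otimes> a [^] i" using metacyclic_gensE[OF g x(1)] .
    obtain u where u: "coprime u q" "[(\<Sum>l<q. ((1 + q ^ (n - 1)) ^ j) ^ l) = q * u] (mod ?N)"
      using modular_sum_cong[OF q n] .
    have "x [^] q = b [^] (j * q) \<otimes> a [^] (i * (\<Sum>l<q. ((1 + q ^ (n - 1)) ^ j) ^ l))"
      unfolding ji(3) by (rule normal_form_pow[OF ab(1,2,5)])
    also have "b [^] (j * q) = \<one>" using ab by (metis mult.commute nat_pow_one nat_pow_pow)
    also have "a [^] (i * (\<Sum>l<q. ((1 + q ^ (n - 1)) ^ j) ^ l)) = a [^] (i * (q * u))"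
      using cong_scalar_left[OF u(2), of i] unfolding cong_def by (rule pow_cong[OF ab(1,4)])
    finally have xq: "x [^] q = a [^] (i * (q * u))" using ab by simp
    have "x [^] (q ^ k) = (x [^] q) [^] (q ^ k')" using x Suc by (simp add: nat_pow_pow)
    also have "\<dots> = b [^] (0::nat) \<otimes> a [^] (i * q ^ k * u)"
      unfolding xq using ab Suc by (simp add: nat_pow_pow ac_simps)
    finally have "?N dvd i * q ^ k * u" using metacyclic_gens_eq_one[OF g pos] x(2) by metis
    moreover have "coprime ?N u" using u(1) by (simp add: coprime_commute)
    ultimately have "?N dvd i * q ^ k" by (simp only: coprime_dvd_mult_left_iff)
    then show "x \<in> (\<lambda>(j, i). b [^] j \<otimes> a [^] i) ` ({0..<q} \<times> {i \<in> {..<?N}. ?N dvd i * q ^ k})"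
      using ji by (intro image_eqI[of _ _ "(j, i)"]) auto
  qed
  then have "card (Fset G (q ^ k)) \<le> card ({0..<q} \<times> {i \<in> {..<?N}. ?N dvd i * q ^ k})"
    by (rule surj_card_le[rotated]) simp
  also have "\<dots> = q * card {i \<in> {..<?N}. ?N dvd i * q ^ k}" by (simp add: card_cartesian_product)
  also have "\<dots> \<le> q * q ^ k" using card_roots_mod_le[of "q ^ k" ?N] pos by simp
  finally show ?thesis .
qed

lemma card_Fset_sylow_types_le:
  assumes q: "Factorial_Ring.prime (q::nat)" and o: "order G = q ^ N"
    and ty: "(\<exists>m\<ge>1. G \<cong> integer_mod_group (q ^ m))
         \<or> (\<exists>m\<ge>2. G \<cong> DirProd (integer_mod_group (q ^ (m - 1))) (integer_mod_group q))
         \<or> G \<cong> quaternion8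
         \<or> (q = 2 \<and> (\<exists>m\<ge>4. G \<cong> metacyc 2 (2 ^ (m - 1)) (1 + 2 ^ (m - 2))))
         \<or> (q > 2 \<and> (\<exists>m\<ge>3. G \<cong> metacyc q (q ^ (m - 1)) (1 + q ^ (m - 2))))"
  shows "card (Fset G (q ^ k)) \<le> q * q ^ k"
proof -
  have q1: "q > 1" using prime_gt_1_nat[OF q] .
  have modular: ?thesis if iso: "G \<cong> metacyc q (q ^ (m - 1)) (1 + q ^ (m - 2))" and m: "m \<ge> 3" "odd q \<or> m \<ge> 4" for m
  proof -
    have "q ^ (m - 1) > 1" using q1 m by (intro one_less_power) auto
    then obtain a b where "metacyclic_gens q (q ^ (m - 1)) (1 + q ^ (m - 2)) a b"
      using iso_metacyc_imp_gens[OF iso q1] by blast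
    \<comment> \<open>In the statement the group has order q^m and a has order q^(m-1), so the
      parameter n of the counting lemma is m - 1.\<close>
    moreover have "m - 2 = (m - 1) - 1" by simp
    ultimately have "metacyclic_gens q (q ^ (m - 1)) (1 + q ^ ((m - 1) - 1)) a b" by metis
    then show ?thesis by (rule card_Fset_modular_le[OF q, rotated 2]) (use m in auto)
  qed
  from ty consider m where "G \<cong> integer_mod_group (q ^ m)"
    | m where "G \<cong> DirProd (integer_mod_group (q ^ (m - 1))) (integer_mod_group q)"
    | "G \<cong> quaternion8"
    | m where "q = 2" "m \<ge> 4" "G \<cong> metacyc q (q ^ (m - 1)) (1 + q ^ (m - 2))"
    | m where "q > 2" "m \<ge> 3" "G \<cong> metacyc q (q ^ (m - 1)) (1 + q ^ (m - 2))"
    by blast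
  then show ?thesis
  proof cases
    case 1
    have "card (Fset G (q ^ k)) = card (Fset (integer_mod_group (q ^ m)) (q ^ k))"
      by (rule card_Fset_iso[OF is_group _ 1]) simp
    also have "\<dots> \<le> q ^ k" using q1 by (intro card_Fset_integer_mod_group_le) auto
    also have "\<dots> \<le> q * q ^ k" using q1 by simp
    finally show ?thesis .
  next
    case 2
    let ?A = "integer_mod_group (q ^ (m - 1))" let ?B = "integer_mod_group q"
    have "card (Fset G (q ^ k)) = card (Fset (?A \<times>\<times> ?B) (q ^ k))"
      by (rule card_Fset_iso[OF is_group _ 2]) (simp add: DirProd_group)
    also have "\<dots> = card (Fset ?A (q ^ k)) * card (Fset ?B (q ^ k))"
      by (simp add: Fset_DirProd card_cartesian_product)
    also have "\<dots> \<le> q ^ k * q"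
    proof (rule mult_mono)
      show "card (Fset ?A (q ^ k)) \<le> q ^ k" using q1 by (intro card_Fset_integer_mod_group_le) auto
      have "card (Fset ?B (q ^ k)) \<le> card (carrier ?B)"
        using q1 by (intro card_mono) (auto simp: Fset_def carrier_integer_mod_group)
      then show "card (Fset ?B (q ^ k)) \<le> q" using q1 by (simp add: carrier_integer_mod_group)
    qed auto
    finally show ?thesis by (simp add: mult.commute)
  next
    case 3
    \<comment> \<open>The quaternion alternative does not mention q, so q = 2 is recovered from the
      order. From k = 2 on, the bound 2 * 2^k covers the whole group.\<close>
    have "order G = 8" using iso_same_card[OF 3] by (simp add: order_def quaternion8_def)
    then have "2 dvd q ^ N" using o by (metis even_numeral)
    then have q2: "q = 2" using q by (metis prime_dvd_power primes_dvd_imp_eq two_is_prime_nat)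
    have c8: "card (Fset G (q ^ k)) \<le> 8"
      using \<open>order G = 8\<close> card_mono[OF fin, of "Fset G (q ^ k)"] by (auto simp: Fset_def order_def)
    consider "k = 0" | "k = 1" | "k \<ge> 2" by linarith
    then show ?thesis
    proof cases
      case 1 then show ?thesis using Fset_one q2 by simp
    next
      case 2 then show ?thesis using card_Fset_2_quaternion8[OF 3] q2 by simp
    next
      case 3
      then have "(2::nat) ^ 2 \<le> 2 ^ k" by (intro power_increasing) auto
      then show ?thesis using c8 q2 by simp
    qed
  next
    case 4 then show ?thesis using modular[of m] by simp
  next
    case 5
    then have "odd q" using q by (metis primes_dvd_imp_eq two_is_prime_nat less_irrefl)
    then show ?thesis using modular[of m] 5 by simp
  qed
qed

text \<open>The factors commute elementwise, so u^n is the inverse of v^n and lies in both of them;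
  hence both parts of a solution are solutions.\<close>

lemma card_Fset_direct_product_le:
  assumes Q: "Q \<lhd> G" and R: "R \<lhd> G" and QR: "Q \<inter> R = {\<one>}" "Q <#> R = carrier G"
  shows "card (Fset G n) \<le> card (Fset (G\<lparr>carrier := Q\<rparr>) n) * card (Fset (G\<lparr>carrier := R\<rparr>) n)"
proof -
  interpret Q: subgroup Q G using Q normal_inv_iff by blast
  interpret R: subgroup R G using R normal_inv_iff by blast
  have "Fset G n \<subseteq> (\<lambda>(u, v). u \<otimes> v) ` ((Fset G n \<inter> Q) \<times> (Fset G n \<inter> R))"
  proof
    fix x assume x: "x \<in> Fset G n"
    then have "x \<in> Q <#> R" using QR by (simp add: Fset_def)
    then obtain u v where uv: "u \<in> Q" "v \<in> R" "x = u \<otimes> v" unfolding set_mult_def by blast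
    have c: "u \<in> carrier G" "v \<in> carrier G" using uv by auto
    have "u \<otimes> v = v \<otimes> u" using commute_normal_disjoint[OF Q R QR(1) uv(1,2)] .
    then have e: "u [^] n \<otimes> v [^] n = \<one>" using pow_mult_distrib[of u v n] x uv c by (simp add: Fset_def)
    then have "u [^] n = inv (v [^] n)" using c by (metis inv_equality nat_pow_closed)
    moreover have "u [^] n \<in> Q" "v [^] n \<in> R"
      using uv by (induction n) auto
    ultimately have "u [^] n \<in> Q \<inter> R" using R.m_inv_closed[of "v [^] n"] by simp
    then have "u [^] n = \<one>" unfolding QR(1) by simp
    moreover from this have "v [^] n = \<one>" using e c by simp
    ultimately show "x \<in> (\<lambda>(u, v). u \<otimes> v) ` ((Fset G n \<inter> Q) \<times> (Fset G n \<inter> R))"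
      using uv c by (intro image_eqI[of _ _ "(u, v)"]) (auto simp: Fset_def)
  qed
  then have "card (Fset G n) \<le> card ((Fset G n \<inter> Q) \<times> (Fset G n \<inter> R))"
    by (rule surj_card_le[rotated]) simp
  then show ?thesis by (simp add: card_cartesian_product Fset_subgroup[OF Q.subset] Fset_subgroup[OF R.subset])
qed

end

section \<open>Solution counts in the group \<open>metacyc (2 ^ m) 3 2\<close>\<close>

lemma group_metacyc:
  assumes M: "M > 0" "N > 0" and r: "[r ^ M = 1] (mod N)" shows "group (metacyc M N r)"
proof -
  let ?H = "metacyc M N r"
  have mul: "(j, i) \<otimes>\<^bsub>?H\<^esub> (l, k) = ((j + l) mod M, (i * r ^ l + k) mod N)" for j i l k by (simp add: metacyc_def)
  have car: "carrier ?H = {0..<M} \<times> {0..<N}" and one: "\<one>\<^bsub>?H\<^esub> = (0, 0)" by (auto simp: metacyc_def)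
  have rmod: "[r ^ (l mod M) = r ^ l] (mod N)" for l
  proof -
    have "[(r ^ M) ^ (l div M) * r ^ (l mod M) = 1 ^ (l div M) * r ^ (l mod M)] (mod N)"
      using r by (intro cong_mult cong_pow cong_refl)
    moreover have "(r ^ M) ^ (l div M) * r ^ (l mod M) = r ^ l"
      by (simp flip: power_mult power_add)
    ultimately show ?thesis by (simp add: cong_sym)
  qed
  show ?thesis
  proof (rule groupI)
    fix x y z assume "x \<in> carrier ?H" "y \<in> carrier ?H" "z \<in> carrier ?H"
    obtain j i l k s t where e: "x = (j, i)" "y = (l, k)" "z = (s, t)" by (metis surj_pair)
    have "[(i * r ^ l + k) mod N * r ^ s + t = (i * r ^ l + k) * r ^ s + t] (mod N)"
      by (intro cong_add cong_mult cong_refl) (simp add: cong_def)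
    also have "(i * r ^ l + k) * r ^ s + t = i * r ^ (l + s) + (k * r ^ s + t)"
      by (simp add: algebra_simps power_add)
    also have "[i * r ^ (l + s) + (k * r ^ s + t) = i * r ^ ((l + s) mod M) + (k * r ^ s + t) mod N] (mod N)"
      using rmod[of "l + s"] by (intro cong_add cong_mult cong_refl) (auto simp: cong_sym cong_def)
    finally show "x \<otimes>\<^bsub>?H\<^esub> y \<otimes>\<^bsub>?H\<^esub> z = x \<otimes>\<^bsub>?H\<^esub> (y \<otimes>\<^bsub>?H\<^esub> z)"
      unfolding e mul by (simp add: cong_def mod_add_left_eq mod_add_right_eq add.assoc)
  next
    fix x assume x: "x \<in> carrier ?H"
    obtain j i where e: "x = (j, i)" by fastforce
    have ji: "j < M" "i < N" using x by (auto simp: car e)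
    \<comment> \<open>The inverse of b^j a^i is a^(-i) b^(-j). In normal form it has the exponent -i
      r^(-j), where r^(-j) is written as r^(M-j).\<close>
    let ?y = "((M - j) mod M, ((N - i) * r ^ (M - j)) mod N)"
    have "[((N - i) * r ^ (M - j)) mod N * r ^ j + i = (N - i) * r ^ (M - j) * r ^ j + i] (mod N)"
      by (intro cong_add cong_mult cong_refl) (simp add: cong_def)
    also have "(N - i) * r ^ (M - j) * r ^ j + i = (N - i) * r ^ M + i"
      using ji by (simp add: mult.assoc flip: power_add)
    also have "[(N - i) * r ^ M + i = (N - i) * 1 + i] (mod N)"
      using r by (intro cong_add cong_mult cong_refl)
    finally have "(((N - i) * r ^ (M - j)) mod N * r ^ j + i) mod N = 0" using ji by (simp add: cong_def)
    moreover have "((M - j) mod M + j) mod M = 0" using ji by (simp add: mod_add_left_eq)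
    ultimately have "?y \<otimes>\<^bsub>?H\<^esub> x = \<one>\<^bsub>?H\<^esub>" unfolding e mul one by simp
    moreover have "?y \<in> carrier ?H" using M by (simp add: car)
    ultimately show "\<exists>y\<in>carrier ?H. y \<otimes>\<^bsub>?H\<^esub> x = \<one>\<^bsub>?H\<^esub>" by blast
  qed (use M in \<open>auto simp: mul car one\<close>)
qed

lemma two_power_even_cong_3: "even j \<Longrightarrow> [2 ^ j = 1] (mod (3::nat))"
proof -
  assume "even j"
  then obtain i where "j = 2 * i" by blast
  moreover have "[(4::nat) ^ i = 1 ^ i] (mod 3)" by (intro cong_pow) (simp add: cong_def)
  ultimately show ?thesis by (simp add: power_mult)
qed

text \<open>Even powers of b centralise a and odd ones invert it, as 2^j is 1 modulo 3 exactly for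
  even j. For k < m a solution of x^(2^k) = 1 has even j and then i = 0, so it is a power of b. For
  k \<ge> m the even j give one solution each and the odd j at most three, together at most 2^(m-1)
  + 3 * 2^(m-1) = 2 * 2^m.\<close>

lemma card_Fset_metacyc_3_le:
  fixes m :: nat defines "H \<equiv> metacyc (2 ^ m) 3 2" assumes m: "m \<ge> 1"
  shows "card (Fset H (2 ^ k)) \<le> 2 * 2 ^ k" "card (Fset H (3 ^ k)) \<le> 3 ^ k"
    "\<lbrakk>Factorial_Ring.prime p; p > 3\<rbrakk> \<Longrightarrow> card (Fset H (p ^ k)) = 1" and "group H"
proof -
  have "[2 ^ (2 ^ m) = 1] (mod (3::nat))" using m by (intro two_power_even_cong_3) simp
  then show gH: "group H" unfolding H_def by (intro group_metacyc) auto
  have "finite (carrier H)" by (simp add: H_def metacyc_def)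
  then interpret finite_group H using gH by (simp add: finite_group_def finite_group_axioms_def)
  have M1: "(2::nat) ^ m > 1" using m by (intro one_less_power) auto
  obtain a b where g: "metacyclic_gens (2 ^ m) 3 2 a b"
    using iso_metacyc_imp_gens[OF _ M1, of 3 2] iso_refl[of H] unfolding H_def by (metis less_add_one numeral_eq_Suc one_less_numeral_iff semiring_norm(77))
  have ab: "a \<in> carrier H" "b \<in> carrier H" "a \<otimes>\<^bsub>H\<^esub> b = b \<otimes>\<^bsub>H\<^esub> a [^]\<^bsub>H\<^esub> (2::nat)" and o: "order H = 2 ^ m * 3"
    using g by (auto simp: metacyclic_gens_def)
  have elt: "\<exists>j i :: nat. j < 2 ^ m \<and> i < 3 \<and> x = b [^]\<^bsub>H\<^esub> j \<otimes>\<^bsub>H\<^esub> a [^]\<^bsub>H\<^esub> i \<and> 2 ^ m dvd j * n \<and> 3 dvd i * (\<Sum>l<n. (2 ^ j) ^ l)"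
    if xF: "x \<in> Fset H n" for x n
  proof -
    have x: "x \<in> carrier H" "x [^]\<^bsub>H\<^esub> n = \<one>\<^bsub>H\<^esub>" using xF by (auto simp: Fset_def)
    obtain j i :: nat where ji: "j < 2 ^ m" "i < 3" "x = b [^]\<^bsub>H\<^esub> j \<otimes>\<^bsub>H\<^esub> a [^]\<^bsub>H\<^esub> i" using metacyclic_gensE[OF g x(1)] .
    have "b [^]\<^bsub>H\<^esub> (j * n) \<otimes>\<^bsub>H\<^esub> a [^]\<^bsub>H\<^esub> (i * (\<Sum>l<n. (2 ^ j) ^ l)) = \<one>\<^bsub>H\<^esub>"
      using x(2) unfolding ji(3) normal_form_pow[OF ab] .
    then show ?thesis using metacyclic_gens_eq_one[OF g] ji by auto
  qed
  show "card (Fset H (p ^ k)) = 1" if p: "Factorial_Ring.prime p" "p > 3"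
  proof -
    have "coprime p 2" "coprime p 3" using p primes_coprime[of p 2] primes_coprime[of p 3] by auto
    then have "coprime (p ^ k) (order H)" unfolding o by simp
    then show ?thesis using Fset_coprime by simp
  qed
  show "card (Fset H (3 ^ k)) \<le> 3 ^ k"
  proof (cases "k = 0")
    case True then show ?thesis using Fset_one by simp
  next
    case False
    have "Fset H (3 ^ k) \<subseteq> (\<lambda>i. a [^]\<^bsub>H\<^esub> i) ` {..<3::nat}"
    proof
      fix x assume "x \<in> Fset H (3 ^ k)"
      then obtain j i where ji: "j < 2 ^ m" "i < 3" "x = b [^]\<^bsub>H\<^esub> (j::nat) \<otimes>\<^bsub>H\<^esub> a [^]\<^bsub>H\<^esub> (i::nat)" "2 ^ m dvd j * 3 ^ k"
        using elt by blast
      have "coprime (2 ^ m) ((3::nat) ^ k)" by simp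
      then have "2 ^ m dvd j" using ji(4) by (simp only: coprime_dvd_mult_left_iff)
      then have "j = 0" using ji(1) by (meson dvd_imp_le not_le gr0I)
      then show "x \<in> (\<lambda>i. a [^]\<^bsub>H\<^esub> i) ` {..<3::nat}" using ji ab by simp
    qed
    then have "card (Fset H (3 ^ k)) \<le> card {..<3::nat}" by (rule surj_card_le[rotated]) simp
    also have "\<dots> \<le> 3 ^ k" using False self_le_power[of "3::nat" k] by simp
    finally show ?thesis .
  qed
  show "card (Fset H (2 ^ k)) \<le> 2 * 2 ^ k"
  proof -
    \<comment> \<open>For even j each term of the sum is 1 modulo 3, so the sum is 2^k modulo 3, a
      unit.\<close>
    have ev: "i = 0" if "even j" "3 dvd i * (\<Sum>l<2 ^ k. (2 ^ j) ^ l)" "i < 3" for i j :: nat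
    proof -
      have "[(\<Sum>l<2 ^ k. (2 ^ j) ^ l) = (\<Sum>l<2 ^ k. 1 ^ l)] (mod (3::nat))"
        using two_power_even_cong_3[OF that(1)] by (intro cong_sum cong_pow)
      then have "[i * (\<Sum>l<2 ^ k. (2 ^ j) ^ l) = i * 2 ^ k] (mod 3)" using cong_scalar_left[of _ _ 3 i] by simp
      then have "3 dvd i * 2 ^ k" using that(2) cong_dvd_iff by blast
      moreover have "coprime 3 ((2::nat) ^ k)" by simp
      ultimately have "3 dvd i" by (simp only: coprime_dvd_mult_left_iff)
      then show ?thesis using that(3) by (meson dvd_imp_le not_le gr0I)
    qed
    show ?thesis
    proof (cases "k < m")
      case True
      have "Fset H (2 ^ k) \<subseteq> (\<lambda>j. b [^]\<^bsub>H\<^esub> j) ` {j \<in> {..<(2::nat) ^ m}. 2 ^ m dvd j * 2 ^ k}"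
      proof
        fix x assume "x \<in> Fset H (2 ^ k)"
        then obtain j i where ji: "j < 2 ^ m" "i < 3" "x = b [^]\<^bsub>H\<^esub> (j::nat) \<otimes>\<^bsub>H\<^esub> a [^]\<^bsub>H\<^esub> (i::nat)"
          "2 ^ m dvd j * 2 ^ k" "3 dvd i * (\<Sum>l<2 ^ k. (2 ^ j) ^ l)" using elt by blast
        have "even j"
        proof (rule ccontr)
          assume "odd j"
          then have "coprime (2 ^ m) j" by simp
          moreover have "2 ^ m dvd 2 ^ k * j" using ji(4) by (simp add: mult.commute)
          ultimately have "2 ^ m dvd (2::nat) ^ k" by (simp only: coprime_dvd_mult_left_iff)
          then have "m \<le> k" using power_dvd_imp_le[of "2::nat" m k] by simp
          then show False using True by simp
        qed
        then have "i = 0" using ev ji by blast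
        then show "x \<in> (\<lambda>j. b [^]\<^bsub>H\<^esub> j) ` {j \<in> {..<(2::nat) ^ m}. 2 ^ m dvd j * 2 ^ k}" using ji ab by simp
      qed
      then have "card (Fset H (2 ^ k)) \<le> card {j \<in> {..<2 ^ m}. 2 ^ m dvd j * (2::nat) ^ k}" by (rule surj_card_le[rotated]) simp
      also have "\<dots> \<le> 2 ^ k" by (rule card_roots_mod_le) auto
      finally show ?thesis by simp
    next
      case False
      let ?E = "{..<(2::nat) ^ (m - 1)}"
      have mm: "(2::nat) ^ m = 2 * 2 ^ (m - 1)" using m by (simp add: power_eq_if)
      have "Fset H (2 ^ k) \<subseteq> (\<lambda>l. b [^]\<^bsub>H\<^esub> (2 * l)) ` ?E \<union> (\<lambda>(l, i). b [^]\<^bsub>H\<^esub> (2 * l + 1) \<otimes>\<^bsub>H\<^esub> a [^]\<^bsub>H\<^esub> i) ` (?E \<times> {..<3::nat})"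
      proof
        fix x assume "x \<in> Fset H (2 ^ k)"
        then obtain j i where ji: "j < 2 ^ m" "i < 3" "x = b [^]\<^bsub>H\<^esub> (j::nat) \<otimes>\<^bsub>H\<^esub> a [^]\<^bsub>H\<^esub> (i::nat)"
          "2 ^ m dvd j * 2 ^ k" "3 dvd i * (\<Sum>l<2 ^ k. (2 ^ j) ^ l)" using elt by blast
        show "x \<in> (\<lambda>l. b [^]\<^bsub>H\<^esub> (2 * l)) ` ?E \<union> (\<lambda>(l, i). b [^]\<^bsub>H\<^esub> (2 * l + 1) \<otimes>\<^bsub>H\<^esub> a [^]\<^bsub>H\<^esub> i) ` (?E \<times> {..<3::nat})"
        proof (cases "even j")
          case True
          then obtain l where l: "j = 2 * l" by blast
          have "i = 0" using ev ji True by blast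
          then have "x = b [^]\<^bsub>H\<^esub> (2 * l)" using ji ab l by simp
          moreover have "l \<in> ?E" using ji(1) l mm by simp
          ultimately show ?thesis by blast
        next
          case False
          then obtain l where l: "j = 2 * l + 1" by (rule oddE)
          have "(l, i) \<in> ?E \<times> {..<3}" using ji(1,2) l mm by simp
          then show ?thesis using ji(3) l by (intro UnI2 image_eqI[of _ _ "(l, i)"]) auto
        qed
      qed
      then have "card (Fset H (2 ^ k)) \<le> card ((\<lambda>l. b [^]\<^bsub>H\<^esub> (2 * l)) ` ?E \<union> (\<lambda>(l, i). b [^]\<^bsub>H\<^esub> (2 * l + 1) \<otimes>\<^bsub>H\<^esub> a [^]\<^bsub>H\<^esub> i) ` (?E \<times> {..<3::nat}))"
        by (intro card_mono) auto
      also have "\<dots> \<le> card ((\<lambda>l. b [^]\<^bsub>H\<^esub> (2 * l)) ` ?E) + card ((\<lambda>(l, i). b [^]\<^bsub>H\<^esub> (2 * l + 1) \<otimes>\<^bsub>H\<^esub> a [^]\<^bsub>H\<^esub> i) ` (?E \<times> {..<3::nat}))"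
        by (rule card_Un_le)
      also have "\<dots> \<le> card ?E + card (?E \<times> {..<3::nat})" by (intro add_mono card_image_le) auto
      also have "\<dots> = 2 * 2 ^ m" using mm by (simp add: card_cartesian_product)
      also have "\<dots> \<le> 2 * 2 ^ k" using False by simp
      finally show ?thesis .
    qed
  qed
qed

section \<open>The classification\<close>

lemma (in small_frobenius_quotients) classification:
  assumes Q: "subgroup Q G" "card Q = q ^ multiplicity q (order G)"
  shows "((\<exists>R. subgroup R G \<and> cyclic_group (G\<lparr>carrier := R\<rparr>)
          \<and> \<not> q dvd card R \<and> (\<exists>k. order G = card R * q ^ k)
          \<and> Q \<lhd> G \<and> R \<lhd> G \<and> Q \<inter> R = {\<one>} \<and> Q <#> R = carrier G)
      \<and> ((\<exists>m\<ge>1. G\<lparr>carrier := Q\<rparr> \<cong> integer_mod_group (q ^ m))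
         \<or> (\<exists>m\<ge>2. G\<lparr>carrier := Q\<rparr> \<cong> DirProd (integer_mod_group (q ^ (m - 1))) (integer_mod_group q))
         \<or> G\<lparr>carrier := Q\<rparr> \<cong> quaternion8
         \<or> (q = 2 \<and> (\<exists>m\<ge>4. G\<lparr>carrier := Q\<rparr> \<cong> metacyc 2 (2 ^ (m - 1)) (1 + 2 ^ (m - 2))))
         \<or> (q > 2 \<and> (\<exists>m\<ge>3. G\<lparr>carrier := Q\<rparr> \<cong> metacyc q (q ^ (m - 1)) (1 + q ^ (m - 2))))))
    \<or> (\<exists>m\<ge>1. \<exists>t>0. coprime t 6 \<and>
          G \<cong> DirProd (metacyc (2 ^ m) 3 2) (integer_mod_group t))"
    (is "(?hall \<and> ?types) \<or> ?three")
proof -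
  define n where "n = multiplicity q (order G)"
  have q1: "q > 1" using prime_gt_1_nat[OF q] .
  have n: "n > 0" unfolding n_def using q q_dvd order_pos by (simp add: prime_multiplicity_gt_zero_iff)
  obtain y d where y: "y \<in> carrier G" "ord y = d" "Fset G d = generate G {y}" "coprime d q"
    and o: "order G = d * q ^ n" using exists_cyclic_hall unfolding n_def .
  have cQ: "card Q = q ^ n" using Q(2) by (simp add: n_def)
  let ?R = "generate G {y}"
  have sR: "subgroup ?R G" "card ?R = d" using generate_is_subgroup generate_pow_card y by auto
  have hall: ?hall if "Q \<lhd> G"
  proof (intro exI[of _ ?R] conjI)
    show "cyclic_group (G\<lparr>carrier := ?R\<rparr>)"
      using cyclic_group_generated[of y] y(1) by (simp add: subgroup_generated_def)
    show "\<not> q dvd card ?R"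
    proof
      assume "q dvd card ?R"
      then have "q dvd gcd d q" using sR(2) by simp
      then show False using y(4) q1 by simp
    qed
    show "\<exists>k. order G = card ?R * q ^ k" using o sR(2) by auto
    show "?R \<lhd> G" using Fset_normal[of d] sR y by simp
    have "Q \<subseteq> Fset G (q ^ n)"
      using ord_dvd_card_subgroup[OF Q(1)] cQ subgroup.subset[OF Q(1)] by (auto simp: Fset_iff_ord)
    moreover have "coprime (q ^ n) d" using y(4) by (simp add: coprime_commute)
    ultimately have "Q \<inter> ?R \<subseteq> {\<one>}" using Fset_Int_coprime[of "q ^ n" d] y(3) by auto
    then show QR: "Q \<inter> ?R = {\<one>}" using subgroup.one_closed[OF Q(1)] subgroup.one_closed[OF sR(1)] by blast
    show "Q <#> ?R = carrier G" using set_mult_eq_carrier[OF Q(1) sR(1) QR] cQ sR(2) o by simp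
  qed (use sR that in auto)
  obtain e x where x: "x \<in> Q" "ord x = q ^ e" "e \<le> n" "Q \<subseteq> Fset G (q ^ e)"
    using exists_max_prime_power_ord[OF Q(1) cQ q] .
  have xc: "x \<in> carrier G" using subgroup.mem_carrier[OF Q(1) x(1)] .
  have "q ^ n \<le> card (Fset G (q ^ e))" using card_mono[OF finite_Fset x(4)] cQ by simp
  also have "\<dots> < (q + 1) * q ^ e" using small[OF q xc x(2)] .
  \<comment> \<open>The crude estimate q + 1 \<le> q^2 is valid for q = 2 as well and leaves only
    index 1 or q for the cyclic subgroup generated by x.\<close>
  also have "\<dots> \<le> (q * q) * q ^ e"
  proof (rule mult_right_mono)
    have "2 * q \<le> q * q" using q1 by (intro mult_right_mono) auto
    then show "q + 1 \<le> q * q" using q1 by linarith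
  qed simp
  finally have "q ^ n < q ^ Suc (Suc e)" by simp
  then have "n < Suc (Suc e)" using q1 by (metis power_less_imp_less_exp)
  then consider "e = n" | "n = Suc e" using x(3) by linarith
  then show ?thesis
  proof cases
    case 1
    have gQ: "generate G {x} = Q" using generate_eqI[OF Q(1) x(1)] x(2) cQ 1 by simp
    have "Q \<lhd> G \<or> card (conjugates Q) = q + 1"
      using cyclic_sylow_conjugates[OF xc, of q n q] x(2) 1 n q small[OF q xc x(2)] gQ n_def by auto
    then show ?thesis
    proof
      assume nQ: "Q \<lhd> G"
      interpret K: finite_group "G\<lparr>carrier := Q\<rparr>" using finite_group_subgroup[OF finite_group_axioms Q(1)] .
      have "G\<lparr>carrier := Q\<rparr> \<cong> integer_mod_group (q ^ n)"
        using K.iso_integer_mod_group[of x] x(1,2) 1 cQ ord_subgroup[OF Q(1)] by (simp add: order_def)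
      then show ?thesis using hall[OF nQ] n by (metis Suc_leI One_nat_def)
    next
      assume c: "card (conjugates Q) = q + 1"
      \<comment> \<open>For odd q the number q + 1 is even and divides the order of G, which
        contradicts the minimality of q.\<close>
      have q2: "q = 2"
      proof (rule ccontr)
        assume "q \<noteq> 2"
        then have "odd q" using q by (metis primes_dvd_imp_eq two_is_prime_nat)
        then have "2 dvd card (conjugates Q)" using c by simp
        then have "2 dvd order G" using card_sylow_conjugates_dvd[OF q Q] by (rule dvd_trans)
        then have "q \<le> 2" using q_min two_is_prime_nat by blast
        then show False using \<open>q \<noteq> 2\<close> q1 by simp
      qed
      have "odd d" using y(4) q2 by simp
      then obtain t where "t > 0" "coprime t 6" "G \<cong> metacyc (2 ^ n) 3 2 \<times>\<times> integer_mod_group t"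
        using three_conjugates_iso[OF xc _ y(1-3)] x(2) 1 q2 o c gQ by auto
      then show ?thesis using n by (metis Suc_leI One_nat_def)
    qed
  next
    case 2
    have cQ': "card Q = q * q ^ e" using cQ 2 by simp
    have nQ: "Q \<lhd> G" using noncyclic_sylow_normal[OF Q(1) cQ' x(1,2,4)] .
    have types: ?types
    proof -
      let ?K = "G\<lparr>carrier := Q\<rparr>"
      have e: "e > 0" and or: "?K \<cong> integer_mod_group (q ^ e) \<times>\<times> integer_mod_group q \<or> ?K \<cong> quaternion8 \<or>
        (e \<ge> 2 \<and> (odd q \<or> e \<ge> 3) \<and> ?K \<cong> metacyc q (q ^ e) (1 + q ^ (e - 1)))"
        using noncyclic_sylow_classification[OF Q(1) cQ' x(1,2,4)] by auto
      from or consider "?K \<cong> integer_mod_group (q ^ e) \<times>\<times> integer_mod_group q" | "?K \<cong> quaternion8"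
        | "e \<ge> 2" "odd q \<or> e \<ge> 3" "?K \<cong> metacyc q (q ^ e) (1 + q ^ (e - 1))" by blast
      then show ?thesis
      proof cases
        case 1
        \<comment> \<open>The statement measures Q by its order q^m, the classification by the order
          q^e of x; hence m = e + 1 here and in the metacyclic alternatives.\<close>
        then have "\<exists>m\<ge>2. ?K \<cong> integer_mod_group (q ^ (m - 1)) \<times>\<times> integer_mod_group q"
          using e by (intro exI[of _ "Suc e"]) auto
        then show ?thesis by blast
      next
        case 2 then show ?thesis by blast
      next
        case 3
        show ?thesis
        proof (cases "q = 2")
          case True
          then have "\<exists>m\<ge>4. ?K \<cong> metacyc 2 (2 ^ (m - 1)) (1 + 2 ^ (m - 2))"
            using 3 by (intro exI[of _ "Suc e"]) (auto simp: numeral_2_eq_2)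
          then show ?thesis using True by blast
        next
          case False
          have "\<exists>m\<ge>3. ?K \<cong> metacyc q (q ^ (m - 1)) (1 + q ^ (m - 2))"
            using 3 by (intro exI[of _ "Suc e"]) (auto simp: numeral_2_eq_2)
          moreover have "q > 2" using False q1 by simp
          ultimately show ?thesis by blast
        qed
      qed
    qed
    show ?thesis by (rule disjI1[OF conjI[OF hall[OF nQ] types]])
  qed
qed

text \<open>For each prime only one of the two factors contributes: for p = q the factor R has no
  solutions besides the unit, and for other p the factor Q has none.\<close>

lemma (in finite_group) card_Fset_nilpotent_case:
  assumes q: "Factorial_Ring.prime (q::nat)" and cQ: "card Q = q ^ N"
    and R: "cyclic_group (G\<lparr>carrier := R\<rparr>)" "\<not> q dvd card R"
    and QR: "Q \<lhd> G" "R \<lhd> G" "Q \<inter> R = {\<one>}" "Q <#> R = carrier G"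
    and types: "\<And>k. card (Fset (G\<lparr>carrier := Q\<rparr>) (q ^ k)) \<le> q * q ^ k"
    and p: "Factorial_Ring.prime p"
  shows "card (Fset G (p ^ k)) < (q + 1) * p ^ k"
proof -
  have sQ: "subgroup Q G" and sR: "subgroup R G" using QR normal_inv_iff by auto
  interpret Q: finite_group "G\<lparr>carrier := Q\<rparr>" using finite_group_subgroup[OF finite_group_axioms sQ] .
  interpret R: finite_group "G\<lparr>carrier := R\<rparr>" using finite_group_subgroup[OF finite_group_axioms sR] .
  have p0: "p > 0" using prime_gt_0_nat[OF p] .
  note le = card_Fset_direct_product_le[OF QR, of "p ^ k"]
  show ?thesis
  proof (cases "p = q")
    case True
    have "coprime (q ^ k) (card R)" using prime_imp_coprime[OF q R(2)] by simp
    then have "card (Fset (G\<lparr>carrier := R\<rparr>) (q ^ k)) = 1" using R.Fset_coprime[of "q ^ k"] by (simp add: order_def)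
    then have "card (Fset G (p ^ k)) \<le> q * p ^ k" using le types[of k] True by simp
    then show ?thesis using p0 by (simp add: le_less_trans)
  next
    case False
    then have "coprime (p ^ k) (card Q)" using p q cQ by (simp add: primes_coprime)
    then have "card (Fset (G\<lparr>carrier := Q\<rparr>) (p ^ k)) = 1" using Q.Fset_coprime[of "p ^ k"] by (simp add: order_def)
    moreover have "card (Fset (G\<lparr>carrier := R\<rparr>) (p ^ k)) \<le> p ^ k"
    proof -
      obtain z where z: "z \<in> R" "subgroup_generated (G\<lparr>carrier := R\<rparr>) {z} = G\<lparr>carrier := R\<rparr>"
        using R(1) unfolding cyclic_group_def by auto
      have "carrier (subgroup_generated (G\<lparr>carrier := R\<rparr>) {z}) = generate (G\<lparr>carrier := R\<rparr>) {z}"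
        using z(1) by (simp add: subgroup_generated_def)
      then have "carrier (G\<lparr>carrier := R\<rparr>) = generate (G\<lparr>carrier := R\<rparr>) {z}" unfolding z(2) .
      then show ?thesis using R.card_Fset_cyclic_le[of z "p ^ k"] z(1) p0 by simp
    qed
    ultimately have "card (Fset G (p ^ k)) \<le> 1 * p ^ k" using le by simp
    also have "\<dots> < (q + 1) * p ^ k" using p0 prime_gt_0_nat[OF q] by (intro mult_strict_right_mono) auto
    finally show ?thesis .
  qed
qed

text \<open>As t is coprime to 6, the primes 2 and 3 see only the metacyclic factor, and larger
  primes see only the cyclic one.\<close>

lemma (in finite_group) card_Fset_three_conjugates_case:
  assumes m: "m \<ge> 1" and t: "t > 0" "coprime t (6::nat)"
    and iso: "G \<cong> metacyc (2 ^ m) 3 2 \<times>\<times> integer_mod_group t" and p: "Factorial_Ring.prime p"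
  shows "card (Fset G (p ^ k)) < 3 * p ^ k"
proof -
  let ?H = "metacyc (2 ^ m) 3 2"
  have gH: "group ?H" using card_Fset_metacyc_3_le(4)[OF m] .
  have "finite_group (integer_mod_group t)"
    using t by (simp add: finite_group_def finite_group_axioms_def carrier_integer_mod_group)
  then interpret T: finite_group "integer_mod_group t" .
  have oT: "order (integer_mod_group t) = t" using t by (simp add: order_def carrier_integer_mod_group)
  have "card (Fset G (p ^ k)) = card (Fset (?H \<times>\<times> integer_mod_group t) (p ^ k))"
    by (rule card_Fset_iso[OF is_group _ iso]) (simp add: DirProd_group gH)
  then have eq: "card (Fset G (p ^ k)) = card (Fset ?H (p ^ k)) * card (Fset (integer_mod_group t) (p ^ k))"
    by (simp add: Fset_DirProd[OF gH] card_cartesian_product)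
  have p0: "p ^ k > 0" using prime_gt_0_nat[OF p] by simp
  have c: "coprime t 2" "coprime t 3"
  proof -
    have "coprime t (2 * 3)" using t(2) by simp
    then show "coprime t 2" "coprime t 3" by (simp_all only: coprime_mult_right_iff)
  qed
  have T1: "card (Fset (integer_mod_group t) (p ^ k)) = 1" if "coprime t p"
    using T.Fset_coprime[of "p ^ k"] oT that by (simp add: coprime_commute)
  have "p \<noteq> 0 \<and> p \<noteq> 1" using p prime_gt_1_nat by force
  then consider "p = 2" | "p = 3" | "p > 3" by linarith
  then show ?thesis
  proof cases
    case 1
    then have "card (Fset G (p ^ k)) \<le> 2 * p ^ k" using eq T1 c(1) card_Fset_metacyc_3_le(1)[OF m, of k] by simp
    then show ?thesis using p0 by linarith
  next
    case 2
    then have "card (Fset G (p ^ k)) \<le> p ^ k" using eq T1 c(2) card_Fset_metacyc_3_le(2)[OF m, of k] by simp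
    then show ?thesis using p0 by linarith
  next
    case 3
    then have "card (Fset G (p ^ k)) = card (Fset (integer_mod_group t) (p ^ k))"
      using eq card_Fset_metacyc_3_le(3)[OF m p, of k] by simp
    also have "\<dots> \<le> p ^ k" using t p0 by (intro card_Fset_integer_mod_group_le)
    finally show ?thesis using p0 by linarith
  qed
qed

theorem theorem1p1:
  fixes G :: "'a monoid" and q :: nat and Q :: "'a set"
  assumes grp: "group G"
    and fin: "finite (carrier G)"
    and gt1: "order G > 1"
    and q_prime: "Factorial_Ring.prime q" and q_dvd: "q dvd order G"
    and q_min: "\<forall>p. Factorial_Ring.prime p \<and> p dvd order G \<longrightarrow> q \<le> p"
    and sylow: "subgroup Q G" "card Q = q ^ multiplicity q (order G)"
  shows "mf_pp G \<le> q \<longleftrightarrow>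
    ((\<exists>R. subgroup R G \<and> cyclic_group (G\<lparr>carrier := R\<rparr>)
          \<and> \<not> q dvd card R \<and> (\<exists>k. order G = card R * q ^ k)
          \<and> Q \<lhd> G \<and> R \<lhd> G \<and> Q \<inter> R = {\<one>\<^bsub>G\<^esub>} \<and> Q <#>\<^bsub>G\<^esub> R = carrier G)
      \<and> ((\<exists>m\<ge>1. G\<lparr>carrier := Q\<rparr> \<cong> integer_mod_group (q ^ m))
         \<or> (\<exists>m\<ge>2. G\<lparr>carrier := Q\<rparr> \<cong> DirProd (integer_mod_group (q ^ (m - 1))) (integer_mod_group q))
         \<or> G\<lparr>carrier := Q\<rparr> \<cong> quaternion8
         \<or> (q = 2 \<and> (\<exists>m\<ge>4. G\<lparr>carrier := Q\<rparr> \<cong> metacyc 2 (2 ^ (m - 1)) (1 + 2 ^ (m - 2))))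
         \<or> (q > 2 \<and> (\<exists>m\<ge>3. G\<lparr>carrier := Q\<rparr> \<cong> metacyc q (q ^ (m - 1)) (1 + q ^ (m - 2))))))
    \<or> (\<exists>m\<ge>1. \<exists>t>0. coprime t 6 \<and>
          G \<cong> DirProd (metacyc (2 ^ m) 3 2) (integer_mod_group t))"
proof -
  interpret finite_group G using grp fin by (simp add: finite_group_def finite_group_axioms_def)
  show ?thesis (is "?lhs \<longleftrightarrow> ?nil \<or> ?three")
  proof
    assume ?lhs
    interpret small_frobenius_quotients G q
    proof unfold_locales
      \<comment> \<open>The locale asks for the bound at prime powers that are orders of elements,
        and these divide the exponent.\<close>
      show "card (Fset G (p ^ k)) < (q + 1) * p ^ k"
        if "Factorial_Ring.prime p" "x \<in> carrier G" "ord x = p ^ k" for p k x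
        using \<open>?lhs\<close> that ord_dvd_group_exponent[OF that(2)] unfolding mf_pp_le_iff by simp
    qed (use q_prime q_dvd q_min in auto)
    show "?nil \<or> ?three" by (rule classification[OF sylow])
  next
    assume "?nil \<or> ?three"
    then show ?lhs
    proof
      assume nil: ?nil
      then obtain R where R: "cyclic_group (G\<lparr>carrier := R\<rparr>)" "\<not> q dvd card R"
        "Q \<lhd> G" "R \<lhd> G" "Q \<inter> R = {\<one>\<^bsub>G\<^esub>}" "Q <#>\<^bsub>G\<^esub> R = carrier G" by blast
      interpret K: finite_group "G\<lparr>carrier := Q\<rparr>"
        using finite_group_subgroup[OF finite_group_axioms sylow(1)] .
      have "card (Fset (G\<lparr>carrier := Q\<rparr>) (q ^ k)) \<le> q * q ^ k" for k
        by (rule K.card_Fset_sylow_types_le[OF q_prime, of "multiplicity q (order G)"])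
          (use sylow(2) nil in \<open>simp_all add: order_def\<close>)
      then show ?lhs unfolding mf_pp_le_iff
        using card_Fset_nilpotent_case[OF q_prime sylow(2) R] by blast
    next
      assume ?three
      then obtain m t where mt: "m \<ge> 1" "t > 0" "coprime t (6::nat)"
        "G \<cong> metacyc (2 ^ m) 3 2 \<times>\<times> integer_mod_group t" by blast
      \<comment> \<open>This alternative does not mention q. Since the order is even, the smallest
        prime divisor is 2, and the bound 3 p^k becomes (q + 1) p^k.\<close>
      have "order G = 2 ^ m * 3 * t"
        using iso_same_card[OF mt(4)] mt(2) by (simp add: order_def metacyc_def carrier_integer_mod_group)
      then have "2 dvd order G" using mt(1) by simp
      then have "q \<le> 2" using q_min two_is_prime_nat by blast
      then have "q = 2" using prime_gt_1_nat[OF q_prime] by simp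
      then show ?lhs unfolding mf_pp_le_iff using card_Fset_three_conjugates_case[OF mt] by simp
    qed
  qed
qed

end
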